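(* Let $X$ be a measure space, $r\colon X\to X$ a measurable, finite-to-one, onto map, $\mu$ a strongly $r$-invariant probability measure on $X$, $m_0\in L^\infty(X)$ not vanishing on any set of positive measure, and $h\in L^1(X)$, $h\ge0$, with $Rh=h$. Let $\hat\mu$, $\omega_n$, $U$, $\pi$, $\varphi$, $H_n$, $i_n$ and the Hilbert space $\mathcal{H}$ be as defined in the context. Then the map $\Phi\colon L^2(X_\infty,\hat\mu)\to\mathcal{H}$ defined by $$\Phi(f)=(i_n^{-1}(P_nf))_{n\ge 0},$$ where $P_n$ is the orthogonal projection onto $H_n$, is an isomorphism of Hilbert spaces. The transform $\Phi$ satisfies the following three conditions, and it is determined uniquely by them: $$\Phi U\Phi^{-1}(\xi_n)_{n\ge0}=(m_0\circ r^n\,\xi_{n+1})_{n\ge0},$$ $$\Phi\pi(g)\Phi^{-1}(\xi_n)_{n\ge0}=(g\circ r^n\,\xi_n)_{n\ge0},\qquad g\in L^\infty(X),$$ $$\Phi\varphi=(1,1,\dots).$$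
   Context: Strong $r$-invariance: $\int_X f\,d\mu=\int_X\frac{1}{\#r^{-1}(x)}\sum_{r(y)=x}f(y)\,d\mu(x)$ for all $f\in L^\infty(X)$ (fibre averages being measurable). $R$ is the operator $(R\xi)(x)=\frac{1}{\#r^{-1}(x)}\sum_{r(y)=x}|m_0(y)|^2\xi(y)$, $\xi\in L^1(X)$. The measures $\omega_n$ on $X$ are given by $\omega_n(f)=\int_X R^n(fh)\,d\mu$, $f\in L^\infty(X)$, $n\ge0$. $X_\infty=\{(x_0,x_1,\dots)\mid x_n\in X,\ r(x_{n+1})=x_n\text{ for all }n\ge0\}$ with the $\sigma$-algebra generated by the projections $\theta_n(x_0,x_1,\dots)=x_n$; $\hat r(x_0,x_1,\dots)=(r(x_0),x_0,x_1,\dots)$, a bijection of $X_\infty$. $\hat\mu$ is the unique measure on $X_\infty$ with $\hat\mu\circ\theta_n^{-1}=\omega_n$ for all $n\ge0$. Functions $f$ on $X$ are identified with functions $f\circ\theta_0$ on $X_\infty$. On $L^2(X_\infty,\hat\mu)$: $Uf=(m_0\circ\theta_0)\,(f\circ\hat r)$ (a unitary operator), $\pi(g)f=(g\circ\theta_0)f$ for $g\in L^\infty(X)$, and $\varphi=1$. $H_n:=\{f\in L^2(X_\infty,\hat\mu)\mid f=\xi\circ\theta_n,\ \xi\in L^2(X,\omega_n)\}$, an increasing sequence of closed subspaces with dense union, and $i_n\colon L^2(X,\omega_n)\to H_n$, $i_n(\xi)=\xi\circ\theta_n$, a unitary isomorphism. $\mathcal{H}$ is the space of sequences $(\xi_0,\xi_1,\dots)$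 with $\xi_n\in L^2(X,\omega_n)$, $R(\xi_{n+1}h)=\xi_nh$ for all $n$, and $\sup_n\int_XR^n(|\xi_n|^2h)\,d\mu<\infty$, with scalar product $\langle(\xi_n)\mid(\eta_n)\rangle=\lim_{n\to\infty}\int_XR^n(\overline{\xi_n}\,\eta_nh)\,d\mu$. *)

theory Defs
  imports "HOL-Probability.Probability"
begin

text \<open>
  The spaces below depend on a measure, hence on a term, so they cannot be types. Scalar products
  are linear in the second argument.
\<close>

record 'v hspace =
  hcarrier :: "'v set"
  hzero :: 'v
  hadd :: "'v \<Rightarrow> 'v \<Rightarrow> 'v"
  hscale :: "complex \<Rightarrow> 'v \<Rightarrow> 'v"
  hinner :: "'v \<Rightarrow> 'v \<Rightarrow> complex"

definition hdiff :: "'v hspace \<Rightarrow> 'v \<Rightarrow> 'v \<Rightarrow> 'v" where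
  "hdiff V x y = hadd V x (hscale V (- 1) y)"

definition hnorm :: "'v hspace \<Rightarrow> 'v \<Rightarrow> real" where
  "hnorm V x = sqrt (Re (hinner V x x))"

locale complex_hilbert_space =
  fixes V :: "'v hspace"
  assumes zero_closed: "hzero V \<in> hcarrier V"
    and add_closed: "\<lbrakk>x \<in> hcarrier V; y \<in> hcarrier V\<rbrakk> \<Longrightarrow> hadd V x y \<in> hcarrier V"
    and scale_closed: "x \<in> hcarrier V \<Longrightarrow> hscale V a x \<in> hcarrier V"
    and add_assoc: "\<lbrakk>x \<in> hcarrier V; y \<in> hcarrier V; z \<in> hcarrier V\<rbrakk>
          \<Longrightarrow> hadd V (hadd V x y) z = hadd V x (hadd V y z)"
    and add_commute: "\<lbrakk>x \<in> hcarrier V; y \<in> hcarrier V\<rbrakk> \<Longrightarrow> hadd V x y = hadd V y x"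
    and add_zero: "x \<in> hcarrier V \<Longrightarrow> hadd V x (hzero V) = x"
    and diff_self: "x \<in> hcarrier V \<Longrightarrow> hdiff V x x = hzero V"
    and scale_add_right: "\<lbrakk>x \<in> hcarrier V; y \<in> hcarrier V\<rbrakk>
          \<Longrightarrow> hscale V a (hadd V x y) = hadd V (hscale V a x) (hscale V a y)"
    and scale_add_left: "x \<in> hcarrier V
          \<Longrightarrow> hscale V (a + b) x = hadd V (hscale V a x) (hscale V b x)"
    and scale_scale: "x \<in> hcarrier V \<Longrightarrow> hscale V a (hscale V b x) = hscale V (a * b) x"
    and scale_one: "x \<in> hcarrier V \<Longrightarrow> hscale V 1 x = x"
    and inner_commute: "\<lbrakk>x \<in> hcarrier V; y \<in> hcarrier V\<rbrakk> \<Longrightarrow> hinner V y x = cnj (hinner V x y)"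
    and inner_add_right: "\<lbrakk>x \<in> hcarrier V; y \<in> hcarrier V; z \<in> hcarrier V\<rbrakk>
          \<Longrightarrow> hinner V x (hadd V y z) = hinner V x y + hinner V x z"
    and inner_scale_right: "\<lbrakk>x \<in> hcarrier V; y \<in> hcarrier V\<rbrakk>
          \<Longrightarrow> hinner V x (hscale V a y) = a * hinner V x y"
    and inner_nonneg: "x \<in> hcarrier V \<Longrightarrow> 0 \<le> Re (hinner V x x)"
    and inner_definite: "\<lbrakk>x \<in> hcarrier V; hinner V x x = 0\<rbrakk> \<Longrightarrow> x = hzero V"
    and complete: "\<lbrakk>\<And>n. X n \<in> hcarrier V;
          \<forall>e>0. \<exists>N::nat. \<forall>m\<ge>N. \<forall>n\<ge>N. hnorm V (hdiff V (X m) (X n)) < e\<rbrakk>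
          \<Longrightarrow> \<exists>L\<in>hcarrier V. (\<lambda>n. hnorm V (hdiff V (X n) L)) \<longlonglongrightarrow> 0"

definition hilbert_isomorphism :: "'v hspace \<Rightarrow> 'w hspace \<Rightarrow> ('v \<Rightarrow> 'w) \<Rightarrow> bool" where
  "hilbert_isomorphism V W T \<longleftrightarrow>
     complex_hilbert_space V \<and> complex_hilbert_space W \<and>
     bij_betw T (hcarrier V) (hcarrier W) \<and>
     (\<forall>x\<in>hcarrier V. \<forall>y\<in>hcarrier V. T (hadd V x y) = hadd W (T x) (T y)) \<and>
     (\<forall>a. \<forall>x\<in>hcarrier V. T (hscale V a x) = hscale W a (T x)) \<and>
     (\<forall>x\<in>hcarrier V. \<forall>y\<in>hcarrier V. hinner W (T x) (T y) = hinner V x y)"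

definition orth_proj :: "'v hspace \<Rightarrow> 'v set \<Rightarrow> 'v \<Rightarrow> 'v" where
  "orth_proj V S x = (THE p. p \<in> S \<and> (\<forall>k\<in>S. hinner V k (hdiff V x p) = 0))"

text \<open>
  Elements of the space of square integrable functions are almost everywhere classes of
  functions. Operations pick a representative with \<open>rep\<close> and take the class of the result.
\<close>

definition ae_class :: "'a measure \<Rightarrow> ('a \<Rightarrow> complex) \<Rightarrow> ('a \<Rightarrow> complex) set" where
  "ae_class M f = {g \<in> borel_measurable M. AE x in M. g x = f x}"

definition rep :: "('a \<Rightarrow> complex) set \<Rightarrow> 'a \<Rightarrow> complex" where
  "rep F = (SOME f. f \<in> F)"

definition L2 :: "'a measure \<Rightarrow> ('a \<Rightarrow> complex) set hspace" where
  "L2 M = \<lparr>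
     hcarrier = ae_class M `
       {f \<in> borel_measurable M. integrable M (\<lambda>x. (cmod (f x))\<^sup>2)},
     hzero = ae_class M (\<lambda>_. 0),
     hadd = (\<lambda>F G. ae_class M (\<lambda>x. rep F x + rep G x)),
     hscale = (\<lambda>a F. ae_class M (\<lambda>x. a * rep F x)),
     hinner = (\<lambda>F G. \<integral>x. cnj (rep F x) * rep G x \<partial>M) \<rparr>"

text \<open>Essentially bounded functions; here honest functions, not classes.\<close>

definition Linf :: "'a measure \<Rightarrow> ('a \<Rightarrow> complex) set" where
  "Linf M = {f \<in> borel_measurable M. \<exists>C. AE x in M. cmod (f x) \<le> C}"

definition fibre :: "'a measure \<Rightarrow> ('a \<Rightarrow> 'a) \<Rightarrow> 'a \<Rightarrow> 'a set" where
  "fibre M r x = {y \<in> space M. r y = x}"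

definition fibre_avg :: "'a measure \<Rightarrow> ('a \<Rightarrow> 'a) \<Rightarrow> ('a \<Rightarrow> complex) \<Rightarrow> 'a \<Rightarrow> complex" where
  "fibre_avg M r f x = (1 / of_nat (card (fibre M r x))) * (\<Sum>y\<in>fibre M r x. f y)"

definition strongly_invariant :: "'a measure \<Rightarrow> ('a \<Rightarrow> 'a) \<Rightarrow> bool" where
  "strongly_invariant M r \<longleftrightarrow>
     (\<forall>f\<in>Linf M. fibre_avg M r f \<in> borel_measurable M \<and>
        (\<integral>x. f x \<partial>M) = (\<integral>x. fibre_avg M r f x \<partial>M))"

definition transfer_op ::
  "'a measure \<Rightarrow> ('a \<Rightarrow> 'a) \<Rightarrow> ('a \<Rightarrow> complex) \<Rightarrow> ('a \<Rightarrow> complex) \<Rightarrow> 'a \<Rightarrow> complex" where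
  "transfer_op M r m0 \<xi> = fibre_avg M r (\<lambda>y. complex_of_real ((cmod (m0 y))\<^sup>2) * \<xi> y)"

definition transfer_integral ::
  "'a measure \<Rightarrow> ('a \<Rightarrow> 'a) \<Rightarrow> ('a \<Rightarrow> complex) \<Rightarrow> ('a \<Rightarrow> real) \<Rightarrow> nat \<Rightarrow> ('a \<Rightarrow> complex) \<Rightarrow> complex"
  where "transfer_integral M r m0 h n f =
     (\<integral>x. (transfer_op M r m0 ^^ n) (\<lambda>y. f y * complex_of_real (h y)) x \<partial>M)"

text \<open>
  Finiteness excludes infinite measures, for which the Bochner integral may default to \<open>0\<close>
  (relevant e.g. when \<open>h = 0\<close>). The measure is \<open>h\<close> times
  \<open>\<Prod>k<n. |m0 (r\<^sup>k x)|\<^sup>2\<close> relative to \<open>M\<close>.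
\<close>

definition omega ::
  "'a measure \<Rightarrow> ('a \<Rightarrow> 'a) \<Rightarrow> ('a \<Rightarrow> complex) \<Rightarrow> ('a \<Rightarrow> real) \<Rightarrow> nat \<Rightarrow> 'a measure" where
  "omega M r m0 h n = (THE N. sets N = sets M \<and> finite_measure N \<and>
     (\<forall>f\<in>Linf M. (\<integral>x. f x \<partial>N) = transfer_integral M r m0 h n f))"

definition path_space :: "'a measure \<Rightarrow> ('a \<Rightarrow> 'a) \<Rightarrow> (nat \<Rightarrow> 'a) set" where
  "path_space M r = {x. \<forall>n. x n \<in> space M \<and> r (x (Suc n)) = x n}"

definition theta :: "nat \<Rightarrow> (nat \<Rightarrow> 'a) \<Rightarrow> 'a" where
  "theta n x = x n"

definition path_sigma :: "'a measure \<Rightarrow> ('a \<Rightarrow> 'a) \<Rightarrow> (nat \<Rightarrow> 'a) measure" where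
  "path_sigma M r = sigma (path_space M r)
     {theta n -` A \<inter> path_space M r | n A. A \<in> sets M}"

definition rhat :: "('a \<Rightarrow> 'a) \<Rightarrow> (nat \<Rightarrow> 'a) \<Rightarrow> nat \<Rightarrow> 'a" where
  "rhat r x = case_nat (r (x 0)) x"

definition muhat ::
  "'a measure \<Rightarrow> ('a \<Rightarrow> 'a) \<Rightarrow> ('a \<Rightarrow> complex) \<Rightarrow> ('a \<Rightarrow> real) \<Rightarrow> (nat \<Rightarrow> 'a) measure" where
  "muhat M r m0 h = (THE P. sets P = sets (path_sigma M r) \<and>
     (\<forall>n. distr P M (theta n) = omega M r m0 h n))"

definition U_op ::
  "'a measure \<Rightarrow> ('a \<Rightarrow> 'a) \<Rightarrow> ('a \<Rightarrow> complex) \<Rightarrow> ('a \<Rightarrow> real)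
     \<Rightarrow> ((nat \<Rightarrow> 'a) \<Rightarrow> complex) set \<Rightarrow> ((nat \<Rightarrow> 'a) \<Rightarrow> complex) set" where
  "U_op M r m0 h F = ae_class (muhat M r m0 h) (\<lambda>x. m0 (theta 0 x) * rep F (rhat r x))"

definition pi_op ::
  "'a measure \<Rightarrow> ('a \<Rightarrow> 'a) \<Rightarrow> ('a \<Rightarrow> complex) \<Rightarrow> ('a \<Rightarrow> real) \<Rightarrow> ('a \<Rightarrow> complex)
     \<Rightarrow> ((nat \<Rightarrow> 'a) \<Rightarrow> complex) set \<Rightarrow> ((nat \<Rightarrow> 'a) \<Rightarrow> complex) set" where
  "pi_op M r m0 h g F = ae_class (muhat M r m0 h) (\<lambda>x. g (theta 0 x) * rep F x)"

definition phi_vec ::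
  "'a measure \<Rightarrow> ('a \<Rightarrow> 'a) \<Rightarrow> ('a \<Rightarrow> complex) \<Rightarrow> ('a \<Rightarrow> real) \<Rightarrow> ((nat \<Rightarrow> 'a) \<Rightarrow> complex) set" where
  "phi_vec M r m0 h = ae_class (muhat M r m0 h) (\<lambda>_. 1)"

definition i_map ::
  "'a measure \<Rightarrow> ('a \<Rightarrow> 'a) \<Rightarrow> ('a \<Rightarrow> complex) \<Rightarrow> ('a \<Rightarrow> real) \<Rightarrow> nat
     \<Rightarrow> ('a \<Rightarrow> complex) set \<Rightarrow> ((nat \<Rightarrow> 'a) \<Rightarrow> complex) set" where
  "i_map M r m0 h n \<xi> = ae_class (muhat M r m0 h) (\<lambda>x. rep \<xi> (theta n x))"

definition H_sub ::
  "'a measure \<Rightarrow> ('a \<Rightarrow> 'a) \<Rightarrow> ('a \<Rightarrow> complex) \<Rightarrow> ('a \<Rightarrow> real) \<Rightarrow> nat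
     \<Rightarrow> ((nat \<Rightarrow> 'a) \<Rightarrow> complex) set set" where
  "H_sub M r m0 h n = {F \<in> hcarrier (L2 (muhat M r m0 h)).
     \<exists>\<xi>\<in>hcarrier (L2 (omega M r m0 h n)). F = i_map M r m0 h n \<xi>}"

text \<open>
  Nothing below depends on the chosen representatives: when \<open>m0\<close> is almost everywhere nonzero
  and \<open>M\<close> is strongly invariant, the null sets of \<open>omega M r m0 h n\<close> are those of the
  measure with density \<open>h\<close>, for every \<open>n\<close>.
\<close>

definition seq_space ::
  "'a measure \<Rightarrow> ('a \<Rightarrow> 'a) \<Rightarrow> ('a \<Rightarrow> complex) \<Rightarrow> ('a \<Rightarrow> real)
     \<Rightarrow> (nat \<Rightarrow> ('a \<Rightarrow> complex) set) hspace" where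
  "seq_space M r m0 h = \<lparr>
     hcarrier = {\<xi>.
       (\<forall>n. \<xi> n \<in> hcarrier (L2 (omega M r m0 h n))) \<and>
       (\<forall>n. AE x in M. transfer_op M r m0 (\<lambda>y. rep (\<xi> (Suc n)) y * complex_of_real (h y)) x
               = rep (\<xi> n) x * complex_of_real (h x)) \<and>
       bdd_above (range (\<lambda>n. Re (transfer_integral M r m0 h n
               (\<lambda>y. complex_of_real ((cmod (rep (\<xi> n) y))\<^sup>2)))))},
     hzero = (\<lambda>n. hzero (L2 (omega M r m0 h n))),
     hadd = (\<lambda>\<xi> \<eta> n. hadd (L2 (omega M r m0 h n)) (\<xi> n) (\<eta> n)),
     hscale = (\<lambda>a \<xi> n. hscale (L2 (omega M r m0 h n)) a (\<xi> n)),
     hinner = (\<lambda>\<xi> \<eta>. lim (\<lambda>n. transfer_integral M r m0 h n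
               (\<lambda>y. cnj (rep (\<xi> n) y) * rep (\<eta> n) y))) \<rparr>"

definition Phi ::
  "'a measure \<Rightarrow> ('a \<Rightarrow> 'a) \<Rightarrow> ('a \<Rightarrow> complex) \<Rightarrow> ('a \<Rightarrow> real)
     \<Rightarrow> ((nat \<Rightarrow> 'a) \<Rightarrow> complex) set \<Rightarrow> nat \<Rightarrow> ('a \<Rightarrow> complex) set" where
  "Phi M r m0 h F = (\<lambda>n. inv_into (hcarrier (L2 (omega M r m0 h n))) (i_map M r m0 h n)
     (orth_proj (L2 (muhat M r m0 h)) (H_sub M r m0 h n) F))"

definition transform_conditions ::
  "'a measure \<Rightarrow> ('a \<Rightarrow> 'a) \<Rightarrow> ('a \<Rightarrow> complex) \<Rightarrow> ('a \<Rightarrow> real)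
     \<Rightarrow> (((nat \<Rightarrow> 'a) \<Rightarrow> complex) set \<Rightarrow> nat \<Rightarrow> ('a \<Rightarrow> complex) set) \<Rightarrow> bool" where
  "transform_conditions M r m0 h T \<longleftrightarrow>
     (\<forall>\<xi>\<in>hcarrier (seq_space M r m0 h).
        T (U_op M r m0 h (inv_into (hcarrier (L2 (muhat M r m0 h))) T \<xi>)) =
        (\<lambda>n. ae_class (omega M r m0 h n) (\<lambda>x. m0 ((r ^^ n) x) * rep (\<xi> (Suc n)) x))) \<and>
     (\<forall>g\<in>Linf M. \<forall>\<xi>\<in>hcarrier (seq_space M r m0 h).
        T (pi_op M r m0 h g (inv_into (hcarrier (L2 (muhat M r m0 h))) T \<xi>)) =
        (\<lambda>n. ae_class (omega M r m0 h n) (\<lambda>x. g ((r ^^ n) x) * rep (\<xi> n) x))) \<and>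
     T (phi_vec M r m0 h) = (\<lambda>n. ae_class (omega M r m0 h n) (\<lambda>_. 1))"

end

theory Submission
  imports Defs
begin

text \<open>
  The measure \<open>omega n\<close> has density \<open>h * (\<Prod>k<n. |m0 (r\<^sup>k x)|\<^sup>2)\<close>, by moving the
  transfer operator across the integral. The measures \<open>omega n\<close> form a projective system, and the
  Kolmogorov extension exists without topological assumptions on \<open>X\<close>: if cylinder sets decrease to the
  empty set then so do their images under \<open>theta 0\<close>, because the fibres of \<open>theta 0\<close> are inverse
  limits of finite sets.

  The relation \<open>R (\<xi>\<^sub>n\<^sub>+\<^sub>1 h) = \<xi>\<^sub>n h\<close> says exactly that \<open>\<xi>\<^sub>n \<circ> theta n\<close> is the projection of
  \<open>\<xi>\<^sub>n\<^sub>+\<^sub>1 \<circ> theta (n + 1)\<close> onto level \<open>n\<close>, so \<open>\<H>\<close> consists of the martingales bounded in the mean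
  square and \<open>Phi\<close> is inverse to taking the limit of such a martingale. The formula for \<open>U\<close> follows from
  the change of variables \<open>\<integral>|m0 \<circ> theta 0|\<^sup>2 (f \<circ> rhat) = \<integral>f\<close>.

  A second transform \<open>\<Psi>\<close> agrees with \<open>Phi\<close> on \<open>\<phi>\<close>, hence on \<open>\<pi>(g)\<phi>\<close>, and, as the condition on \<open>U\<close>
  determines \<open>\<Psi> f\<close> from \<open>\<Psi> (U f)\<close>, by induction on all \<open>b \<circ> theta n\<close> with \<open>b\<close> bounded; these are total.
\<close>

section \<open>Square integrable functions\<close>

text \<open>The delicate point in the extension is measurability: continuity from above is applied
  to images of cylinders under \<open>theta 0\<close>, and forward images of measurable sets need
  not be measurable. Strong invariance repairs this, because it makes fibre averages measurable and
  \<open>r\<close> maps a measurable \<open>A\<close> onto the set where the average of the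
  indicator of \<open>A\<close> is nonzero. The same average, integrated, shows that almost every
  fibre avoids a given null set, which lets almost everywhere identities pass through the transfer
  operator.

  Invariance is postulated for essentially bounded functions, whereas \<open>h\<close> and the
  entries of \<open>\<H>\<close> may be unbounded; truncation extends it to integrable functions,
  fibre sums being finite.

  \<open>omega\<close>, \<open>muhat\<close> and \<open>orth_proj\<close> are definite descriptions,
  so each needs existence and uniqueness before anything can be computed. Projections and limits are
  handled on functions, through the weak characterisation \<open>is_proj\<close>, and carried over
  to classes when the transform is assembled. The Hilbert space laws of \<open>\<H>\<close>, whose
  scalar product is a limit, are transported along \<open>Phi\<close>.\<close>

lemma borel_measurable_cnj [measurable (raw)]:
  "f \<in> borel_measurable M \<Longrightarrow> (\<lambda>x. cnj (f x)) \<in> borel_measurable M"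
  by (rule borel_measurable_continuous_on[OF continuous_on_cnj[OF continuous_on_id]])

text \<open>Functions rather than classes, so that computations are pointwise;
  \<open>carrier_L2\<close> recovers the carrier as the set of their classes.\<close>

definition sq_int :: "'a measure \<Rightarrow> ('a \<Rightarrow> complex) set" where
  "sq_int M = {f \<in> borel_measurable M. integrable M (\<lambda>x. (cmod (f x))\<^sup>2)}"

abbreviation sq_norm :: "'a measure \<Rightarrow> ('a \<Rightarrow> complex) \<Rightarrow> real" where
  "sq_norm M f \<equiv> \<integral>x. (cmod (f x))\<^sup>2 \<partial>M"

lemma sq_int_measurable [dest]: "f \<in> sq_int M \<Longrightarrow> f \<in> borel_measurable M"
  by (simp add: sq_int_def)

lemma sq_int_integrable: "f \<in> sq_int M \<Longrightarrow> integrable M (\<lambda>x. (cmod (f x))\<^sup>2)"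
  by (simp add: sq_int_def)

lemma sq_int_zero [simp]: "(\<lambda>_. 0) \<in> sq_int M"
  by (simp add: sq_int_def)

lemma sq_int_dominated:
  assumes "f \<in> borel_measurable M" "integrable M w" "AE x in M. (cmod (f x))\<^sup>2 \<le> w x"
  shows "f \<in> sq_int M"
proof -
  have "integrable M (\<lambda>x. (cmod (f x))\<^sup>2)"
    by (rule Bochner_Integration.integrable_bound[OF assms(2)]) (use assms in auto)
  then show ?thesis using assms(1) by (simp add: sq_int_def)
qed

lemma sq_int_scale: "f \<in> sq_int M \<Longrightarrow> (\<lambda>x. c * f x) \<in> sq_int M"
  by (auto simp: sq_int_def norm_mult power_mult_distrib)

lemma cmod_add_sq_le: "(cmod (a + b))\<^sup>2 \<le> 2 * (cmod a)\<^sup>2 + 2 * (cmod b)\<^sup>2"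
proof -
  have "(cmod (a + b))\<^sup>2 \<le> (cmod a + cmod b)\<^sup>2"
    by (intro power_mono norm_triangle_ineq) auto
  also have "\<dots> \<le> 2 * (cmod a)\<^sup>2 + 2 * (cmod b)\<^sup>2"
    using sum_squares_bound[of "cmod a" "cmod b"] by (simp add: power2_sum)
  finally show ?thesis .
qed

lemma sq_int_add: "f \<in> sq_int M \<Longrightarrow> g \<in> sq_int M \<Longrightarrow> (\<lambda>x. f x + g x) \<in> sq_int M"
  by (rule sq_int_dominated[where w = "\<lambda>x. 2 * (cmod (f x))\<^sup>2 + 2 * (cmod (g x))\<^sup>2"])
     (auto simp: sq_int_def cmod_add_sq_le)

lemma sq_int_diff:
  assumes "f \<in> sq_int M" "g \<in> sq_int M"
  shows "(\<lambda>x. f x - g x) \<in> sq_int M"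
  using sq_int_add[OF assms(1) sq_int_scale[OF assms(2), of "-1"]] by simp

lemma sq_int_cong_AE:
  assumes "f \<in> sq_int M" "g \<in> borel_measurable M" "AE x in M. g x = f x"
  shows "g \<in> sq_int M"
  by (rule sq_int_dominated[OF assms(2) sq_int_integrable[OF assms(1)]]) (use assms(3) in auto)

lemma sq_int_bounded_mult:
  assumes "f \<in> sq_int M" "g \<in> Linf M"
  shows "(\<lambda>x. g x * f x) \<in> sq_int M"
proof -
  from assms(2) obtain C where C: "AE x in M. cmod (g x) \<le> C" and g: "g \<in> borel_measurable M"
    by (auto simp: Linf_def)
  have "AE x in M. (cmod (g x * f x))\<^sup>2 \<le> C\<^sup>2 * (cmod (f x))\<^sup>2"
    using C
  proof eventually_elim
    case (elim x)
    have "(cmod (g x))\<^sup>2 \<le> C\<^sup>2" using elim by (intro power_mono) auto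
    then show ?case by (auto simp: norm_mult power_mult_distrib intro: mult_right_mono)
  qed
  then show ?thesis
    using assms(1) g by (intro sq_int_dominated[where w = "\<lambda>x. C\<^sup>2 * (cmod (f x))\<^sup>2"])
      (auto simp: sq_int_def)
qed

lemma Linf_sq_int:
  assumes "finite_measure M" "g \<in> Linf M"
  shows "g \<in> sq_int M"
proof -
  have "(\<lambda>_. 1) \<in> sq_int M"
    using finite_measure.integrable_const[OF assms(1), of "1::real"] by (simp add: sq_int_def)
  from sq_int_bounded_mult[OF this assms(2)] show ?thesis by simp
qed

lemma integrable_cnj_mult:
  assumes "f \<in> sq_int M" "g \<in> sq_int M"
  shows "integrable M (\<lambda>x. cnj (f x) * g x)"
proof (rule Bochner_Integration.integrable_bound)
  show "integrable M (\<lambda>x. (cmod (f x))\<^sup>2 + (cmod (g x))\<^sup>2)"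
    using assms by (simp add: sq_int_def)
  show "(\<lambda>x. cnj (f x) * g x) \<in> borel_measurable M"
    using assms by (auto intro!: borel_measurable_times borel_measurable_cnj)
  have "cmod (f x) * cmod (g x) \<le> (cmod (f x))\<^sup>2 + (cmod (g x))\<^sup>2" for x
    using sum_squares_bound[of "cmod (f x)" "cmod (g x)"]
      mult_nonneg_nonneg[OF norm_ge_zero norm_ge_zero, of "f x" "g x"] by linarith
  then show "AE x in M. norm (cnj (f x) * g x) \<le> norm ((cmod (f x))\<^sup>2 + (cmod (g x))\<^sup>2)"
    by (auto simp: norm_mult)
qed

lemma integral_cnj_self: "(\<integral>x. cnj (f x) * f x \<partial>M) = complex_of_real (sq_norm M f)"
proof -
  have "(\<integral>x. cnj (f x) * f x \<partial>M) = (\<integral>x. complex_of_real ((cmod (f x))\<^sup>2) \<partial>M)"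
    by (intro Bochner_Integration.integral_cong refl)
       (simp add: complex_norm_square mult.commute del: of_real_power)
  then show ?thesis by (simp only: integral_complex_of_real)
qed

lemma sq_norm_nonneg: "0 \<le> sq_norm M f"
  by simp

lemma sq_norm_zero_AE:
  assumes "f \<in> sq_int M" "sq_norm M f = 0"
  shows "AE x in M. f x = 0"
  using integral_nonneg_eq_0_iff_AE[OF sq_int_integrable[OF assms(1)]] assms(2) by simp

lemma cmod_diff_scale_sq:
  "(cmod (u - c * k))\<^sup>2 = (cmod u)\<^sup>2 - 2 * Re (cnj c * (cnj k * u)) + (cmod c)\<^sup>2 * (cmod k)\<^sup>2"
  unfolding cmod_power2 by (simp add: algebra_simps power2_eq_square)

text \<open>Serves three times: for Cauchy-Schwarz, for the variational argument in
  \<open>sq_int_projection\<close>, and as Pythagoras in \<open>sq_norm_diff_proj\<close>.\<close>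

lemma sq_norm_diff_scale:
  assumes "u \<in> sq_int M" "k \<in> sq_int M"
  shows "sq_norm M (\<lambda>x. u x - c * k x) =
    sq_norm M u - 2 * Re (cnj c * (\<integral>x. cnj (k x) * u x \<partial>M)) + (cmod c)\<^sup>2 * sq_norm M k"
proof -
  have i: "integrable M (\<lambda>x. cnj c * (cnj (k x) * u x))"
    using integrable_cnj_mult[OF assms(2,1)] by (intro integrable_mult_right) auto
  have "(\<integral>x. Re (cnj c * (cnj (k x) * u x)) \<partial>M) = Re (cnj c * (\<integral>x. cnj (k x) * u x \<partial>M))"
    using i integrable_cnj_mult[OF assms(2,1)] by (subst integral_Re) auto
  then show ?thesis
    unfolding cmod_diff_scale_sq
    using integrable_Re[OF i] assms[THEN sq_int_integrable]
    by (simp only: Bochner_Integration.integral_add Bochner_Integration.integral_diff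
          integral_mult_right_zero Bochner_Integration.integrable_diff integrable_mult_right)
qed

text \<open>The squared norm of \<open>u - t z k\<close>, with \<open>z\<close> the inner product,
  is a nonnegative quadratic in \<open>t\<close>, evaluated at its minimum \<open>t = 1 / K\<close>
  where \<open>K\<close> is the squared norm of \<open>k\<close>. If \<open>K = 0\<close> then
  \<open>k\<close> vanishes almost everywhere.\<close>

lemma Cauchy_Schwarz_integral:
  assumes "k \<in> sq_int M" "u \<in> sq_int M"
  shows "(cmod (\<integral>x. cnj (k x) * u x \<partial>M))\<^sup>2 \<le> sq_norm M k * sq_norm M u"
proof -
  define z where "z = (\<integral>x. cnj (k x) * u x \<partial>M)"
  let ?K = "sq_norm M k"
  have main: "0 \<le> sq_norm M u - 2 * t * (cmod z)\<^sup>2 + t\<^sup>2 * (cmod z)\<^sup>2 * ?K" for t :: real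
  proof -
    have "0 \<le> sq_norm M (\<lambda>x. u x - (of_real t * z) * k x)" by simp
    also have "\<dots> = sq_norm M u - 2 * Re (cnj (of_real t * z) * z) + (cmod (of_real t * z))\<^sup>2 * ?K"
      unfolding z_def by (rule sq_norm_diff_scale[OF assms(2,1)])
    also have "Re (cnj (of_real t * z) * z) = t * (cmod z)\<^sup>2"
      unfolding cmod_power2 by (simp add: power2_eq_square algebra_simps)
    finally show ?thesis by (simp add: norm_mult power_mult_distrib)
  qed
  show ?thesis
  proof (cases "?K = 0")
    case True
    then have "AE x in M. k x = 0" by (rule sq_norm_zero_AE[OF assms(1)])
    then have "z = (\<integral>x. 0 \<partial>M)"
      unfolding z_def using assms
      by (intro integral_cong_AE borel_measurable_times borel_measurable_cnj) auto
    then show ?thesis using True z_def by simp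
  next
    case False
    then have K: "?K > 0" using sq_norm_nonneg[of M k] by linarith
    have "0 \<le> sq_norm M u - (cmod z)\<^sup>2 / ?K"
      using main[of "1 / ?K"] K by (simp add: power2_eq_square field_simps)
    then show ?thesis using K by (simp add: z_def field_simps)
  qed
qed

lemma tendsto_integral_cnj_zero:
  assumes "k \<in> sq_int M" "\<And>n. u n \<in> sq_int M" "(\<lambda>n. sq_norm M (u n)) \<longlonglongrightarrow> 0"
  shows "(\<lambda>n. \<integral>x. cnj (k x) * u n x \<partial>M) \<longlonglongrightarrow> 0"
proof -
  have "(\<lambda>n. sqrt (sq_norm M k * sq_norm M (u n))) \<longlonglongrightarrow> sqrt (sq_norm M k * 0)"
    by (intro tendsto_intros assms)
  then have "(\<lambda>n. sqrt (sq_norm M k * sq_norm M (u n))) \<longlonglongrightarrow> 0" by simp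
  then have "(\<lambda>n. norm (\<integral>x. cnj (k x) * u n x \<partial>M)) \<longlonglongrightarrow> 0"
    by (rule Lim_null_comparison[rotated])
       (auto intro!: always_eventually real_le_rsqrt Cauchy_Schwarz_integral assms)
  then show ?thesis by (rule tendsto_norm_zero_cancel)
qed

section \<open>Riesz-Fischer completeness and the projection theorem\<close>

lemma nn_integral_sq:
  "f \<in> sq_int M \<Longrightarrow> (\<integral>\<^sup>+x. ennreal ((cmod (f x))\<^sup>2) \<partial>M) = ennreal (sq_norm M f)"
  by (intro nn_integral_eq_integral sq_int_integrable) auto

text \<open>Weighting the squares by \<open>4 ^ k\<close> still leaves integrals of size
  \<open>(1/2) ^ k\<close>, so the weighted sum is finite almost everywhere. Its terms then tend to
  zero, which makes \<open>d k x\<close> eventually smaller than \<open>(1/2) ^ k\<close>.\<close>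

lemma convergent_AE_of_fast_Cauchy:
  assumes d: "\<And>k. d k \<in> sq_int M" "\<And>k::nat. sq_norm M (d k) \<le> (1/8) ^ k"
  shows "AE x in M. summable (\<lambda>k. d k x)"
proof -
  let ?g = "\<lambda>k x. ennreal (4 ^ k * (cmod (d k x))\<^sup>2)"
  have [measurable]: "d k \<in> borel_measurable M" for k using d by auto
  have "(\<integral>\<^sup>+x. (\<Sum>k. ?g k x) \<partial>M) = (\<Sum>k. \<integral>\<^sup>+x. ?g k x \<partial>M)"
    by (rule nn_integral_suminf) measurable
  also have "\<dots> \<le> (\<Sum>k. ennreal ((1/2) ^ k))"
  proof (intro suminf_le)
    fix k
    have "(\<integral>\<^sup>+x. ?g k x \<partial>M) = ennreal (\<integral>x. 4 ^ k * (cmod (d k x))\<^sup>2 \<partial>M)"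
      using d by (intro nn_integral_eq_integral) (auto simp: sq_int_def)
    also have "\<dots> = ennreal (4 ^ k * sq_norm M (d k))" by simp
    also have "\<dots> \<le> ennreal (4 ^ k * (1/8) ^ k)"
      using d(2) by (intro ennreal_leI mult_left_mono) auto
    finally show "(\<integral>\<^sup>+x. ?g k x \<partial>M) \<le> ennreal ((1/2) ^ k)"
      by (simp add: power_mult_distrib[symmetric])
  qed auto
  also have "\<dots> < \<infinity>"
    by (subst suminf_ennreal2) auto
  finally have "AE x in M. (\<Sum>k. ?g k x) \<noteq> \<infinity>"
    by (intro nn_integral_PInf_AE) auto
  then show ?thesis
  proof eventually_elim
    case (elim x)
    have "summable (\<lambda>k. 4 ^ k * (cmod (d k x))\<^sup>2)"
      using elim by (intro summable_suminf_not_top) auto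
    then have "(\<lambda>k. 4 ^ k * (cmod (d k x))\<^sup>2) \<longlonglongrightarrow> 0" by (rule summable_LIMSEQ_zero)
    then have "\<forall>\<^sub>F k in sequentially. 4 ^ k * (cmod (d k x))\<^sup>2 < 1"
      by (rule order_tendstoD) simp
    then have "\<forall>\<^sub>F k in sequentially. norm (d k x) \<le> (1/2) ^ k"
    proof eventually_elim
      case (elim k)
      have "(2 ^ k * cmod (d k x))\<^sup>2 \<le> 1\<^sup>2"
        using elim by (simp add: power_mult_distrib power2_eq_square[of "2 ^ k"] flip: power_mult_distrib[of 2 2])
      then have "2 ^ k * cmod (d k x) \<le> 1" by (rule power2_le_imp_le) simp
      then show ?case by (simp add: field_simps)
    qed
    then show ?case
      by (rule summable_comparison_test_ev) (auto intro: summable_geometric)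
  qed
qed

text \<open>Riesz-Fischer: a subsequence with squared gaps below \<open>(1/8) ^ k\<close> converges
  almost everywhere, and Fatou's lemma turns the pointwise limit into a limit of the whole sequence
  in mean square.\<close>

lemma sq_int_complete:
  assumes X: "\<And>n. X n \<in> sq_int M"
    and Cauchy: "\<And>e. e > 0 \<Longrightarrow> \<exists>N. \<forall>m\<ge>N. \<forall>n\<ge>N. sq_norm M (\<lambda>x. X m x - X n x) < e"
  shows "\<exists>L\<in>sq_int M. (\<lambda>n. sq_norm M (\<lambda>x. X n x - L x)) \<longlonglongrightarrow> 0"
proof -
  note [measurable] = sq_int_measurable[OF X]
  have "\<exists>s. \<forall>k. (\<forall>m\<ge>s k. \<forall>n\<ge>s k. sq_norm M (\<lambda>x. X m x - X n x) < (1/8) ^ k) \<and> s k < s (Suc k)"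
  proof (rule dependent_nat_choice)
    show "\<exists>s. \<forall>m\<ge>s. \<forall>n\<ge>s. sq_norm M (\<lambda>x. X m x - X n x) < (1/8) ^ 0"
      using Cauchy[of 1] by simp
    fix s k
    obtain N where "\<forall>m\<ge>N. \<forall>n\<ge>N. sq_norm M (\<lambda>x. X m x - X n x) < (1/8) ^ Suc k"
      using Cauchy[of "(1/8) ^ Suc k"] by auto
    then show "\<exists>y. (\<forall>m\<ge>y. \<forall>n\<ge>y. sq_norm M (\<lambda>x. X m x - X n x) < (1/8) ^ Suc k) \<and> s < y"
      by (intro exI[of _ "max N (Suc s)"]) auto
  qed
  then obtain s where s: "\<And>k m n. m \<ge> s k \<Longrightarrow> n \<ge> s k \<Longrightarrow> sq_norm M (\<lambda>x. X m x - X n x) < (1/8) ^ k"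
    and smono: "\<And>k. s k < s (Suc k)" by blast
  have sm: "strict_mono s" using smono by (simp add: strict_mono_Suc_iff)
  define L where "L x = lim (\<lambda>k. X (s k) x)" for x
  have [measurable]: "L \<in> borel_measurable M"
    unfolding L_def by measurable
  have "AE x in M. summable (\<lambda>k. X (s (Suc k)) x - X (s k) x)"
    using s smono by (intro convergent_AE_of_fast_Cauchy sq_int_diff X)
       (simp add: less_imp_le)
  then have L: "AE x in M. (\<lambda>k. X (s k) x) \<longlonglongrightarrow> L x"
  proof eventually_elim
    case (elim x)
    have "convergent (\<lambda>n. \<Sum>k<n. X (s (Suc k)) x - X (s k) x)"
      using elim by (simp add: summable_iff_convergent)
    then have "convergent (\<lambda>n. X (s n) x - X (s 0) x)"
      using sum_lessThan_telescope[of "\<lambda>k. X (s k) x"] by simp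
    then have "convergent (\<lambda>n. X (s n) x)"
      using convergent_diff_const_right_iff[of "\<lambda>n. X (s n) x" "X (s 0) x"] by simp
    then show ?case unfolding L_def by (simp only: convergent_LIMSEQ_iff)
  qed
  \<comment> \<open>Fatou along the subsequence: since \<open>s k \<ge> k\<close>, the squared
    distances from \<open>X n\<close> to \<open>X (s k)\<close> are eventually below
    \<open>e\<close>. The bound on the integral also yields square integrability of the difference,
    from which membership of \<open>L\<close> follows.\<close>
  have est: "(\<lambda>x. X n x - L x) \<in> sq_int M \<and> sq_norm M (\<lambda>x. X n x - L x) \<le> e"
    if n: "n \<ge> N" and N: "\<And>m n. m \<ge> N \<Longrightarrow> n \<ge> N \<Longrightarrow> sq_norm M (\<lambda>x. X m x - X n x) < e" for n N e
  proof -
    have e: "e \<ge> 0" using N[of N N] by simp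
    have "(\<integral>\<^sup>+x. ennreal ((cmod (X n x - L x))\<^sup>2) \<partial>M) =
        (\<integral>\<^sup>+x. liminf (\<lambda>k. ennreal ((cmod (X n x - X (s k) x))\<^sup>2)) \<partial>M)"
    proof (intro nn_integral_cong_AE)
      show "AE x in M. ennreal ((cmod (X n x - L x))\<^sup>2) = liminf (\<lambda>k. ennreal ((cmod (X n x - X (s k) x))\<^sup>2))"
        using L
      proof eventually_elim
        case (elim x)
        have "(\<lambda>k. ennreal ((cmod (X n x - X (s k) x))\<^sup>2)) \<longlonglongrightarrow> ennreal ((cmod (X n x - L x))\<^sup>2)"
          by (intro tendsto_ennrealI tendsto_intros elim)
        then show ?case by (intro lim_imp_Liminf[symmetric]) simp_all
      qed
    qed
    also have "\<dots> \<le> liminf (\<lambda>k. \<integral>\<^sup>+x. ennreal ((cmod (X n x - X (s k) x))\<^sup>2) \<partial>M)"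
      by (rule nn_integral_liminf) measurable
    also have "\<dots> \<le> limsup (\<lambda>k. \<integral>\<^sup>+x. ennreal ((cmod (X n x - X (s k) x))\<^sup>2) \<partial>M)"
      by (rule Liminf_le_Limsup) simp
    also have "\<dots> \<le> ennreal e"
    proof (rule Limsup_bounded, rule eventually_sequentiallyI[of N])
      fix k assume "k \<ge> N"
      then have "s k \<ge> N" using seq_suble[OF sm, of k] by linarith
      then show "(\<integral>\<^sup>+x. ennreal ((cmod (X n x - X (s k) x))\<^sup>2) \<partial>M) \<le> ennreal e"
        using N[OF n, of "s k"] by (subst nn_integral_sq) (auto intro!: sq_int_diff X ennreal_leI)
    qed
    finally have le: "(\<integral>\<^sup>+x. ennreal ((cmod (X n x - L x))\<^sup>2) \<partial>M) \<le> ennreal e" .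
    then have "integrable M (\<lambda>x. (cmod (X n x - L x))\<^sup>2)"
      by (intro integrableI_bounded) (auto simp: le_less_trans[OF _ ennreal_less_top])
    then have in_sq: "(\<lambda>x. X n x - L x) \<in> sq_int M" by (simp add: sq_int_def)
    then show ?thesis using le e by (simp add: nn_integral_sq)
  qed
  obtain N1 where N1: "\<And>m n. m \<ge> N1 \<Longrightarrow> n \<ge> N1 \<Longrightarrow> sq_norm M (\<lambda>x. X m x - X n x) < 1"
    using Cauchy[of 1] by auto
  have "(\<lambda>x. X N1 x - L x) \<in> sq_int M" using est[OF order_refl N1] by simp
  from sq_int_diff[OF X[of N1] this] have "L \<in> sq_int M" by simp
  moreover have "(\<lambda>n. sq_norm M (\<lambda>x. X n x - L x)) \<longlonglongrightarrow> 0"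
  proof (rule LIMSEQ_I)
    fix e :: real assume "e > 0"
    then obtain N where N: "\<And>m n. m \<ge> N \<Longrightarrow> n \<ge> N \<Longrightarrow> sq_norm M (\<lambda>x. X m x - X n x) < e/2"
      using Cauchy[of "e/2"] by auto
    show "\<exists>no. \<forall>n\<ge>no. norm (sq_norm M (\<lambda>x. X n x - L x) - 0) < e"
    proof (intro exI[of _ N] allI impI)
      fix n assume "n \<ge> N"
      from est[OF this N] have "sq_norm M (\<lambda>x. X n x - L x) \<le> e/2" by simp
      then show "norm (sq_norm M (\<lambda>x. X n x - L x) - 0) < e" using \<open>e > 0\<close> by simp
    qed
  qed
  ultimately show ?thesis by blast
qed

text \<open>\<open>S\<close> consists of functions and need not be closed under almost everywhere
  equality, hence completeness is asked for with limits chosen inside \<open>S\<close>. A minimising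
  sequence is Cauchy, and its limit \<open>p\<close> is orthogonal to \<open>S\<close> because
  moving along any \<open>k\<close> in \<open>S\<close> cannot lower the distance below the
  infimum.\<close>

lemma sq_int_projection:
  assumes S: "S \<subseteq> sq_int M" and zero: "(\<lambda>_. 0) \<in> S"
    and lin: "\<And>f g c. f \<in> S \<Longrightarrow> g \<in> S \<Longrightarrow> (\<lambda>x. f x + c * g x) \<in> S"
    and complete: "\<And>Y. (\<And>n. Y n \<in> S) \<Longrightarrow>
      (\<And>e. e > 0 \<Longrightarrow> \<exists>N::nat. \<forall>m\<ge>N. \<forall>n\<ge>N. sq_norm M (\<lambda>x. Y m x - Y n x) < e) \<Longrightarrow>
      \<exists>L\<in>S. (\<lambda>n. sq_norm M (\<lambda>x. Y n x - L x)) \<longlonglongrightarrow> 0"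
    and f: "f \<in> sq_int M"
  shows "\<exists>p\<in>S. \<forall>k\<in>S. (\<integral>x. cnj (k x) * (f x - p x) \<partial>M) = 0"
proof -
  define D where "D = (\<lambda>y. sq_norm M (\<lambda>x. f x - y x)) ` S"
  define d where "d = Inf D"
  have D: "D \<noteq> {}" "bdd_below D"
    using zero by (auto simp: D_def intro!: bdd_belowI[of _ 0])
  have d_le: "d \<le> sq_norm M (\<lambda>x. f x - y x)" if "y \<in> S" for y
    unfolding d_def using D that by (intro cInf_lower) (auto simp: D_def)
  have "\<exists>y\<in>S. sq_norm M (\<lambda>x. f x - y x) < d + 1 / real (Suc n)" for n
  proof -
    have "\<exists>z\<in>D. z < d + 1 / real (Suc n)"
      using D by (subst cInf_less_iff[symmetric]) (auto simp: d_def)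
    then show ?thesis by (auto simp: D_def)
  qed
  then obtain Y where Y: "\<And>n. Y n \<in> S" and Yd: "\<And>n. sq_norm M (\<lambda>x. f x - Y n x) < d + 1 / real (Suc n)"
    by metis
  have YS: "Y n \<in> sq_int M" for n using Y S by auto
  note int = sq_int_integrable[OF sq_int_diff[OF f YS]]
  \<comment> \<open>The midpoint of \<open>Y m\<close> and \<open>Y n\<close> lies in
    \<open>S\<close>, so its squared distance from \<open>f\<close> is at least \<open>d\<close>;
    the \<open>- 4 d\<close> this contributes cancels the \<open>2 d + 2 d\<close> of the two
    near-minimisers.\<close>
  have parallelogram: "sq_norm M (\<lambda>x. Y m x - Y n x) \<le> 2 / real (Suc m) + 2 / real (Suc n)" for m n
  proof -
    let ?mid = "\<lambda>x. 1/2 * Y m x + 1/2 * Y n x"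
    have "(\<lambda>x. 0 + 1/2 * Y m x) \<in> S" by (intro lin zero Y)
    then have mid: "?mid \<in> S" using lin[OF _ Y, of _ "1/2" n] by simp
    have pw: "(cmod (a - b))\<^sup>2 = 2 * (cmod (u - a))\<^sup>2 + 2 * (cmod (u - b))\<^sup>2
        - 4 * (cmod (u - (1/2 * a + 1/2 * b)))\<^sup>2" for a b u
      unfolding cmod_power2 by (simp add: power2_eq_square field_simps)
    have "sq_norm M (\<lambda>x. Y m x - Y n x) = (\<integral>x. 2 * (cmod (f x - Y m x))\<^sup>2 + 2 * (cmod (f x - Y n x))\<^sup>2
        - 4 * (cmod (f x - ?mid x))\<^sup>2 \<partial>M)"
      by (intro Bochner_Integration.integral_cong refl pw)
    also have "\<dots> = 2 * sq_norm M (\<lambda>x. f x - Y m x)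
        + 2 * sq_norm M (\<lambda>x. f x - Y n x) - 4 * sq_norm M (\<lambda>x. f x - ?mid x)"
      using int sq_int_integrable[OF sq_int_diff[OF f subsetD[OF S mid]]]
      by (simp only: Bochner_Integration.integral_add Bochner_Integration.integral_diff
          integral_mult_right_zero Bochner_Integration.integrable_add integrable_mult_right)
    finally show ?thesis using Yd[of m] Yd[of n] d_le[OF mid] by linarith
  qed
  have "\<exists>L\<in>S. (\<lambda>n. sq_norm M (\<lambda>x. Y n x - L x)) \<longlonglongrightarrow> 0"
  proof (rule complete[OF Y])
    fix e :: real assume "e > 0"
    then obtain N where N: "1 / real (Suc N) < e / 4"
      using nat_approx_posE[of "e/4"] by auto
    show "\<exists>N::nat. \<forall>m\<ge>N. \<forall>n\<ge>N. sq_norm M (\<lambda>x. Y m x - Y n x) < e"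
    proof (intro exI[of _ N] allI impI)
      fix m n assume "m \<ge> N" "n \<ge> N"
      then have "1 / real (Suc m) \<le> 1 / real (Suc N)" "1 / real (Suc n) \<le> 1 / real (Suc N)"
        by (auto intro!: divide_left_mono)
      then show "sq_norm M (\<lambda>x. Y m x - Y n x) < e"
        using parallelogram[of m n] N by simp
    qed
  qed
  then obtain p where p: "p \<in> S" and lim: "(\<lambda>n. sq_norm M (\<lambda>x. Y n x - p x)) \<longlonglongrightarrow> 0" by blast
  have pM: "p \<in> sq_int M" using p S by auto
  have lim': "(\<lambda>n. sq_norm M (\<lambda>x. p x - Y n x)) \<longlonglongrightarrow> 0"
    using lim by (simp add: norm_minus_commute)
  have "(\<integral>x. cnj (k x) * (f x - p x) \<partial>M) = 0" if k: "k \<in> S" for k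
  proof -
    define z where "z = (\<integral>x. cnj (k x) * (f x - p x) \<partial>M)"
    define zn where "zn n = (\<integral>x. cnj (k x) * (f x - Y n x) \<partial>M)" for n
    define K where "K = sq_norm M k"
    have kM: "k \<in> sq_int M" using k S by auto
    have zn_eq: "zn n = z + (\<integral>x. cnj (k x) * (p x - Y n x) \<partial>M)" for n
    proof -
      have "zn n = (\<integral>x. cnj (k x) * (f x - p x) + cnj (k x) * (p x - Y n x) \<partial>M)"
        by (simp add: zn_def flip: distrib_left)
      also have "\<dots> = z + (\<integral>x. cnj (k x) * (p x - Y n x) \<partial>M)"
        unfolding z_def by (intro Bochner_Integration.integral_add integrable_cnj_mult sq_int_diff kM f pM YS)
      finally show ?thesis .
    qed
    have "(\<lambda>n. \<integral>x. cnj (k x) * (p x - Y n x) \<partial>M) \<longlonglongrightarrow> 0"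
      by (intro tendsto_integral_cnj_zero kM sq_int_diff pM YS lim')
    from tendsto_add[OF tendsto_const[of z] this] have zn: "zn \<longlonglongrightarrow> z"
      by (simp add: zn_eq[abs_def])
    have bound: "2 * Re (cnj c * zn n) \<le> 1 / real (Suc n) + (cmod c)\<^sup>2 * K" for n c
    proof -
      have "d \<le> sq_norm M (\<lambda>x. f x - (Y n x + c * k x))"
        by (intro d_le lin Y k)
      also have "\<dots> = sq_norm M (\<lambda>x. (f x - Y n x) - c * k x)" by (simp add: algebra_simps)
      also have "\<dots> = sq_norm M (\<lambda>x. f x - Y n x) - 2 * Re (cnj c * zn n) + (cmod c)\<^sup>2 * K"
        unfolding zn_def K_def by (intro sq_norm_diff_scale sq_int_diff f YS kM)
      finally show ?thesis using Yd[of n] by linarith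
    qed
    have "2 * Re (cnj c * z) \<le> 0 + (cmod c)\<^sup>2 * K" for c
    proof (rule LIMSEQ_le)
      show "(\<lambda>n. 2 * Re (cnj c * zn n)) \<longlonglongrightarrow> 2 * Re (cnj c * z)"
        by (intro tendsto_intros zn)
      show "(\<lambda>n. 1 / real (Suc n) + (cmod c)\<^sup>2 * K) \<longlonglongrightarrow> 0 + (cmod c)\<^sup>2 * K"
        by (intro tendsto_intros LIMSEQ_Suc[OF lim_inverse_n'])
      show "\<exists>N. \<forall>n\<ge>N. 2 * Re (cnj c * zn n) \<le> 1 / real (Suc n) + (cmod c)\<^sup>2 * K"
        using bound by blast
    qed
    \<comment> \<open>The choice \<open>c = z / (K + 1)\<close> approximates the minimising
      coefficient \<open>z / K\<close> and remains meaningful for \<open>K = 0\<close>. It leads to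
      \<open>2 |z|^2 \<le> (K / (K + 1)) |z|^2\<close>, which forces \<open>z = 0\<close>.\<close>
    then have *: "2 * Re (cnj (of_real (1 / (K + 1)) * z) * z) \<le> (cmod (of_real (1 / (K + 1)) * z))\<^sup>2 * K"
      by (simp only: add_0)
    have K: "K \<ge> 0" by (simp add: K_def)
    have "Re (cnj (of_real t * z) * z) = t * (cmod z)\<^sup>2" for t
      unfolding cmod_power2 by (simp add: power2_eq_square algebra_simps)
    with * have "2 * (1 / (K + 1)) * (cmod z)\<^sup>2 \<le> (1 / (K + 1))\<^sup>2 * (cmod z)\<^sup>2 * K"
      using K by (simp only: norm_mult power_mult_distrib norm_of_real power2_abs mult.assoc)
    then have "2 * (cmod z)\<^sup>2 \<le> (K / (K + 1)) * (cmod z)\<^sup>2"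
      using K by (simp add: divide_simps power2_eq_square[of "K + 1"] mult_ac)
    also have "\<dots> \<le> 1 * (cmod z)\<^sup>2"
      using K by (intro mult_right_mono) auto
    finally have "z = 0" by simp
    then show ?thesis by (simp add: z_def)
  qed
  with p show ?thesis by blast
qed

section \<open>The Hilbert space of almost everywhere classes\<close>

lemma ae_class_self: "f \<in> borel_measurable M \<Longrightarrow> f \<in> ae_class M f"
  by (simp add: ae_class_def)

lemma rep_ae_class:
  assumes "f \<in> borel_measurable M"
  shows "rep (ae_class M f) \<in> borel_measurable M" "AE x in M. rep (ae_class M f) x = f x"
proof -
  have "rep (ae_class M f) \<in> ae_class M f"
    unfolding rep_def by (rule someI[of "\<lambda>g. g \<in> ae_class M f"]) (rule ae_class_self[OF assms])
  then show "rep (ae_class M f) \<in> borel_measurable M" "AE x in M. rep (ae_class M f) x = f x"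
    by (auto simp: ae_class_def)
qed

lemma ae_class_cong:
  assumes "AE x in M. f x = g x"
  shows "ae_class M f = ae_class M g"
proof -
  have "(AE x in M. k x = f x) \<longleftrightarrow> (AE x in M. k x = g x)" for k
    using assms by (intro eventually_subst) (auto elim: eventually_mono)
  then show ?thesis by (simp add: ae_class_def)
qed

lemma ae_class_eq_iff:
  assumes "f \<in> borel_measurable M"
  shows "ae_class M f = ae_class M g \<longleftrightarrow> (AE x in M. f x = g x)"
proof
  assume "ae_class M f = ae_class M g"
  then have "f \<in> ae_class M g" using ae_class_self[OF assms] by simp
  then show "AE x in M. f x = g x" by (simp add: ae_class_def)
qed (rule ae_class_cong)

lemma rep_sq_int: "f \<in> sq_int M \<Longrightarrow> rep (ae_class M f) \<in> sq_int M"
  using sq_int_cong_AE rep_ae_class sq_int_measurable by metis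

lemma carrier_L2: "hcarrier (L2 M) = ae_class M ` sq_int M"
  by (simp add: L2_def sq_int_def)

lemma carrier_L2_rep:
  assumes "F \<in> hcarrier (L2 M)"
  shows "rep F \<in> sq_int M" "F = ae_class M (rep F)"
proof -
  obtain f where f: "f \<in> sq_int M" "F = ae_class M f" using assms by (auto simp: carrier_L2)
  then show "rep F \<in> sq_int M" by (simp add: rep_sq_int)
  have "AE x in M. rep F x = f x" unfolding f(2) by (intro rep_ae_class sq_int_measurable f)
  then show "F = ae_class M (rep F)" unfolding f(2) by (rule ae_class_cong[symmetric])
qed

lemma L2_zero: "hzero (L2 M) = ae_class M (\<lambda>_. 0)"
  by (simp add: L2_def)

lemma L2_add:
  assumes "f \<in> borel_measurable M" "g \<in> borel_measurable M"
  shows "hadd (L2 M) (ae_class M f) (ae_class M g) = ae_class M (\<lambda>x. f x + g x)"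
proof -
  have "AE x in M. rep (ae_class M f) x + rep (ae_class M g) x = f x + g x"
    using rep_ae_class(2)[OF assms(1)] rep_ae_class(2)[OF assms(2)] by eventually_elim simp
  then show ?thesis by (simp add: L2_def ae_class_cong)
qed

lemma L2_scale:
  assumes "f \<in> borel_measurable M"
  shows "hscale (L2 M) a (ae_class M f) = ae_class M (\<lambda>x. a * f x)"
proof -
  have "AE x in M. a * rep (ae_class M f) x = a * f x"
    using rep_ae_class(2)[OF assms(1)] by eventually_elim simp
  then show ?thesis by (simp add: L2_def ae_class_cong)
qed

lemma L2_diff:
  assumes "f \<in> borel_measurable M" "g \<in> borel_measurable M"
  shows "hdiff (L2 M) (ae_class M f) (ae_class M g) = ae_class M (\<lambda>x. f x - g x)"
  using assms by (simp add: hdiff_def L2_add L2_scale)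

lemma L2_inner:
  assumes "f \<in> borel_measurable M" "g \<in> borel_measurable M"
  shows "hinner (L2 M) (ae_class M f) (ae_class M g) = (\<integral>x. cnj (f x) * g x \<partial>M)"
proof -
  have "(\<integral>x. cnj (rep (ae_class M f) x) * rep (ae_class M g) x \<partial>M) = (\<integral>x. cnj (f x) * g x \<partial>M)"
  proof (intro integral_cong_AE borel_measurable_times borel_measurable_cnj rep_ae_class(1) assms)
    show "AE x in M. cnj (rep (ae_class M f) x) * rep (ae_class M g) x = cnj (f x) * g x"
      using rep_ae_class(2)[OF assms(1)] rep_ae_class(2)[OF assms(2)] by eventually_elim simp
  qed
  then show ?thesis by (simp add: L2_def)
qed

lemma L2_norm:
  assumes "f \<in> sq_int M"
  shows "hnorm (L2 M) (ae_class M f) = sqrt (sq_norm M f)"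
  using assms by (simp add: hnorm_def L2_inner sq_int_measurable integral_cnj_self)

lemma complex_hilbert_space_L2: "complex_hilbert_space (L2 M)"
proof
  fix x y z :: "('a \<Rightarrow> complex) set" and a b
  note rules = L2_zero L2_add L2_scale L2_diff L2_inner carrier_L2 sq_int_measurable sq_int_add sq_int_scale
    sq_int_diff algebra_simps
  show "hzero (L2 M) \<in> hcarrier (L2 M)" by (auto simp: rules)
  assume x: "x \<in> hcarrier (L2 M)"
  then obtain f where f: "f \<in> sq_int M" "x = ae_class M f" by (auto simp: rules)
  note fm [measurable] = sq_int_measurable[OF f(1)]
  show "hscale (L2 M) a x \<in> hcarrier (L2 M)"
    using f by (auto simp: rules)
  show "hadd (L2 M) x (hzero (L2 M)) = x" using f by (simp add: rules)
  show "hdiff (L2 M) x x = hzero (L2 M)" using f by (simp add: rules)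
  show "hscale (L2 M) (a + b) x = hadd (L2 M) (hscale (L2 M) a x) (hscale (L2 M) b x)"
    using f by (simp add: rules)
  show "hscale (L2 M) a (hscale (L2 M) b x) = hscale (L2 M) (a * b) x"
    using f by (simp add: rules)
  show "hscale (L2 M) 1 x = x" using f by (simp add: rules)
  have xx: "hinner (L2 M) x x = complex_of_real (sq_norm M f)"
    using f by (simp add: L2_inner sq_int_measurable integral_cnj_self)
  then show "0 \<le> Re (hinner (L2 M) x x)" by simp
  show "x = hzero (L2 M)" if "hinner (L2 M) x x = 0"
  proof -
    have "sq_norm M f = 0" using that xx by (simp only: of_real_eq_0_iff)
    from sq_norm_zero_AE[OF f(1) this] show ?thesis unfolding f(2) L2_zero by (rule ae_class_cong)
  qed
  assume y: "y \<in> hcarrier (L2 M)"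
  then obtain g where g: "g \<in> sq_int M" "y = ae_class M g" by (auto simp: rules)
  note gm [measurable] = sq_int_measurable[OF g(1)]
  show "hadd (L2 M) x y \<in> hcarrier (L2 M)"
    using f g by (auto simp: rules)
  show "hadd (L2 M) x y = hadd (L2 M) y x" using f g by (simp add: rules)
  show "hscale (L2 M) a (hadd (L2 M) x y) = hadd (L2 M) (hscale (L2 M) a x) (hscale (L2 M) a y)"
    using f g by (simp add: rules)
  show "hinner (L2 M) y x = cnj (hinner (L2 M) x y)"
    unfolding f(2) g(2)
    by (subst L2_inner[OF gm fm], subst L2_inner[OF fm gm], subst Bochner_Integration.integral_cnj[symmetric])
       (simp add: mult.commute)
  show "hinner (L2 M) x (hscale (L2 M) a y) = a * hinner (L2 M) x y"
    using f g by (simp add: L2_inner L2_scale fm gm mult.left_commute[of _ a])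
  assume z: "z \<in> hcarrier (L2 M)"
  then obtain k where k: "k \<in> sq_int M" "z = ae_class M k" by (auto simp: rules)
  note km [measurable] = sq_int_measurable[OF k(1)]
  show "hadd (L2 M) (hadd (L2 M) x y) z = hadd (L2 M) x (hadd (L2 M) y z)"
    using f g k by (simp add: rules)
  show "hinner (L2 M) x (hadd (L2 M) y z) = hinner (L2 M) x y + hinner (L2 M) x z"
    unfolding f(2) g(2) k(2)
    by (simp add: L2_inner L2_add fm gm km distrib_left Bochner_Integration.integral_add
        integrable_cnj_mult[OF f(1) g(1)] integrable_cnj_mult[OF f(1) k(1)])
next
  fix X :: "nat \<Rightarrow> ('a \<Rightarrow> complex) set"
  assume X: "\<And>n. X n \<in> hcarrier (L2 M)"
    and C: "\<forall>e>0. \<exists>N::nat. \<forall>m\<ge>N. \<forall>n\<ge>N. hnorm (L2 M) (hdiff (L2 M) (X m) (X n)) < e"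
  define f where "f n = rep (X n)" for n
  have f: "f n \<in> sq_int M" and X_eq: "X n = ae_class M (f n)" for n
    using carrier_L2_rep[OF X] by (auto simp: f_def)
  have nd: "hnorm (L2 M) (hdiff (L2 M) (X n) (ae_class M k)) = sqrt (sq_norm M (\<lambda>x. f n x - k x))"
    if "k \<in> sq_int M" for n k
    using that by (simp add: X_eq L2_diff f sq_int_measurable L2_norm sq_int_diff)
  have "\<exists>L\<in>sq_int M. (\<lambda>n. sq_norm M (\<lambda>x. f n x - L x)) \<longlonglongrightarrow> 0"
  proof (rule sq_int_complete[OF f])
    fix e :: real assume "e > 0"
    then obtain N where N: "\<forall>m\<ge>N. \<forall>n\<ge>N. hnorm (L2 M) (hdiff (L2 M) (X m) (X n)) < sqrt e"
      using C by (meson real_sqrt_gt_0_iff)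
    show "\<exists>N. \<forall>m\<ge>N. \<forall>n\<ge>N. sq_norm M (\<lambda>x. f m x - f n x) < e"
      using N nd[OF f] unfolding X_eq[symmetric] by (intro exI[of _ N]) simp
  qed
  then obtain L where L: "L \<in> sq_int M" "(\<lambda>n. sq_norm M (\<lambda>x. f n x - L x)) \<longlonglongrightarrow> 0" by blast
  have "(\<lambda>n. sqrt (sq_norm M (\<lambda>x. f n x - L x))) \<longlonglongrightarrow> sqrt 0"
    by (intro tendsto_intros L)
  then show "\<exists>L\<in>hcarrier (L2 M). (\<lambda>n. hnorm (L2 M) (hdiff (L2 M) (X n) L)) \<longlonglongrightarrow> 0"
    using L(1) by (intro bexI[of _ "ae_class M L"]) (auto simp: nd carrier_L2)
qed

text \<open>Meant for the sequence space: its scalar product is a \<open>lim\<close>, so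
  sesquilinearity and completeness are awkward to verify from the definition but are inherited along
  a structure preserving bijection.\<close>

lemma complex_hilbert_space_transport:
  assumes V: "complex_hilbert_space V" and bij: "bij_betw T (hcarrier V) (hcarrier W)"
    and zero: "T (hzero V) = hzero W"
    and add: "\<And>x y. x \<in> hcarrier V \<Longrightarrow> y \<in> hcarrier V \<Longrightarrow> T (hadd V x y) = hadd W (T x) (T y)"
    and scale: "\<And>a x. x \<in> hcarrier V \<Longrightarrow> T (hscale V a x) = hscale W a (T x)"
    and inner: "\<And>x y. x \<in> hcarrier V \<Longrightarrow> y \<in> hcarrier V \<Longrightarrow> hinner W (T x) (T y) = hinner V x y"
  shows "complex_hilbert_space W"
proof -
  interpret V: complex_hilbert_space V by (rule V)
  have W: "hcarrier W = T ` hcarrier V" using bij by (simp add: bij_betw_def)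
  note closed = V.zero_closed V.add_closed V.scale_closed
  have diff_closed: "hdiff V x y \<in> hcarrier V" if "x \<in> hcarrier V" "y \<in> hcarrier V" for x y
    using that by (simp add: hdiff_def closed)
  have diff: "hdiff W (T x) (T y) = T (hdiff V x y)" if "x \<in> hcarrier V" "y \<in> hcarrier V" for x y
    using that by (simp add: hdiff_def add scale closed)
  have norm: "hnorm W (T x) = hnorm V x" if "x \<in> hcarrier V" for x
    using that by (simp add: hnorm_def inner)
  show ?thesis
  proof
    show "hzero W \<in> hcarrier W" using W closed zero by (metis imageI)
  next
    fix X :: "nat \<Rightarrow> 'b"
    assume X: "\<And>n. X n \<in> hcarrier W"
      and C: "\<forall>e>0. \<exists>N::nat. \<forall>m\<ge>N. \<forall>n\<ge>N. hnorm W (hdiff W (X m) (X n)) < e"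
    have "\<forall>n. \<exists>y. y \<in> hcarrier V \<and> X n = T y" using X W by auto
    then obtain Y where Y: "\<And>n. Y n \<in> hcarrier V" "\<And>n. X n = T (Y n)" by metis
    have "\<exists>L\<in>hcarrier V. (\<lambda>n. hnorm V (hdiff V (Y n) L)) \<longlonglongrightarrow> 0"
      using C by (intro V.complete Y) (simp add: Y diff norm diff_closed)
    then obtain L where "L \<in> hcarrier V" "(\<lambda>n. hnorm V (hdiff V (Y n) L)) \<longlonglongrightarrow> 0" by blast
    then show "\<exists>L\<in>hcarrier W. (\<lambda>n. hnorm W (hdiff W (X n) L)) \<longlonglongrightarrow> 0"
      by (intro bexI[of _ "T L"]) (simp_all add: W Y diff norm diff_closed)
  next
    fix x y z a b
    assume x: "x \<in> hcarrier W"
    then obtain x' where x': "x' \<in> hcarrier V" "x = T x'" by (auto simp: W)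
    show "hscale W a x \<in> hcarrier W" using x' by (simp add: W closed flip: scale)
    show "hadd W x (hzero W) = x" using x' by (simp add: closed V.add_zero flip: zero add)
    show "hdiff W x x = hzero W" using x' by (simp add: diff V.diff_self zero)
    show "hscale W (a + b) x = hadd W (hscale W a x) (hscale W b x)"
      using x' by (simp add: closed V.scale_add_left flip: scale add)
    show "hscale W a (hscale W b x) = hscale W (a * b) x"
      using x' by (simp add: closed V.scale_scale flip: scale)
    show "hscale W 1 x = x" using x' by (simp add: V.scale_one flip: scale)
    show "0 \<le> Re (hinner W x x)" using x' by (simp add: inner V.inner_nonneg)
    show "x = hzero W" if "hinner W x x = 0"
      using that x' V.inner_definite by (simp add: inner flip: zero)
    assume "y \<in> hcarrier W"
    then obtain y' where y': "y' \<in> hcarrier V" "y = T y'" by (auto simp: W)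
    show "hadd W x y \<in> hcarrier W" using x' y' by (simp add: W closed flip: add)
    show "hadd W x y = hadd W y x" using x' y' by (simp add: V.add_commute flip: add)
    show "hinner W y x = cnj (hinner W x y)" using x' y' V.inner_commute[OF x'(1) y'(1)] by (simp add: inner)
    show "hscale W a (hadd W x y) = hadd W (hscale W a x) (hscale W a y)"
      using x' y' by (simp add: closed V.scale_add_right flip: add scale)
    show "hinner W x (hscale W a y) = a * hinner W x y"
      using x' y' by (simp add: closed V.inner_scale_right inner flip: scale)
    assume "z \<in> hcarrier W"
    then obtain z' where z': "z' \<in> hcarrier V" "z = T z'" by (auto simp: W)
    show "hadd W (hadd W x y) z = hadd W x (hadd W y z)"
      using x' y' z' by (simp add: closed V.add_assoc flip: add)
    show "hinner W x (hadd W y z) = hinner W x y + hinner W x z"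
      using x' y' z' by (simp add: closed inner V.inner_add_right flip: add)
  qed
qed

section \<open>Strongly invariant measures\<close>

locale strongly_invariant_map = prob_space M for M :: "'a measure" +
  fixes r :: "'a \<Rightarrow> 'a"
  assumes r_measurable [measurable]: "r \<in> measurable M M"
    and finite_fibres: "\<forall>x\<in>space M. finite {y \<in> space M. r y = x}"
    and r_onto: "r ` space M = space M"
    and invariant: "strongly_invariant M r"
begin

abbreviation avg :: "('a \<Rightarrow> complex) \<Rightarrow> 'a \<Rightarrow> complex" where
  "avg \<equiv> fibre_avg M r"

lemma r_space: "x \<in> space M \<Longrightarrow> r x \<in> space M"
  using r_onto by auto

lemma fibre_empty: "x \<notin> space M \<Longrightarrow> fibre M r x = {}"
  using r_space by (auto simp: fibre_def)

lemma finite_fibre: "finite (fibre M r x)"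
  using finite_fibres fibre_empty by (metis fibre_def finite.emptyI)

lemma fibre_nonempty: "x \<in> space M \<Longrightarrow> fibre M r x \<noteq> {}"
  using r_onto unfolding fibre_def by (metis (mono_tags, lifting) empty_iff imageE mem_Collect_eq)

lemma card_fibre_pos: "x \<in> space M \<Longrightarrow> 0 < card (fibre M r x)"
  using fibre_nonempty finite_fibre by (simp add: card_gt_0_iff)

lemma avg_const: "x \<in> space M \<Longrightarrow> avg (\<lambda>_. c) x = c"
  using card_fibre_pos[of x] by (simp add: fibre_avg_def)

lemma avg_cong: "(\<And>y. y \<in> fibre M r x \<Longrightarrow> f y = g y) \<Longrightarrow> avg f x = avg g x"
  unfolding fibre_avg_def by (intro arg_cong2[where f = "(*)"] sum.cong refl)

lemma avg_pull_out: "avg (\<lambda>y. k (r y) * f y) x = k x * avg f x"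
proof -
  have "(\<Sum>y\<in>fibre M r x. k (r y) * f y) = (\<Sum>y\<in>fibre M r x. k x * f y)"
    by (intro sum.cong) (auto simp: fibre_def)
  then show ?thesis by (simp add: fibre_avg_def sum_distrib_left)
qed

lemma avg_tendsto:
  assumes "\<And>y. (\<lambda>k. f k y) \<longlonglongrightarrow> g y"
  shows "(\<lambda>k. avg (f k) x) \<longlonglongrightarrow> avg g x"
  unfolding fibre_avg_def by (intro tendsto_intros assms)

lemma avg_of_real: "avg (\<lambda>y. complex_of_real (g y)) x = complex_of_real ((\<Sum>y\<in>fibre M r x. g y) / card (fibre M r x))"
  by (simp add: fibre_avg_def)

lemma norm_avg_le: "cmod (avg f x) \<le> Re (avg (\<lambda>y. complex_of_real (cmod (f y))) x)"
proof -
  have "cmod (avg f x) = cmod (\<Sum>y\<in>fibre M r x. f y) / card (fibre M r x)"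
    by (simp add: fibre_avg_def norm_divide)
  also have "\<dots> \<le> (\<Sum>y\<in>fibre M r x. cmod (f y)) / card (fibre M r x)"
    by (intro divide_right_mono norm_sum) simp
  finally show ?thesis by (simp only: avg_of_real Re_complex_of_real)
qed

lemma Re_avg_mono:
  assumes "\<And>y. g y \<le> g' y"
  shows "Re (avg (\<lambda>y. complex_of_real (g y)) x) \<le> Re (avg (\<lambda>y. complex_of_real (g' y)) x)"
  unfolding avg_of_real by (auto intro!: divide_right_mono sum_mono assms)

section \<open>Strong invariance extended from bounded to integrable functions\<close>

definition truncate :: "('a \<Rightarrow> complex) \<Rightarrow> nat \<Rightarrow> 'a \<Rightarrow> complex" where
  "truncate f k y = (if cmod (f y) \<le> real k then f y else 0)"

lemma truncate_Linf: "f \<in> borel_measurable M \<Longrightarrow> truncate f k \<in> Linf M"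
  unfolding truncate_def Linf_def by (auto intro!: exI[of _ "real k"])

lemma truncate_tendsto: "(\<lambda>k. truncate f k y) \<longlonglongrightarrow> f y"
proof (rule tendsto_eventually)
  obtain N :: nat where "cmod (f y) \<le> real N" using real_arch_simple by blast
  then show "\<forall>\<^sub>F k in sequentially. truncate f k y = f y"
    unfolding truncate_def by (intro eventually_sequentiallyI[of N]) (auto intro: order_trans)
qed

lemma avg_Linf:
  assumes "f \<in> Linf M"
  shows "avg f \<in> borel_measurable M" "(\<integral>x. f x \<partial>M) = (\<integral>x. avg f x \<partial>M)"
  using invariant assms by (auto simp: strongly_invariant_def)

text \<open>The invariance hypothesis gives measurability for bounded functions. An average is a
  finite sum, so the averages of truncations converge pointwise.\<close>

lemma avg_measurable [measurable (raw)]: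
  assumes "f \<in> borel_measurable M"
  shows "avg f \<in> borel_measurable M"
  by (rule borel_measurable_LIMSEQ_metric[where f = "\<lambda>k. avg (truncate f k)"])
     (auto intro: avg_Linf avg_tendsto truncate_tendsto truncate_Linf assms)

text \<open>Monotone convergence on both sides along \<open>min (g y) (real k)\<close>, to which
  invariance applies. \<open>Re\<close> and \<open>complex_of_real\<close> are there because
  \<open>fibre_avg\<close> acts on complex functions.\<close>

lemma nn_integral_avg:
  assumes [measurable]: "g \<in> borel_measurable M" and g: "\<And>y. 0 \<le> g y"
  shows "(\<integral>\<^sup>+x. ennreal (Re (avg (\<lambda>y. complex_of_real (g y)) x)) \<partial>M) = (\<integral>\<^sup>+x. ennreal (g x) \<partial>M)"
proof -
  define gk where "gk k y = min (g y) (real k)" for k :: nat and y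
  have gk0: "0 \<le> gk k y" for k y using g by (simp add: gk_def)
  have [measurable]: "gk k \<in> borel_measurable M" for k unfolding gk_def[abs_def] by measurable
  have gk_lim: "(\<lambda>k. gk k y) \<longlonglongrightarrow> g y" for y
  proof (rule tendsto_eventually)
    obtain N :: nat where "g y \<le> real N" using real_arch_simple by blast
    then show "\<forall>\<^sub>F k in sequentially. gk k y = g y"
      unfolding gk_def by (intro eventually_sequentiallyI[of N]) (auto simp: min_def)
  qed
  have gk_inc: "gk k y \<le> gk k' y" if "k \<le> k'" for k k' y using that by (auto simp: gk_def min_def)
  let ?a = "\<lambda>k x. Re (avg (\<lambda>y. complex_of_real (gk k y)) x)"
  have a0: "0 \<le> ?a k x" for k x by (simp add: avg_of_real gk0 sum_nonneg)
  have a_le: "?a k x \<le> real k" for k x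
  proof (cases "x \<in> space M")
    case True
    have "?a k x \<le> Re (avg (\<lambda>y. complex_of_real (real k)) x)"
      by (rule Re_avg_mono) (simp add: gk_def)
    then show ?thesis using True by (simp add: avg_const)
  qed (simp add: avg_of_real fibre_empty)
  have eq: "(\<integral>\<^sup>+x. ennreal (?a k x) \<partial>M) = (\<integral>\<^sup>+x. ennreal (gk k x) \<partial>M)" for k
  proof -
    have L: "(\<lambda>y. complex_of_real (gk k y)) \<in> Linf M"
      using gk0 by (auto simp: Linf_def gk_def intro!: exI[of _ "real k"])
    have ig: "integrable M (gk k)"
      by (rule integrable_const_bound[of _ "real k"]) (use gk0 in \<open>auto simp: gk_def\<close>)
    have ia: "integrable M (?a k)"
      by (rule integrable_const_bound[of _ "real k"]) (use a0 a_le in auto)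
    have "complex_of_real (\<integral>x. gk k x \<partial>M) = (\<integral>x. complex_of_real (gk k x) \<partial>M)" by simp
    also have "\<dots> = (\<integral>x. avg (\<lambda>y. complex_of_real (gk k y)) x \<partial>M)"
      by (rule avg_Linf(2)[OF L])
    also have "\<dots> = (\<integral>x. complex_of_real (?a k x) \<partial>M)"
      by (intro Bochner_Integration.integral_cong refl) (simp add: avg_of_real)
    also have "\<dots> = complex_of_real (\<integral>x. ?a k x \<partial>M)" by (rule integral_complex_of_real)
    finally have "(\<integral>x. gk k x \<partial>M) = (\<integral>x. ?a k x \<partial>M)" by (simp only: of_real_eq_iff)
    then show ?thesis using ig ia a0 gk0 by (simp add: nn_integral_eq_integral)
  qed
  have "(\<lambda>k. \<integral>\<^sup>+x. ennreal (?a k x) \<partial>M) \<longlonglongrightarrow> (\<integral>\<^sup>+x. ennreal (Re (avg (\<lambda>y. complex_of_real (g y)) x)) \<partial>M)"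
    by (intro nn_integral_LIMSEQ tendsto_intros avg_tendsto gk_lim)
       (auto simp: incseq_def le_fun_def intro!: ennreal_leI Re_avg_mono gk_inc)
  moreover have "(\<lambda>k. \<integral>\<^sup>+x. ennreal (gk k x) \<partial>M) \<longlonglongrightarrow> (\<integral>\<^sup>+x. ennreal (g x) \<partial>M)"
    by (intro nn_integral_LIMSEQ tendsto_intros gk_lim)
       (auto simp: incseq_def le_fun_def intro!: ennreal_leI gk_inc)
  ultimately show ?thesis unfolding eq by (rule LIMSEQ_unique)
qed

lemma integrable_avg_norm:
  assumes "integrable M f"
  shows "integrable M (\<lambda>x. Re (avg (\<lambda>y. complex_of_real (cmod (f y))) x))"
proof (rule integrableI_bounded)
  have [measurable]: "f \<in> borel_measurable M" using assms by auto
  show "(\<lambda>x. Re (avg (\<lambda>y. complex_of_real (cmod (f y))) x)) \<in> borel_measurable M" by measurable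
  have "(\<integral>\<^sup>+x. ennreal (norm (Re (avg (\<lambda>y. complex_of_real (cmod (f y))) x))) \<partial>M) = (\<integral>\<^sup>+x. ennreal (cmod (f x)) \<partial>M)"
    by (subst nn_integral_avg[symmetric])
       (auto intro!: nn_integral_cong simp: avg_of_real abs_of_nonneg sum_nonneg)
  also have "\<dots> < \<infinity>" using assms by (simp add: integrable_iff_bounded)
  finally show "(\<integral>\<^sup>+x. ennreal (norm (Re (avg (\<lambda>y. complex_of_real (cmod (f y))) x))) \<partial>M) < \<infinity>" .
qed

lemma integrable_avg:
  assumes "integrable M f"
  shows "integrable M (avg f)"
  by (rule Bochner_Integration.integrable_bound[OF integrable_avg_norm[OF assms]])
     (use assms in \<open>auto intro!: order_trans[OF norm_avg_le] avg_measurable\<close>)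

text \<open>Dominated convergence along truncations. For the averages the majorant is the average of
  the modulus of \<open>f\<close>, integrable by \<open>integrable_avg_norm\<close>.\<close>

lemma integral_avg:
  assumes "integrable M f"
  shows "(\<integral>x. avg f x \<partial>M) = (\<integral>x. f x \<partial>M)"
proof -
  have [measurable]: "f \<in> borel_measurable M" using assms by auto
  have m: "truncate f k \<in> borel_measurable M" for k using truncate_Linf[of f k] by (simp add: Linf_def)
  have le: "cmod (truncate f k y) \<le> cmod (f y)" for k y by (simp add: truncate_def)
  have "(\<lambda>k. \<integral>x. avg (truncate f k) x \<partial>M) \<longlonglongrightarrow> (\<integral>x. avg f x \<partial>M)"
  proof (rule integral_dominated_convergence[OF _ _ integrable_avg_norm[OF assms]])
    show "AE x in M. cmod (avg (truncate f k) x) \<le> Re (avg (\<lambda>y. complex_of_real (cmod (f y))) x)" for k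
      by (intro AE_I2 order_trans[OF norm_avg_le] Re_avg_mono le)
  qed (auto intro!: avg_tendsto truncate_tendsto avg_measurable m)
  moreover have "(\<lambda>k. \<integral>x. truncate f k x \<partial>M) \<longlonglongrightarrow> (\<integral>x. f x \<partial>M)"
    by (rule integral_dominated_convergence[OF _ _ integrable_norm[OF assms]])
       (auto intro: truncate_tendsto m le)
  ultimately show ?thesis
    unfolding avg_Linf(2)[OF truncate_Linf[OF \<open>f \<in> borel_measurable M\<close>]]
    by (rule LIMSEQ_unique)
qed

text \<open>The average of the indicator of a null set has integral zero, hence vanishes almost
  everywhere. It is a sum of nonnegative terms over a finite nonempty fibre, so each term vanishes
  and the fibre misses the null set.\<close>

lemma AE_fibre:
  assumes "AE x in M. P x"
  shows "AE x in M. \<forall>y\<in>fibre M r x. P y"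
proof -
  obtain N where N: "{x\<in>space M. \<not> P x} \<subseteq> N" "N \<in> sets M" "emeasure M N = 0"
    using assms by (auto elim: AE_E)
  have [measurable]: "N \<in> sets M" by fact
  have "(\<integral>\<^sup>+x. ennreal (Re (avg (\<lambda>y. complex_of_real (indicator N y)) x)) \<partial>M) = (\<integral>\<^sup>+x. ennreal (indicator N x) \<partial>M)"
    by (rule nn_integral_avg) (use N in simp_all)
  also have "\<dots> = 0" using N by (simp add: ennreal_indicator)
  finally have "AE x in M. ennreal (Re (avg (\<lambda>y. complex_of_real (indicator N y)) x)) = 0"
    by (subst (asm) nn_integral_0_iff_AE) auto
  then show ?thesis
  proof (rule AE_mp, intro AE_I2 impI ballI)
    fix x y assume x: "x \<in> space M" and y: "y \<in> fibre M r x"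
      and 0: "ennreal (Re (avg (\<lambda>y. complex_of_real (indicator N y)) x)) = 0"
    have "(\<Sum>y\<in>fibre M r x. indicator N y :: real) / card (fibre M r x) \<le> 0"
      using 0 unfolding avg_of_real by (simp add: ennreal_eq_0_iff)
    then have "(\<Sum>y\<in>fibre M r x. indicator N y :: real) \<le> 0"
      using card_fibre_pos[OF x] by (simp add: divide_le_0_iff)
    then have "(\<Sum>y\<in>fibre M r x. indicator N y :: real) = 0"
      by (intro antisym sum_nonneg) auto
    then have "indicator N y = (0::real)"
      using y by (subst (asm) sum_nonneg_eq_0_iff) (auto simp: finite_fibre)
    then show "P y" using y N(1) by (auto simp: fibre_def indicator_def split: if_splits)
  qed
qed

lemma avg_cong_AE:
  assumes "AE x in M. f x = g x"
  shows "AE x in M. avg f x = avg g x"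
  using AE_fibre[OF assms] by eventually_elim (auto intro: avg_cong)

text \<open>A function of the form \<open>k (r y)\<close> is constant on fibres, so averaging
  returns \<open>k\<close>; applied to indicators, invariance becomes preservation of
  \<open>M\<close>.\<close>

lemma measure_preserving_r: "distr M M r = M"
proof (rule measure_eqI)
  fix A assume "A \<in> sets (distr M M r)"
  then have [measurable]: "A \<in> sets M" by simp
  have "emeasure (distr M M r) A = (\<integral>\<^sup>+x. ennreal (indicator A (r x)) \<partial>M)"
    by (subst nn_integral_distr[symmetric, of r M M "\<lambda>x. ennreal (indicator A x)"]) (auto simp: ennreal_indicator)
  also have "\<dots> = (\<integral>\<^sup>+x. ennreal (Re (avg (\<lambda>y. complex_of_real (indicator A (r y))) x)) \<partial>M)"
    by (rule nn_integral_avg[symmetric]) auto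
  also have "\<dots> = (\<integral>\<^sup>+x. ennreal (indicator A x) \<partial>M)"
  proof (intro nn_integral_cong arg_cong[of _ _ ennreal])
    fix x assume "x \<in> space M"
    then show "Re (avg (\<lambda>y. complex_of_real (indicator A (r y))) x) = indicator A x"
      using avg_pull_out[of "\<lambda>x. complex_of_real (indicator A x)" "\<lambda>_. 1" x] by (simp add: avg_const)
  qed
  also have "\<dots> = emeasure M A" by (simp add: ennreal_indicator)
  finally show "emeasure (distr M M r) A = emeasure M A" .
qed simp

lemma AE_r: "AE x in M. P x \<Longrightarrow> AE x in M. P (r x)"
  using AE_distrD[OF r_measurable, of P] unfolding measure_preserving_r .

lemma r_pow_measurable [measurable]: "(r ^^ n) \<in> measurable M M"
  by (induction n) (simp_all add: measurable_comp[OF _ r_measurable] id_def)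

lemma AE_r_pow: "AE x in M. P x \<Longrightarrow> AE x in M. P ((r ^^ n) x)"
proof (induction n)
  case (Suc n)
  then show ?case using AE_r[of "\<lambda>x. P ((r ^^ n) x)"] by (simp add: funpow_swap1)
qed simp

lemma Linf_r_pow:
  assumes "g \<in> Linf M"
  shows "(\<lambda>x. g ((r ^^ n) x)) \<in> Linf M"
proof -
  have [measurable]: "g \<in> borel_measurable M" and "\<exists>C. AE x in M. cmod (g x) \<le> C"
    using assms by (auto simp: Linf_def)
  then obtain C where "AE x in M. cmod (g x) \<le> C" by blast
  from AE_r_pow[OF this, of n] show ?thesis by (auto simp: Linf_def)
qed

end

section \<open>The transfer operator and the measures it generates\<close>

text \<open>Integrals of complex indicators are the form in which \<open>omega\<close> is
  characterised; finiteness lets them determine \<open>emeasure\<close>.\<close>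

lemma finite_measure_eqI_integral:
  assumes "finite_measure N" "finite_measure N'" "sets N = sets N'"
    and "\<And>A. A \<in> sets N \<Longrightarrow>
      (\<integral>x. complex_of_real (indicator A x) \<partial>N) = (\<integral>x. complex_of_real (indicator A x) \<partial>N')"
  shows "N = N'"
proof (rule measure_eqI[OF assms(3)])
  fix A assume A: "A \<in> sets N"
  have "complex_of_real (measure N A) = complex_of_real (measure N' A)"
    using assms(4)[OF A] A assms(3) sets.sets_into_space[OF A] sets_eq_imp_space_eq[OF assms(3)]
    by (simp add: Int_absorb2)
  then show "emeasure N A = emeasure N' A"
    using assms(1,2) by (simp add: finite_measure.emeasure_eq_measure)
qed

locale transfer_setting = strongly_invariant_map +
  fixes m0 :: "'a \<Rightarrow> complex" and h :: "'a \<Rightarrow> real"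
  assumes m0_bounded: "m0 \<in> Linf M"
    and m0_nonvanishing: "\<forall>A\<in>sets M. emeasure M A > 0 \<longrightarrow> (\<exists>x\<in>A. m0 x \<noteq> 0)"
    and h_integrable: "integrable M h"
    and h_nonneg: "AE x in M. 0 \<le> h x"
    and h_fixed: "AE x in M. transfer_op M r m0 (\<lambda>y. complex_of_real (h y)) x = complex_of_real (h x)"
begin

abbreviation T :: "('a \<Rightarrow> complex) \<Rightarrow> 'a \<Rightarrow> complex" where
  "T \<equiv> transfer_op M r m0"

definition W :: "nat \<Rightarrow> 'a \<Rightarrow> real" where
  "W n x = (\<Prod>k<n. (cmod (m0 ((r ^^ k) x)))\<^sup>2)"

definition Om :: "nat \<Rightarrow> 'a measure" where
  "Om n = density M (\<lambda>x. ennreal (h x * W n x))"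

lemma m0_measurable [measurable]: "m0 \<in> borel_measurable M"
  using m0_bounded by (simp add: Linf_def)

lemma h_measurable [measurable]: "h \<in> borel_measurable M"
  using h_integrable by auto

lemma W_measurable [measurable]: "W n \<in> borel_measurable M"
  unfolding W_def[abs_def] by measurable

lemma W_0 [simp]: "W 0 x = 1"
  by (simp add: W_def)

lemma W_Suc: "W (Suc n) x = W n x * (cmod (m0 ((r ^^ n) x)))\<^sup>2"
  by (simp add: W_def)

text \<open>Splits off the factor \<open>k = 0\<close>, which is the weight inside the transfer
  operator, whereas \<open>W_Suc\<close> splits off \<open>k = n\<close>. The first factorisation
  relates levels by projection along \<open>r\<close>, the second by a change of density.\<close>

lemma W_Suc_r: "W (Suc n) x = (cmod (m0 x))\<^sup>2 * W n (r x)"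
  by (simp only: W_def prod.lessThan_Suc_shift funpow_Suc_right o_apply) simp

lemma W_nonneg: "0 \<le> W n x"
  by (simp add: W_def prod_nonneg)

lemma AE_m0_nonzero: "AE x in M. m0 x \<noteq> 0"
proof -
  let ?A = "{x \<in> space M. m0 x = 0}"
  have "?A \<in> sets M" by measurable
  then have "emeasure M ?A = 0" using m0_nonvanishing by (metis (mono_tags, lifting) mem_Collect_eq not_gr_zero)
  then show ?thesis using \<open>?A \<in> sets M\<close> by (intro AE_I[of _ _ ?A]) auto
qed

text \<open>\<open>r\<close> preserves null sets under preimage, so the zeros of \<open>m0\<close>
  along all of the countably many iterates still form a null set.\<close>

lemma AE_W_pos: "AE x in M. \<forall>n. 0 < W n x"
proof -
  have "AE x in M. \<forall>k. m0 ((r ^^ k) x) \<noteq> 0"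
    unfolding AE_all_countable by (intro allI AE_r_pow AE_m0_nonzero)
  then show ?thesis by eventually_elim (auto simp: W_def intro!: prod_pos)
qed

lemma integrable_W_mult:
  fixes f :: "'a \<Rightarrow> 'b :: {banach, second_countable_topology}"
  assumes "integrable M f"
  shows "integrable M (\<lambda>x. W n x *\<^sub>R f x)"
proof -
  obtain C where C: "AE x in M. cmod (m0 x) \<le> C" using m0_bounded by (auto simp: Linf_def)
  have "AE x in M. \<forall>k. cmod (m0 ((r ^^ k) x)) \<le> C"
    unfolding AE_all_countable by (intro allI AE_r_pow C)
  then have bound: "AE x in M. W n x \<le> (C\<^sup>2) ^ n"
  proof eventually_elim
    case (elim x)
    have "W n x \<le> (\<Prod>k<n. C\<^sup>2)"
      unfolding W_def using elim by (intro prod_mono) (auto intro!: power_mono)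
    then show ?case by simp
  qed
  show ?thesis
  proof (rule Bochner_Integration.integrable_bound[OF integrable_scaleR_right[OF assms, of "(C\<^sup>2) ^ n"]])
    show "(\<lambda>x. W n x *\<^sub>R f x) \<in> borel_measurable M" using assms by measurable
    show "AE x in M. norm (W n x *\<^sub>R f x) \<le> norm ((C\<^sup>2) ^ n *\<^sub>R f x)"
      using bound by eventually_elim (auto intro!: mult_right_mono simp: W_nonneg)
  qed
qed

lemma T_measurable [measurable (raw)]: "f \<in> borel_measurable M \<Longrightarrow> T f \<in> borel_measurable M"
  unfolding transfer_op_def by measurable

text \<open>The factors \<open>W n x\<close> and \<open>k x\<close> depend on the base point of the
  fibre and can be pulled inside the average, where \<open>W n (r y)\<close> and the weight of
  \<open>T\<close> merge into \<open>W (Suc n) y\<close>.\<close>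

lemma W_mult_T:
  "complex_of_real (W n x) * (k x * T \<xi> x) =
    avg (\<lambda>y. complex_of_real (W (Suc n) y) * (k (r y) * \<xi> y)) x"
proof -
  have "complex_of_real (W n x) * (k x * T \<xi> x) =
      avg (\<lambda>y. (complex_of_real (W n (r y)) * k (r y)) * (complex_of_real ((cmod (m0 y))\<^sup>2) * \<xi> y)) x"
    unfolding transfer_op_def by (subst avg_pull_out) (simp only: mult.assoc)
  also have "\<dots> = avg (\<lambda>y. complex_of_real (W (Suc n) y) * (k (r y) * \<xi> y)) x"
    by (intro avg_cong) (simp only: W_Suc_r of_real_mult mult_ac)
  finally show ?thesis .
qed

text \<open>Relative to the weights, \<open>T\<close> is adjoint to composition with
  \<open>r\<close>. The density of \<open>omega\<close>, the consistency of the \<open>Om n\<close>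
  and the weak form of the relation defining \<open>\<H>\<close> all come from this
  identity.\<close>

lemma T_balance:
  assumes "integrable M (\<lambda>x. complex_of_real (W (Suc n) x) * (k (r x) * \<xi> x))"
  shows "integrable M (\<lambda>x. complex_of_real (W n x) * (k x * T \<xi> x))"
    "(\<integral>x. complex_of_real (W n x) * (k x * T \<xi> x) \<partial>M) =
     (\<integral>x. complex_of_real (W (Suc n) x) * (k (r x) * \<xi> x) \<partial>M)"
  using integrable_avg[OF assms] integral_avg[OF assms] by (simp_all add: W_mult_T)

lemma integral_T_pow:
  assumes "f \<in> borel_measurable M" "integrable M (\<lambda>x. complex_of_real (W n x) * f x)"
  shows "(\<integral>x. (T ^^ n) f x \<partial>M) = (\<integral>x. complex_of_real (W n x) * f x \<partial>M)"
  using assms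
proof (induction n arbitrary: f)
  case (Suc n)
  have i: "integrable M (\<lambda>x. complex_of_real (W n x) * T f x)"
    and e: "(\<integral>x. complex_of_real (W n x) * T f x \<partial>M) = (\<integral>x. complex_of_real (W (Suc n) x) * f x \<partial>M)"
    using T_balance[of n "\<lambda>_. 1" f] Suc.prems(2) by simp_all
  have "(T ^^ Suc n) f = (T ^^ n) (T f)" by (simp only: funpow_Suc_right o_apply)
  then show ?case using Suc.IH[OF T_measurable[OF Suc.prems(1)] i] e by simp
qed simp

section \<open>The weighted measures, their null sets and their consistency\<close>

lemma sets_Om [measurable_cong, simp]: "sets (Om n) = sets M"
  by (simp add: Om_def)

lemma space_Om [simp]: "space (Om n) = space M"
  by (simp add: Om_def)

lemma borel_measurable_Om [simp]: "borel_measurable (Om n) = borel_measurable M"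
  by (rule measurable_cong_sets) simp_all

lemma hW_integrable: "integrable M (\<lambda>x. h x * W n x)"
  using integrable_W_mult[OF h_integrable, of n] by (simp add: mult.commute)

lemma AE_hW_nonneg: "AE x in M. 0 \<le> h x * W n x"
  using h_nonneg by eventually_elim (simp add: W_nonneg)

lemma finite_measure_Om: "finite_measure (Om n)"
proof
  have "emeasure (Om n) (space M) = (\<integral>\<^sup>+x. ennreal (h x * W n x) \<partial>M)"
    by (auto simp: Om_def emeasure_density intro!: nn_integral_cong)
  also have "\<dots> = ennreal (\<integral>x. h x * W n x \<partial>M)"
    by (rule nn_integral_eq_integral[OF hW_integrable AE_hW_nonneg])
  finally show "emeasure (Om n) (space (Om n)) \<noteq> \<infinity>" by simp
qed

sublocale Om: finite_measure "Om n" for n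
  by (rule finite_measure_Om)

lemma integral_Om:
  fixes f :: "'a \<Rightarrow> complex"
  assumes "f \<in> borel_measurable M"
  shows "(\<integral>x. f x \<partial>Om n) = (\<integral>x. complex_of_real (W n x) * (f x * complex_of_real (h x)) \<partial>M)"
proof -
  have "(\<integral>x. f x \<partial>Om n) = (\<integral>x. (h x * W n x) *\<^sub>R f x \<partial>M)"
    unfolding Om_def by (rule integral_density[OF assms _ AE_hW_nonneg]) measurable
  then show ?thesis by (simp only: scaleR_conv_of_real of_real_mult mult_ac)
qed

lemma integrable_Om:
  fixes f :: "'a \<Rightarrow> complex"
  assumes "f \<in> borel_measurable M"
  shows "integrable (Om n) f \<longleftrightarrow> integrable M (\<lambda>x. complex_of_real (W n x) * (f x * complex_of_real (h x)))"
proof -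
  have "integrable (Om n) f \<longleftrightarrow> integrable M (\<lambda>x. (h x * W n x) *\<^sub>R f x)"
    unfolding Om_def by (rule integrable_density[OF assms _ AE_hW_nonneg]) measurable
  then show ?thesis by (simp only: scaleR_conv_of_real of_real_mult mult_ac)
qed

text \<open>The right-hand side does not mention \<open>n\<close>, so almost everywhere statements
  move freely between levels. Positivity of \<open>W n\<close> is what allows it to be dropped from
  the density.\<close>

lemma AE_Om: "(AE x in Om n. P x) \<longleftrightarrow> (AE x in M. h x \<noteq> 0 \<longrightarrow> P x)"
proof -
  have "(AE x in Om n. P x) \<longleftrightarrow> (AE x in M. 0 < ennreal (h x * W n x) \<longrightarrow> P x)"
    unfolding Om_def by (rule AE_density) measurable
  also have "\<dots> \<longleftrightarrow> (AE x in M. h x \<noteq> 0 \<longrightarrow> P x)"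
  proof (rule eventually_subst)
    show "AE x in M. (0 < ennreal (h x * W n x) \<longrightarrow> P x) = (h x \<noteq> 0 \<longrightarrow> P x)"
      using h_nonneg AE_W_pos by eventually_elim (auto simp: zero_less_mult_iff)
  qed
  finally show ?thesis .
qed

text \<open>The relation defining \<open>\<H>\<close> involves the products with \<open>h\<close>,
  taken modulo \<open>M\<close>; these are exactly what a class modulo \<open>Om n\<close>
  determines.\<close>

lemma AE_Om_mult_h:
  fixes f g :: "'a \<Rightarrow> complex"
  shows "(AE x in Om n. f x = g x) \<longleftrightarrow> (AE x in M. f x * complex_of_real (h x) = g x * complex_of_real (h x))"
  unfolding AE_Om by (rule AE_cong) auto

lemma AE_OmI: "AE x in M. P x \<Longrightarrow> AE x in Om n. P x"
  unfolding AE_Om by (elim eventually_mono) simp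

lemma Linf_Om: "Linf M \<subseteq> Linf (Om n)"
  by (auto simp: Linf_def intro: AE_OmI)

lemma Linf_integrable_Om:
  assumes "f \<in> Linf M"
  shows "integrable (Om n) f"
proof -
  obtain C where "AE x in Om n. cmod (f x) \<le> C" and "f \<in> borel_measurable M"
    using assms Linf_Om[of n] by (auto simp: Linf_def)
  then show ?thesis by (intro Om.integrable_const_bound) auto
qed

lemma transfer_integral_eq:
  assumes "f \<in> borel_measurable M" "integrable (Om n) f"
  shows "transfer_integral M r m0 h n f = (\<integral>x. f x \<partial>Om n)"
  unfolding transfer_integral_def integral_Om[OF assms(1)]
  using assms integrable_Om[OF assms(1), of n] by (intro integral_T_pow) auto

lemma indicator_Linf: "A \<in> sets M \<Longrightarrow> (\<lambda>x. complex_of_real (indicator A x)) \<in> Linf M"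
  by (auto simp: Linf_def intro!: exI[of _ 1] AE_I2 split: split_indicator)

text \<open>Existence is the integrated transfer identity \<open>integral_T_pow\<close> in the form
  \<open>transfer_integral_eq\<close>; uniqueness follows by testing with indicators, which belong
  to \<open>Linf M\<close>.\<close>

lemma omega_eq: "omega M r m0 h n = Om n"
  unfolding omega_def
proof (rule the_equality)
  have P: "(\<integral>x. f x \<partial>Om n) = transfer_integral M r m0 h n f" if "f \<in> Linf M" for f
    using Linf_integrable_Om[OF that] that by (simp only: transfer_integral_eq Linf_def mem_Collect_eq)
  then show "sets (Om n) = sets M \<and> finite_measure (Om n) \<and>
     (\<forall>f\<in>Linf M. (\<integral>x. f x \<partial>Om n) = transfer_integral M r m0 h n f)"
    by (simp add: finite_measure_Om)
  fix N assume N: "sets N = sets M \<and> finite_measure N \<and>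
     (\<forall>f\<in>Linf M. (\<integral>x. f x \<partial>N) = transfer_integral M r m0 h n f)"
  show "N = Om n"
  proof (rule finite_measure_eqI_integral)
    fix A assume "A \<in> sets N"
    then have "(\<lambda>x. complex_of_real (indicator A x)) \<in> Linf M"
      using N by (intro indicator_Linf) simp
    then show "(\<integral>x. complex_of_real (indicator A x) \<partial>N) = (\<integral>x. complex_of_real (indicator A x) \<partial>Om n)"
      using N P by metis
  qed (use N finite_measure_Om in simp_all)
qed

text \<open>Here \<open>R h = h\<close> enters: adjointness turns the integral of
  \<open>k (r x)\<close> at level \<open>n + 1\<close> into one of \<open>k\<close> against
  \<open>T h\<close>, and the fixed point equation replaces \<open>T h\<close> by
  \<open>h\<close>.\<close>

lemma distr_Om_Suc: "distr (Om (Suc n)) M r = Om n"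
proof (rule finite_measure_eqI_integral)
  show "finite_measure (distr (Om (Suc n)) M r)"
    by (rule Om.finite_measure_distr) simp
  show "finite_measure (Om n)" by (rule finite_measure_Om)
  fix A assume "A \<in> sets (distr (Om (Suc n)) M r)"
  then have [measurable]: "A \<in> sets M" by simp
  let ?k = "\<lambda>x. complex_of_real (indicator A x)" and ?h = "\<lambda>x. complex_of_real (h x)"
  have L: "(\<lambda>x. ?k (r x)) \<in> Linf M" using Linf_r_pow[OF indicator_Linf[of A], of 1] by simp
  then have [measurable]: "(\<lambda>x. ?k (r x)) \<in> borel_measurable M" by (simp add: Linf_def)
  have i: "integrable M (\<lambda>x. complex_of_real (W (Suc n) x) * (?k (r x) * ?h x))"
    using Linf_integrable_Om[OF L, of "Suc n"] integrable_Om[of "\<lambda>x. ?k (r x)" "Suc n"] by simp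
  have "(\<integral>x. ?k x \<partial>distr (Om (Suc n)) M r) = (\<integral>x. ?k (r x) \<partial>Om (Suc n))"
    by (rule integral_distr) auto
  also have "\<dots> = (\<integral>x. complex_of_real (W (Suc n) x) * (?k (r x) * ?h x) \<partial>M)"
    by (rule integral_Om) measurable
  also have "\<dots> = (\<integral>x. complex_of_real (W n x) * (?k x * T ?h x) \<partial>M)"
    by (rule T_balance(2)[OF i, symmetric])
  also have "\<dots> = (\<integral>x. complex_of_real (W n x) * (?k x * ?h x) \<partial>M)"
  proof (rule integral_cong_AE)
    have "T ?h \<in> borel_measurable M" by (rule T_measurable) measurable
    then show "(\<lambda>x. complex_of_real (W n x) * (?k x * T ?h x)) \<in> borel_measurable M" by measurable
    show "AE x in M. complex_of_real (W n x) * (?k x * T ?h x) = complex_of_real (W n x) * (?k x * ?h x)"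
      using h_fixed by eventually_elim (simp only:)
  qed measurable
  also have "\<dots> = (\<integral>x. ?k x \<partial>Om n)"
    by (rule integral_Om[symmetric]) measurable
  finally show "(\<integral>x. ?k x \<partial>distr (Om (Suc n)) M r) = (\<integral>x. ?k x \<partial>Om n)" .
qed simp

lemma emeasure_Om_Suc: "A \<in> sets M \<Longrightarrow> emeasure (Om (Suc n)) (r -` A \<inter> space M) = emeasure (Om n) A"
  using emeasure_distr[of r "Om (Suc n)" M A] by (simp add: distr_Om_Suc)

lemma emeasure_Om_add:
  "A \<in> sets M \<Longrightarrow> emeasure (Om (n + k)) ((r ^^ k) -` A \<inter> space M) = emeasure (Om n) A"
proof (induction k)
  case (Suc k)
  have "(r ^^ Suc k) -` A \<inter> space M = r -` ((r ^^ k) -` A \<inter> space M) \<inter> space M"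
    using r_space by (auto simp: funpow_swap1)
  then show ?case
    using Suc emeasure_Om_Suc[of "(r ^^ k) -` A \<inter> space M" "n + k"]
    by (simp only: add_Suc_right measurable_sets[OF r_pow_measurable])
next
  case 0
  then show ?case by (simp add: Int_absorb2 sets.sets_into_space)
qed

end

section \<open>The path space and its measure\<close>

context transfer_setting
begin

abbreviation paths :: "(nat \<Rightarrow> 'a) set" where
  "paths \<equiv> path_space M r"

definition cyl :: "nat \<Rightarrow> 'a set \<Rightarrow> (nat \<Rightarrow> 'a) set" where
  "cyl n A = theta n -` A \<inter> paths"

definition cylinders :: "(nat \<Rightarrow> 'a) set set" where
  "cylinders = {cyl n A | n A. A \<in> sets M}"

lemma theta_space: "p \<in> paths \<Longrightarrow> theta n p \<in> space M"
  by (simp add: path_space_def theta_def)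

lemma theta_r_pow: "p \<in> paths \<Longrightarrow> (r ^^ k) (theta (n + k) p) = theta n p"
  by (induction k) (simp_all add: path_space_def theta_def funpow_swap1[symmetric] funpow_Suc_right del: funpow.simps(2))

lemma theta_Suc: "p \<in> paths \<Longrightarrow> r (theta (Suc n) p) = theta n p"
  by (simp add: path_space_def theta_def)

lemma theta_0: "p \<in> paths \<Longrightarrow> theta 0 p = (r ^^ n) (theta n p)"
  using theta_r_pow[of p n 0] by simp

lemma r_pow_space: "x \<in> space M \<Longrightarrow> (r ^^ n) x \<in> space M"
  by (induction n) (auto intro: r_space)

text \<open>Below index \<open>n\<close> the path is forced by iterating \<open>r\<close>; above it
  a section \<open>s\<close> of the surjection \<open>r\<close> supplies preimages. Surjectivity of
  \<open>theta n\<close> is what allows the base of a cylinder to be recovered from the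
  cylinder.\<close>

lemma ex_path_through:
  assumes x: "x \<in> space M"
  shows "\<exists>p\<in>paths. theta n p = x"
proof -
  define s where "s = inv_into (space M) r"
  have s: "s y \<in> space M" "r (s y) = y" if "y \<in> space M" for y
    unfolding s_def using that r_onto by (auto intro: inv_into_into f_inv_into_f)
  have s_pow: "(s ^^ k) x \<in> space M" for k by (induction k) (auto simp: x s)
  define p where "p k = (if k \<le> n then (r ^^ (n - k)) x else (s ^^ (k - n)) x)" for k
  have "r (p (Suc k)) = p k" for k
  proof (cases "Suc k \<le> n")
    case True
    then have "n - k = Suc (n - Suc k)" by simp
    then show ?thesis using True by (simp add: p_def)
  next
    case False
    then have "Suc k - n = Suc (k - n)" by simp
    then show ?thesis using False s_pow[of "k - n"] by (cases "k = n") (simp_all add: p_def s x)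
  qed
  moreover have "p k \<in> space M" for k by (simp add: p_def s_pow r_pow_space x)
  ultimately have "p \<in> paths" by (simp add: path_space_def)
  then show ?thesis by (intro bexI[of _ p]) (simp_all add: theta_def p_def)
qed

lemma theta_image_cyl: "A \<subseteq> space M \<Longrightarrow> theta n ` cyl n A = A"
  using ex_path_through[of _ n] by (fastforce simp: cyl_def)

lemma cyl_lift: "cyl n A = cyl (n + k) ((r ^^ k) -` A \<inter> space M)"
  by (auto simp: cyl_def theta_r_pow theta_space)

lemma cyl_subset: "cyl n A \<subseteq> paths"
  by (simp add: cyl_def)

lemma cyl_Un: "cyl n (A \<union> B) = cyl n A \<union> cyl n B"
  by (auto simp: cyl_def)

lemma cyl_Diff: "cyl n (A - B) = cyl n A - cyl n B"
  by (auto simp: cyl_def)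

lemma cyl_Int: "cyl n (A \<inter> B) = cyl n A \<inter> cyl n B"
  by (auto simp: cyl_def)

lemma cyl_empty: "cyl n {} = {}"
  by (simp add: cyl_def)

lemma cyl_space: "cyl n (space M) = paths"
  by (auto simp: cyl_def theta_space)

lemma cyl_common_level:
  assumes "S \<in> cylinders" "S' \<in> cylinders"
  obtains n A B where "A \<in> sets M" "B \<in> sets M" "S = cyl n A" "S' = cyl n B"
proof -
  obtain n A m B where *: "S = cyl n A" "A \<in> sets M" "S' = cyl m B" "B \<in> sets M"
    using assms by (auto simp: cylinders_def)
  show thesis
  proof (rule that)
    show "S = cyl (n + m) ((r ^^ m) -` A \<inter> space M)" using * cyl_lift by simp
    show "S' = cyl (n + m) ((r ^^ n) -` B \<inter> space M)" using * cyl_lift[of m B n] by (simp add: add.commute)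
  qed (use * measurable_sets[OF r_pow_measurable] in auto)
qed

lemma cylinders_I: "A \<in> sets M \<Longrightarrow> cyl n A \<in> cylinders"
  by (auto simp: cylinders_def)

lemma ring_of_cylinders: "ring_of_sets paths cylinders"
proof (rule ring_of_setsI)
  show "cylinders \<subseteq> Pow paths" using cyl_subset by (auto simp: cylinders_def)
  show "{} \<in> cylinders" using cylinders_I[of "{}" 0] by (simp add: cyl_empty)
  fix a b assume "a \<in> cylinders" "b \<in> cylinders"
  then obtain n A B where "A \<in> sets M" "B \<in> sets M" "a = cyl n A" "b = cyl n B"
    by (rule cyl_common_level)
  then show "a \<union> b \<in> cylinders" "a - b \<in> cylinders"
    by (auto simp flip: cyl_Un cyl_Diff intro: cylinders_I)
qed

lemma Int_stable_cylinders: "Int_stable cylinders"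
proof (rule Int_stableI)
  fix a b assume "a \<in> cylinders" "b \<in> cylinders"
  then obtain n A B where "A \<in> sets M" "B \<in> sets M" "a = cyl n A" "b = cyl n B"
    by (rule cyl_common_level)
  then show "a \<inter> b \<in> cylinders"
    by (auto simp flip: cyl_Int intro: cylinders_I)
qed

lemma cylinders_Pow: "cylinders \<subseteq> Pow paths"
  using ring_of_cylinders by (simp add: ring_of_sets_iff)

lemma sets_path_sigma: "sets (path_sigma M r) = sigma_sets paths cylinders"
  unfolding path_sigma_def using cylinders_Pow
  by (subst sets_measure_of) (auto simp: cylinders_def cyl_def)

lemma space_path_sigma: "space (path_sigma M r) = paths"
  unfolding path_sigma_def using cylinders_Pow
  by (subst space_measure_of) (auto simp: cylinders_def cyl_def)

section \<open>The premeasure on cylinders and its extension\<close>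

definition premeasure :: "(nat \<Rightarrow> 'a) set \<Rightarrow> ennreal" where
  "premeasure S = (THE v. \<exists>n A. A \<in> sets M \<and> S = cyl n A \<and> v = emeasure (Om n) A)"

text \<open>Both cylinders are rewritten at the common level \<open>n + m\<close>. Since
  \<open>theta (n + m)\<close> is onto, their bases there coincide, and consistency of the
  \<open>Om\<close> carries the common value back to both levels.\<close>

lemma emeasure_Om_cyl_unique:
  assumes "A \<in> sets M" "B \<in> sets M" "cyl n A = cyl m B"
  shows "emeasure (Om n) A = emeasure (Om m) B"
proof -
  let ?A = "(r ^^ m) -` A \<inter> space M" and ?B = "(r ^^ n) -` B \<inter> space M"
  have "cyl (n + m) ?A = cyl (n + m) ?B"
    using assms(3) cyl_lift[of n A m] cyl_lift[of m B n] by (simp add: add.commute)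
  then have "theta (n + m) ` cyl (n + m) ?A = theta (n + m) ` cyl (n + m) ?B" by simp
  then have "?A = ?B" by (simp add: theta_image_cyl)
  then show ?thesis
    using emeasure_Om_add[OF assms(1), of n m] emeasure_Om_add[OF assms(2), of m n]
    by (simp add: add.commute)
qed

lemma premeasure_cyl: "A \<in> sets M \<Longrightarrow> premeasure (cyl n A) = emeasure (Om n) A"
  unfolding premeasure_def by (rule the_equality) (auto intro: emeasure_Om_cyl_unique)

text \<open>Koenig's lemma: every fibre of \<open>theta 0\<close> is an inverse limit of finite sets.\<close>

lemma decseq_cylinders_nonempty:
  assumes S: "range S \<subseteq> cylinders" and dec: "decseq S"
    and x: "\<And>i. \<exists>p\<in>S i. theta 0 p = x"
  shows "(\<Inter>i. S i) \<noteq> {}"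
proof -
  have sub: "S i \<subseteq> paths" for i using S cylinders_Pow by auto
  have "\<exists>y. \<forall>n. (\<forall>i. \<exists>p\<in>S i. theta n p = y n) \<and> r (y (Suc n)) = y n"
  proof (rule dependent_nat_choice)
    show "\<exists>y. \<forall>i. \<exists>p\<in>S i. theta 0 p = y" using x by blast
  next
    fix y n assume y: "\<forall>i. \<exists>p\<in>S i. theta n p = y"
    show "\<exists>y'. (\<forall>i. \<exists>p\<in>S i. theta (Suc n) p = y') \<and> r y' = y"
    proof (rule ccontr)
      assume contra: "\<not> ?thesis"
      have "\<forall>y'\<in>fibre M r y. \<exists>i. \<forall>p\<in>S i. theta (Suc n) p \<noteq> y'"
        using contra by (auto simp: fibre_def)
      then obtain i where i: "\<And>y' p. y' \<in> fibre M r y \<Longrightarrow> p \<in> S (i y') \<Longrightarrow> theta (Suc n) p \<noteq> y'"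
        by metis
      \<comment> \<open>The sum is an upper bound for the finitely many bad indices. As
        \<open>S\<close> decreases, a point of \<open>S N\<close> above \<open>y\<close> lies in
        every \<open>S (i y')\<close>, including the one that its own next coordinate should
        avoid.\<close>
      define N where "N = (\<Sum>y'\<in>fibre M r y. i y')"
      obtain p where p: "p \<in> S N" "theta n p = y" using y by blast
      have fib: "theta (Suc n) p \<in> fibre M r y"
        using p theta_Suc theta_space subsetD[OF sub p(1)] by (simp add: fibre_def)
      then have "i (theta (Suc n) p) \<le> N"
        unfolding N_def by (intro member_le_sum) (auto simp: finite_fibre)
      then have "p \<in> S (i (theta (Suc n) p))" using dec p(1) by (auto simp: decseq_def)
      then show False using i[OF fib] by blast
    qed
  qed
  then obtain y where "\<forall>n. (\<forall>i. \<exists>p\<in>S i. theta n p = y n) \<and> r (y (Suc n)) = y n" ..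
  then have y: "\<exists>p\<in>S i. theta n p = y n" "r (y (Suc n)) = y n" for n i by simp_all
  have "y n \<in> space M" for n
  proof -
    obtain p where "p \<in> S 0" "theta n p = y n" using y(1) by blast
    then show ?thesis using theta_space[OF subsetD[OF sub], of p 0 n] by simp
  qed
  then have "y \<in> paths" using y(2) by (simp add: path_space_def)
  \<comment> \<open>Membership of a path in a cylinder is decided by one coordinate, and at that
    coordinate \<open>y\<close> agrees with some path in \<open>S i\<close>.\<close>
  have "y \<in> S i" for i
  proof -
    have "S i \<in> cylinders" using S by blast
    then obtain n A where A: "S i = cyl n A" unfolding cylinders_def by blast
    obtain p where "p \<in> S i" "theta n p = y n" using y(1) by blast
    then show ?thesis using \<open>y \<in> paths\<close> by (simp add: A cyl_def theta_def)
  qed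
  then show ?thesis by blast
qed

text \<open>A fibre meets \<open>A\<close> exactly when the average of the indicator of
  \<open>A\<close> over it is nonzero, and that average is a measurable function.\<close>

lemma image_r_measurable:
  assumes "A \<in> sets M"
  shows "r ` A \<in> sets M"
proof -
  have [measurable]: "A \<in> sets M" by fact
  let ?a = "avg (\<lambda>y. complex_of_real (indicator A y))"
  have "?a x \<noteq> 0 \<longleftrightarrow> x \<in> r ` A" if x: "x \<in> space M" for x
  proof -
    have "?a x \<noteq> 0 \<longleftrightarrow> (\<Sum>y\<in>fibre M r x. indicator A y :: real) \<noteq> 0"
      using card_fibre_pos[OF x] by (simp add: avg_of_real flip: of_real_sum)
    also have "\<dots> \<longleftrightarrow> (\<exists>y\<in>fibre M r x. y \<in> A)"
      by (subst sum_nonneg_eq_0_iff) (auto simp: finite_fibre indicator_def)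
    also have "\<dots> \<longleftrightarrow> x \<in> r ` A"
      using sets.sets_into_space[OF assms] by (auto simp: fibre_def)
    finally show ?thesis .
  qed
  then have "r ` A = {x \<in> space M. ?a x \<noteq> 0}"
    using sets.sets_into_space[OF assms] r_space by blast
  also have "\<dots> \<in> sets M"
  proof -
    have "?a \<in> borel_measurable M" by (rule avg_measurable) measurable
    then show ?thesis by measurable
  qed
  finally show ?thesis .
qed

lemma image_r_pow_measurable: "A \<in> sets M \<Longrightarrow> (r ^^ n) ` A \<in> sets M"
proof (induction n)
  case (Suc n)
  have "(r ^^ Suc n) ` A = r ` ((r ^^ n) ` A)" by (simp add: image_comp)
  then show ?case using image_r_measurable Suc by simp
qed simp

lemma theta_0_image_cyl:
  assumes "A \<in> sets M"
  shows "theta 0 ` cyl n A = (r ^^ n) ` A"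
proof -
  have "theta 0 ` cyl n A = (r ^^ n) ` (theta n ` cyl n A)"
    unfolding image_image by (intro image_cong refl theta_0) (simp add: cyl_def)
  then show ?thesis using theta_image_cyl[OF sets.sets_into_space[OF assms]] by simp
qed

text \<open>\<open>A\<close> is contained in the preimage under \<open>r ^^ n\<close> of its own
  image, and by consistency that preimage has the \<open>Om 0\<close> measure of the image. All
  levels are thereby controlled by one finite measure.\<close>

lemma premeasure_le_base:
  assumes "S \<in> cylinders"
  shows "theta 0 ` S \<in> sets M" "premeasure S \<le> emeasure (Om 0) (theta 0 ` S)"
proof -
  obtain n A where A: "S = cyl n A" "A \<in> sets M" using assms by (auto simp: cylinders_def)
  let ?D = "(r ^^ n) ` A"
  show "theta 0 ` S \<in> sets M" using A image_r_pow_measurable by (simp add: theta_0_image_cyl)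
  have D: "?D \<in> sets M" using A(2) by (rule image_r_pow_measurable)
  have "emeasure (Om n) A \<le> emeasure (Om n) ((r ^^ n) -` ?D \<inter> space M)"
    using A(2) sets.sets_into_space[OF A(2)] measurable_sets[OF r_pow_measurable D]
    by (intro emeasure_mono) auto
  also have "\<dots> = emeasure (Om 0) ?D" using emeasure_Om_add[OF D, of 0 n] by simp
  finally show "premeasure S \<le> emeasure (Om 0) (theta 0 ` S)"
    using A by (simp add: premeasure_cyl theta_0_image_cyl)
qed

lemma premeasure_continuous:
  assumes S: "range S \<subseteq> cylinders" and dec: "decseq S" and empty: "(\<Inter>i. S i) = {}"
  shows "(\<lambda>i. premeasure (S i)) \<longlonglongrightarrow> 0"
proof (rule tendsto_sandwich[OF _ _ tendsto_const])
  have "(\<lambda>i. emeasure (Om 0) (theta 0 ` S i)) \<longlonglongrightarrow> emeasure (Om 0) (\<Inter>i. theta 0 ` S i)"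
  proof (rule Lim_emeasure_decseq)
    show "range (\<lambda>i. theta 0 ` S i) \<subseteq> sets (Om 0)" using S premeasure_le_base(1) by auto
    show "decseq (\<lambda>i. theta 0 ` S i)" using dec by (auto simp: decseq_def)
  qed simp
  moreover have "(\<Inter>i. theta 0 ` S i) = {}"
  proof (rule ccontr)
    assume "(\<Inter>i. theta 0 ` S i) \<noteq> {}"
    then obtain x where x: "\<And>i. x \<in> theta 0 ` S i" by blast
    have "\<exists>p\<in>S i. theta 0 p = x" for i using x[of i] by auto
    from decseq_cylinders_nonempty[OF S dec this] show False using empty by simp
  qed
  ultimately show "(\<lambda>i. emeasure (Om 0) (theta 0 ` S i)) \<longlonglongrightarrow> 0" by simp
  show "\<forall>\<^sub>F i in sequentially. premeasure (S i) \<le> emeasure (Om 0) (theta 0 ` S i)"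
    using S by (intro always_eventually allI premeasure_le_base(2)) auto
qed auto

lemma ex_path_measure:
  "\<exists>P. sets P = sets (path_sigma M r) \<and> (\<forall>n. \<forall>A\<in>sets M. emeasure P (cyl n A) = emeasure (Om n) A)"
proof -
  interpret ring_of_sets paths cylinders by (rule ring_of_cylinders)
  have "\<exists>\<mu>. (\<forall>s\<in>cylinders. \<mu> s = premeasure s) \<and> measure_space paths (sigma_sets paths cylinders) \<mu>"
  proof (rule caratheodory_empty_continuous)
    show "positive cylinders premeasure"
      using premeasure_cyl[of "{}" 0] by (simp add: positive_def cyl_empty)
    show "additive cylinders premeasure"
      unfolding additive_def
    proof (intro ballI impI)
      fix a b assume "a \<in> cylinders" "b \<in> cylinders" and disj: "a \<inter> b = {}"
      then obtain n A B where *: "A \<in> sets M" "B \<in> sets M" "a = cyl n A" "b = cyl n B"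
        using cyl_common_level by metis
      have "A \<inter> B = {}"
      proof -
        have "theta n ` cyl n (A \<inter> B) = {}" using disj * by (simp add: cyl_Int)
        then show ?thesis
          using theta_image_cyl[of "A \<inter> B" n] sets.sets_into_space[OF *(1)] by auto
      qed
      then show "premeasure (a \<union> b) = premeasure a + premeasure b"
        using * by (simp add: premeasure_cyl plus_emeasure flip: cyl_Un)
    qed
    show "premeasure A \<noteq> \<infinity>" if "A \<in> cylinders" for A
      using that by (auto simp: cylinders_def premeasure_cyl)
  qed (rule premeasure_continuous)
  then obtain \<mu> where \<mu>: "\<And>s. s \<in> cylinders \<Longrightarrow> \<mu> s = premeasure s"
    "measure_space paths (sigma_sets paths cylinders) \<mu>" by blast
  let ?P = "measure_of paths cylinders \<mu>"
  have "sets ?P = sets (path_sigma M r)"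
    using cylinders_Pow by (simp add: sets_path_sigma)
  moreover have "emeasure ?P (cyl n A) = emeasure (Om n) A" if A: "A \<in> sets M" for n A
    using \<mu> cylinders_Pow cylinders_I[OF A, of n]
    by (simp add: emeasure_measure_of_conv sigma_sets.Basic premeasure_cyl[OF A])
  ultimately show ?thesis by blast
qed

section \<open>The measure on path space and its determination by cylinders\<close>

lemma theta_measurable_path_sigma: "theta n \<in> measurable (path_sigma M r) M"
proof (rule measurableI)
  fix A assume "A \<in> sets M"
  then show "theta n -` A \<inter> space (path_sigma M r) \<in> sets (path_sigma M r)"
    unfolding space_path_sigma sets_path_sigma cyl_def[symmetric]
    by (intro sigma_sets.Basic cylinders_I)
qed (simp add: space_path_sigma theta_space)

lemma distr_theta_eq_iff:
  assumes "sets N = sets (path_sigma M r)" "sets N' = sets M"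
  shows "distr N M (theta n) = N' \<longleftrightarrow> (\<forall>A\<in>sets M. emeasure N (cyl n A) = emeasure N' A)"
proof -
  have [measurable]: "theta n \<in> measurable N M"
    using theta_measurable_path_sigma measurable_cong_sets[OF assms(1) refl] by blast
  have sp: "space N = paths" using sets_eq_imp_space_eq[OF assms(1)] by (simp add: space_path_sigma)
  have "emeasure (distr N M (theta n)) A = emeasure N (cyl n A)" if "A \<in> sets M" for A
    using that by (simp add: emeasure_distr sp cyl_def)
  then show ?thesis
    using assms(2) by (auto intro!: measure_eqI)
qed

lemma path_measure_eqI:
  assumes N: "sets N = sets (path_sigma M r)" and N': "sets N' = sets (path_sigma M r)"
    and distr: "\<And>n. distr N M (theta n) = Om n" "\<And>n. distr N' M (theta n) = Om n"
  shows "N = N'"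
proof (rule measure_eqI_generator_eq[OF Int_stable_cylinders cylinders_Pow])
  have eq: "emeasure N (cyl n A) = emeasure (Om n) A" "emeasure N' (cyl n A) = emeasure (Om n) A"
    if "A \<in> sets M" for n A
    using distr distr_theta_eq_iff[OF N, of "Om n" n] distr_theta_eq_iff[OF N', of "Om n" n] that by simp_all
  then show "emeasure N X = emeasure N' X" if "X \<in> cylinders" for X
    using that by (auto simp: cylinders_def)
  show "sets N = sigma_sets paths cylinders" "sets N' = sigma_sets paths cylinders"
    using N N' by (simp_all add: sets_path_sigma)
  show "range (\<lambda>_::nat. paths) \<subseteq> cylinders" using cylinders_I[of "space M" 0] by (simp add: cyl_space)
  show "emeasure N paths \<noteq> \<infinity>" using eq(1)[of "space M" 0] by (simp add: cyl_space)
qed simp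

definition P :: "(nat \<Rightarrow> 'a) measure" where
  "P = muhat M r m0 h"

lemma P_spec: "sets P = sets (path_sigma M r) \<and> (\<forall>n. distr P M (theta n) = omega M r m0 h n)"
  unfolding P_def muhat_def omega_eq
proof -
  obtain N where "sets N = sets (path_sigma M r)"
    "\<forall>n. \<forall>A\<in>sets M. emeasure N (cyl n A) = emeasure (Om n) A"
    using ex_path_measure by blast
  then have N: "sets N = sets (path_sigma M r) \<and> (\<forall>n. distr N M (theta n) = Om n)"
    by (simp add: distr_theta_eq_iff)
  let ?Q = "\<lambda>P. sets P = sets (path_sigma M r) \<and> (\<forall>n. distr P M (theta n) = Om n)"
  show "?Q (THE P. ?Q P)"
  proof (rule theI[of ?Q, OF N])
    show "N' = N" if "sets N' = sets (path_sigma M r) \<and> (\<forall>n. distr N' M (theta n) = Om n)" for N'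
      using that N by (intro path_measure_eqI) auto
  qed
qed

lemma sets_P: "sets P = sets (path_sigma M r)"
  using P_spec by simp

lemma space_P [simp]: "space P = paths"
  using sets_eq_imp_space_eq[OF sets_P] by (simp add: space_path_sigma)

lemma distr_P: "distr P M (theta n) = Om n"
  using P_spec by (simp add: omega_eq)

lemma theta_measurable [measurable]: "theta n \<in> measurable P M"
  using theta_measurable_path_sigma measurable_cong_sets[OF sets_P refl] by blast

lemma emeasure_P_cyl: "A \<in> sets M \<Longrightarrow> emeasure P (cyl n A) = emeasure (Om n) A"
  using distr_theta_eq_iff[OF sets_P sets_Om] distr_P by blast

lemma finite_measure_P: "finite_measure P"
  using emeasure_P_cyl[of "space M" 0] by (intro finite_measureI) (simp add: cyl_space)

sublocale P: finite_measure P
  by (rule finite_measure_P)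

lemma integral_theta:
  fixes f :: "'a \<Rightarrow> 'b :: {banach, second_countable_topology}"
  assumes "f \<in> borel_measurable M"
  shows "(\<integral>p. f (theta n p) \<partial>P) = (\<integral>x. f x \<partial>Om n)"
  using integral_distr[OF theta_measurable assms, of n] by (simp add: distr_P)

lemma integrable_theta:
  fixes f :: "'a \<Rightarrow> 'b :: {banach, second_countable_topology}"
  assumes "f \<in> borel_measurable M"
  shows "integrable P (\<lambda>p. f (theta n p)) \<longleftrightarrow> integrable (Om n) f"
  using integrable_distr_eq[OF theta_measurable assms, of n] by (simp add: distr_P)

lemma AE_theta: "AE x in Om n. Q x \<Longrightarrow> AE p in P. Q (theta n p)"
  using AE_distrD[of "theta n" P M Q] unfolding distr_P by simp

lemma AE_theta_iff:
  assumes [measurable]: "{x \<in> space M. Q x} \<in> sets M"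
  shows "(AE p in P. Q (theta n p)) \<longleftrightarrow> (AE x in Om n. Q x)"
  using AE_distr_iff[OF theta_measurable assms, of n] unfolding distr_P by simp

text \<open>The sets over which \<open>f\<close> integrates to zero form a Dynkin system: closure
  under complements uses that \<open>paths\<close> is itself a cylinder, so the total integral
  vanishes. Cylinders are stable under intersection and generate.\<close>

lemma AE_zero_of_cyl_integrals:
  fixes f :: "(nat \<Rightarrow> 'a) \<Rightarrow> complex"
  assumes f: "integrable P f"
    and zero: "\<And>n A. A \<in> sets M \<Longrightarrow> (LINT p:cyl n A|P. f p) = 0"
  shows "AE p in P. f p = 0"
proof (rule P.density_zero[OF f])
  have all: "(\<integral>p. f p \<partial>P) = 0"
    using zero[of "space M" 0] set_integral_space[OF f] by (simp add: cyl_space)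
  have si: "set_integrable P A f" if "A \<in> sets P" for A
    using f that unfolding set_integrable_def by (intro integrable_mult_indicator) auto
  fix A assume "A \<in> sets P"
  then have "A \<in> sigma_sets paths cylinders" by (simp add: sets_P sets_path_sigma)
  from Int_stable_cylinders cylinders_Pow this show "(LINT p:A|P. f p) = 0"
  proof (induction rule: sigma_sets_induct_disjoint)
    case (basic A)
    then show ?case using zero by (auto simp: cylinders_def)
  next
    case empty
    then show ?case by (simp add: set_lebesgue_integral_def)
  next
    case (compl A)
    then have A: "A \<in> sets P" by (simp add: sets_P sets_path_sigma)
    have "(LINT p:(paths - A) \<union> A|P. f p) = (LINT p:paths - A|P. f p) + (LINT p:A|P. f p)"
      using A sets.compl_sets[OF A] by (intro set_integral_Un si) auto
    moreover have "(paths - A) \<union> A = space P" using sets.sets_into_space[OF A] by auto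
    ultimately show ?case using compl all set_integral_space[OF f] by simp
  next
    case (union A)
    then have A: "A i \<in> sets P" for i by (auto simp: sets_P sets_path_sigma)
    have "(LINT p:(\<Union>i. A i)|P. f p) = (\<Sum>i. LINT p:A i|P. f p)"
      using A union(1) by (intro lebesgue_integral_countable_add si) (auto simp: disjoint_family_on_def)
    then show ?case using union by simp
  qed
qed

section \<open>The shift on path space and its change of variables\<close>

lemma rhat_paths: "p \<in> paths \<Longrightarrow> rhat r p \<in> paths"
  by (auto simp: path_space_def rhat_def r_space split: nat.splits)

lemma theta_Suc_rhat: "theta (Suc n) (rhat r p) = theta n p"
  by (simp add: theta_def rhat_def)

lemma theta_0_rhat: "theta 0 (rhat r p) = r (theta 0 p)"
  by (simp add: theta_def rhat_def)

text \<open>It suffices to pull back cylinders: the condition on coordinate \<open>k + 1\<close>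
  becomes the same condition on coordinate \<open>k\<close>, and coordinate \<open>0\<close> is
  pulled back through \<open>r\<close>.\<close>

lemma rhat_measurable [measurable]: "rhat r \<in> measurable P P"
proof (rule measurable_sigma_sets[OF _ cylinders_Pow])
  show "sets P = sigma_sets paths cylinders" by (simp add: sets_P sets_path_sigma)
  show "rhat r \<in> space P \<rightarrow> paths" using rhat_paths by simp
  fix S assume "S \<in> cylinders"
  then obtain n A where S: "S = cyl n A" and A [measurable]: "A \<in> sets M" by (auto simp: cylinders_def)
  have "rhat r -` S \<inter> space P = {p \<in> space P. theta n (rhat r p) \<in> A}"
    using rhat_paths by (auto simp: S cyl_def)
  also have "\<dots> \<in> sets P"
  proof (cases n)
    case 0
    have "{p \<in> space P. r (theta 0 p) \<in> A} \<in> sets P" by measurable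
    then show ?thesis by (simp add: 0 theta_0_rhat)
  next
    case (Suc k)
    have "{p \<in> space P. theta k p \<in> A} \<in> sets P" by measurable
    then show ?thesis by (simp add: Suc theta_Suc_rhat)
  qed
  finally show "rhat r -` S \<inter> space P \<in> sets P" .
qed

text \<open>The factor of \<open>W (Suc n)\<close> at index \<open>n\<close> makes the next level a
  change of density on the same space, a second link between levels besides projection along
  \<open>r\<close>. The formula for \<open>U\<close> rests on it.\<close>

lemma density_Om: "density (Om n) (\<lambda>x. ennreal ((cmod (m0 ((r ^^ n) x)))\<^sup>2)) = Om (Suc n)"
proof -
  have "density (Om n) (\<lambda>x. ennreal ((cmod (m0 ((r ^^ n) x)))\<^sup>2)) =
      density M (\<lambda>x. ennreal (h x * W n x) * ennreal ((cmod (m0 ((r ^^ n) x)))\<^sup>2))"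
    unfolding Om_def by (rule density_density_eq) measurable
  also have "\<dots> = Om (Suc n)"
    unfolding Om_def W_Suc mult.assoc[symmetric]
    by (intro density_cong) (auto simp: ennreal_mult'')
  finally show ?thesis .
qed

definition PD :: "(nat \<Rightarrow> 'a) measure" where
  "PD = density P (\<lambda>p. ennreal ((cmod (m0 (theta 0 p)))\<^sup>2))"

lemma sets_PD [measurable_cong, simp]: "sets PD = sets P"
  by (simp add: PD_def)

text \<open>On paths \<open>theta 0\<close> equals \<open>r ^^ n\<close> after
  \<open>theta n\<close>, so the density is a function of coordinate \<open>n\<close> and passes
  through the image measure.\<close>

lemma distr_PD_theta: "distr PD M (theta n) = Om (Suc n)"
proof -
  have "PD = density P (\<lambda>p. ennreal ((cmod (m0 ((r ^^ n) (theta n p))))\<^sup>2))"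
    unfolding PD_def by (intro density_cong) (auto simp: theta_0[of _ n])
  then have "distr PD M (theta n) = density (distr P M (theta n)) (\<lambda>x. ennreal ((cmod (m0 ((r ^^ n) x)))\<^sup>2))"
    by (simp add: density_distr)
  then show ?thesis by (simp add: distr_P density_Om)
qed

text \<open>Compared on marginals. Coordinate \<open>n\<close> has law \<open>Om (n + 1)\<close>
  under \<open>PD\<close>, and \<open>rhat\<close> moves coordinate \<open>k\<close> to coordinate
  \<open>k + 1\<close>, which therefore gets the right law; at coordinate \<open>0\<close> the law
  \<open>Om 1\<close> is pushed forward by \<open>r\<close>.\<close>

lemma distr_PD_rhat: "distr PD P (rhat r) = P"
proof (rule path_measure_eqI)
  fix n
  have "distr (distr PD P (rhat r)) M (theta n) = distr PD M (theta n \<circ> rhat r)"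
    by (rule distr_distr) measurable
  also have "\<dots> = Om n"
  proof (cases n)
    case 0
    have "theta 0 \<circ> rhat r = r \<circ> theta 0" by (simp add: fun_eq_iff theta_0_rhat)
    then have "distr PD M (theta 0 \<circ> rhat r) = distr (distr PD M (theta 0)) M r"
      by (simp add: distr_distr)
    then show ?thesis by (simp add: 0 distr_PD_theta distr_Om_Suc)
  next
    case (Suc k)
    have "theta (Suc k) \<circ> rhat r = theta k" by (simp add: fun_eq_iff theta_Suc_rhat)
    then show ?thesis by (simp add: Suc distr_PD_theta)
  qed
  finally show "distr (distr PD P (rhat r)) M (theta n) = Om n" .
qed (simp_all add: sets_P distr_P)

lemma integral_rhat:
  fixes f :: "(nat \<Rightarrow> 'a) \<Rightarrow> complex"
  assumes f: "f \<in> borel_measurable P"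
  shows "(\<integral>p. complex_of_real ((cmod (m0 (theta 0 p)))\<^sup>2) * f (rhat r p) \<partial>P) = (\<integral>p. f p \<partial>P)"
    "integrable P (\<lambda>p. complex_of_real ((cmod (m0 (theta 0 p)))\<^sup>2) * f (rhat r p)) \<longleftrightarrow> integrable P f"
proof -
  have m: "rhat r \<in> measurable PD P" by measurable
  have f': "(\<lambda>p. f (rhat r p)) \<in> borel_measurable P" using f by measurable
  have "(\<integral>p. f p \<partial>distr PD P (rhat r)) = (\<integral>p. f (rhat r p) \<partial>PD)"
    by (rule integral_distr[OF m f])
  also have "\<dots> = (\<integral>p. (cmod (m0 (theta 0 p)))\<^sup>2 *\<^sub>R f (rhat r p) \<partial>P)"
    unfolding PD_def by (rule integral_density[OF f']) auto
  finally show "(\<integral>p. complex_of_real ((cmod (m0 (theta 0 p)))\<^sup>2) * f (rhat r p) \<partial>P) = (\<integral>p. f p \<partial>P)"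
    by (simp only: distr_PD_rhat scaleR_conv_of_real)
  have "integrable (distr PD P (rhat r)) f \<longleftrightarrow> integrable PD (\<lambda>p. f (rhat r p))"
    by (rule integrable_distr_eq[OF m f])
  also have "\<dots> \<longleftrightarrow> integrable P (\<lambda>p. (cmod (m0 (theta 0 p)))\<^sup>2 *\<^sub>R f (rhat r p))"
    unfolding PD_def by (rule integrable_density[OF f']) auto
  finally show "integrable P (\<lambda>p. complex_of_real ((cmod (m0 (theta 0 p)))\<^sup>2) * f (rhat r p)) \<longleftrightarrow> integrable P f"
    by (simp only: distr_PD_rhat scaleR_conv_of_real)
qed

text \<open>\<open>PD\<close> carries no information where its density vanishes, hence the guard. At
  such points the factor \<open>m0\<close> in \<open>U\<close> annihilates the value anyway.\<close>

lemma AE_rhat: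
  assumes "AE p in P. Q p"
  shows "AE p in P. m0 (theta 0 p) \<noteq> 0 \<longrightarrow> Q (rhat r p)"
proof -
  have "AE p in PD. Q (rhat r p)"
    using assms AE_distrD[of "rhat r" PD P Q] unfolding distr_PD_rhat by simp
  then show ?thesis
    unfolding PD_def by (subst (asm) AE_density) (auto elim!: eventually_mono simp: zero_less_power2)
qed

end

section \<open>Projections onto the levels of the path space\<close>

context transfer_setting
begin

lemma borel_measurable_theta: "f \<in> borel_measurable M \<Longrightarrow> (\<lambda>p. f (theta n p)) \<in> borel_measurable P"
  by (rule measurable_compose[OF theta_measurable])

lemma borel_measurable_cmod_sq: "f \<in> borel_measurable N \<Longrightarrow> (\<lambda>x. (cmod (f x))\<^sup>2) \<in> borel_measurable N"
  by measurable

lemma sq_int_theta: "\<xi> \<in> sq_int (Om n) \<Longrightarrow> (\<lambda>p. \<xi> (theta n p)) \<in> sq_int P"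
  using integrable_theta[of "\<lambda>x. (cmod (\<xi> x))\<^sup>2" n]
  by (simp add: sq_int_def borel_measurable_theta borel_measurable_cmod_sq)

lemma sq_norm_theta: "\<xi> \<in> sq_int (Om n) \<Longrightarrow> sq_norm P (\<lambda>p. \<xi> (theta n p)) = sq_norm (Om n) \<xi>"
  using integral_theta[of "\<lambda>x. (cmod (\<xi> x))\<^sup>2" n] by (simp add: sq_int_def borel_measurable_cmod_sq)

lemma inner_theta:
  assumes "\<xi> \<in> sq_int (Om n)" "\<eta> \<in> sq_int (Om n)"
  shows "(\<integral>p. cnj (\<xi> (theta n p)) * \<eta> (theta n p) \<partial>P) = (\<integral>x. cnj (\<xi> x) * \<eta> x \<partial>Om n)"
  using assms by (intro integral_theta borel_measurable_times borel_measurable_cnj) (simp_all add: sq_int_def)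

text \<open>Says weakly that \<open>\<xi> \<circ> theta n\<close> is the orthogonal projection of
  \<open>f\<close> onto \<open>H_n\<close>: inner products against level \<open>n\<close> are the
  same, those of \<open>\<xi>\<close> being computed on \<open>X\<close>.\<close>

definition is_proj :: "nat \<Rightarrow> ((nat \<Rightarrow> 'a) \<Rightarrow> complex) \<Rightarrow> ('a \<Rightarrow> complex) \<Rightarrow> bool" where
  "is_proj n f \<xi> \<longleftrightarrow> \<xi> \<in> sq_int (Om n) \<and>
     (\<forall>k\<in>sq_int (Om n). (\<integral>p. cnj (k (theta n p)) * f p \<partial>P) = (\<integral>x. cnj (k x) * \<xi> x \<partial>Om n))"

lemma is_projD:
  assumes "is_proj n f \<xi>"
  shows "\<xi> \<in> sq_int (Om n)"
    "k \<in> sq_int (Om n) \<Longrightarrow> (\<integral>p. cnj (k (theta n p)) * f p \<partial>P) = (\<integral>x. cnj (k x) * \<xi> x \<partial>Om n)"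
  using assms by (auto simp: is_proj_def)

lemma inner_diff_right:
  assumes "k \<in> sq_int N" "u \<in> sq_int N" "v \<in> sq_int N"
  shows "(\<integral>x. cnj (k x) * (u x - v x) \<partial>N) = (\<integral>x. cnj (k x) * u x \<partial>N) - (\<integral>x. cnj (k x) * v x \<partial>N)"
  unfolding right_diff_distrib
  by (intro Bochner_Integration.integral_diff integrable_cnj_mult assms)

lemma inner_add_right:
  assumes "k \<in> sq_int N" "u \<in> sq_int N" "v \<in> sq_int N"
  shows "(\<integral>x. cnj (k x) * (u x + v x) \<partial>N) = (\<integral>x. cnj (k x) * u x \<partial>N) + (\<integral>x. cnj (k x) * v x \<partial>N)"
  unfolding distrib_left
  by (intro Bochner_Integration.integral_add integrable_cnj_mult assms)

lemma inner_scale_right: "(\<integral>x. cnj (k x) * (c * u x) \<partial>N) = c * (\<integral>x. cnj (k x) * u x \<partial>N)"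
proof -
  have "(\<integral>x. cnj (k x) * (c * u x) \<partial>N) = (\<integral>x. c * (cnj (k x) * u x) \<partial>N)"
    by (simp only: mult.left_commute)
  then show ?thesis by (simp only: integral_mult_right_zero)
qed

lemma is_proj_iff_orthogonal:
  assumes "f \<in> sq_int P" "\<xi> \<in> sq_int (Om n)"
  shows "is_proj n f \<xi> \<longleftrightarrow>
    (\<forall>k\<in>sq_int (Om n). (\<integral>p. cnj (k (theta n p)) * (f p - \<xi> (theta n p)) \<partial>P) = 0)"
proof -
  have "(\<integral>p. cnj (k (theta n p)) * (f p - \<xi> (theta n p)) \<partial>P) =
      (\<integral>p. cnj (k (theta n p)) * f p \<partial>P) - (\<integral>x. cnj (k x) * \<xi> x \<partial>Om n)" if k: "k \<in> sq_int (Om n)" for k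
    by (subst inner_diff_right[OF sq_int_theta[OF k] assms(1) sq_int_theta[OF assms(2)]])
       (simp only: inner_theta[OF k assms(2)])
  then show ?thesis using assms(2) by (simp add: is_proj_def)
qed

text \<open>Composition with \<open>theta n\<close> is isometric from level \<open>n\<close> into
  path space, so its range is complete in the sense required by the projection theorem.\<close>

lemma ex_is_proj:
  assumes f: "f \<in> sq_int P"
  shows "\<exists>\<xi>. is_proj n f \<xi>"
proof -
  let ?S = "{\<lambda>p. \<xi> (theta n p) | \<xi>. \<xi> \<in> sq_int (Om n)}"
  have "\<exists>p\<in>?S. \<forall>k\<in>?S. (\<integral>x. cnj (k x) * (f x - p x) \<partial>P) = 0"
  proof (rule sq_int_projection[OF _ _ _ _ f])
    show "?S \<subseteq> sq_int P" using sq_int_theta by auto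
    show "(\<lambda>_. 0) \<in> ?S" using sq_int_zero by (intro CollectI exI[of _ "\<lambda>_. 0"]) simp
  next
    fix f g c assume "f \<in> ?S" "g \<in> ?S"
    then obtain \<xi> \<eta> where *: "f = (\<lambda>p. \<xi> (theta n p))" "g = (\<lambda>p. \<eta> (theta n p))"
      "\<xi> \<in> sq_int (Om n)" "\<eta> \<in> sq_int (Om n)" by blast
    have "(\<lambda>x. \<xi> x + c * \<eta> x) \<in> sq_int (Om n)" by (intro sq_int_add sq_int_scale *)
    then show "(\<lambda>x. f x + c * g x) \<in> ?S"
      by (intro CollectI exI[of _ "\<lambda>x. \<xi> x + c * \<eta> x"]) (simp add: *)
  next
    fix Y :: "nat \<Rightarrow> (nat \<Rightarrow> 'a) \<Rightarrow> complex"
    assume Y: "\<And>j. Y j \<in> ?S"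
      and C: "\<And>e. e > 0 \<Longrightarrow> \<exists>N::nat. \<forall>m\<ge>N. \<forall>j\<ge>N. sq_norm P (\<lambda>x. Y m x - Y j x) < e"
    have "\<forall>j. \<exists>\<xi>. \<xi> \<in> sq_int (Om n) \<and> Y j = (\<lambda>p. \<xi> (theta n p))" using Y by blast
    then obtain \<xi> where \<xi>: "\<And>j. \<xi> j \<in> sq_int (Om n)" "\<And>j. Y j = (\<lambda>p. \<xi> j (theta n p))" by metis
    have nrm: "sq_norm P (\<lambda>p. Y j p - k (theta n p)) = sq_norm (Om n) (\<lambda>x. \<xi> j x - k x)"
      if "k \<in> sq_int (Om n)" for j k
      using sq_norm_theta[OF sq_int_diff[OF \<xi>(1)[of j] that]] by (simp add: \<xi>(2))
    have "\<exists>L\<in>sq_int (Om n). (\<lambda>j. sq_norm (Om n) (\<lambda>x. \<xi> j x - L x)) \<longlonglongrightarrow> 0"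
    proof (rule sq_int_complete[OF \<xi>(1)])
      fix e :: real assume "e > 0"
      from C[OF this] show "\<exists>N. \<forall>m\<ge>N. \<forall>j\<ge>N. sq_norm (Om n) (\<lambda>x. \<xi> m x - \<xi> j x) < e"
        using nrm[OF \<xi>(1)] by (simp add: \<xi>(2))
    qed
    then obtain L where L: "L \<in> sq_int (Om n)" "(\<lambda>j. sq_norm (Om n) (\<lambda>x. \<xi> j x - L x)) \<longlonglongrightarrow> 0" by blast
    show "\<exists>L\<in>?S. (\<lambda>j. sq_norm P (\<lambda>x. Y j x - L x)) \<longlonglongrightarrow> 0"
      using L nrm[OF L(1)] by (intro bexI[of _ "\<lambda>p. L (theta n p)"]) auto
  qed
  then obtain \<xi> where \<xi>: "\<xi> \<in> sq_int (Om n)"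
    "\<forall>k\<in>?S. (\<integral>p. cnj (k p) * (f p - \<xi> (theta n p)) \<partial>P) = 0" by blast
  then have "is_proj n f \<xi>"
    unfolding is_proj_iff_orthogonal[OF f \<xi>(1)] by (intro ballI) (erule bspec, blast)
  then show ?thesis by blast
qed

lemma is_proj_unique:
  assumes "is_proj n f \<xi>" "is_proj n f \<eta>"
  shows "AE x in Om n. \<xi> x = \<eta> x"
proof -
  have sq: "\<xi> \<in> sq_int (Om n)" "\<eta> \<in> sq_int (Om n)" using assms by (auto dest: is_projD)
  define k where "k x = \<xi> x - \<eta> x" for x
  have k: "k \<in> sq_int (Om n)" unfolding k_def[abs_def] by (intro sq_int_diff sq)
  have "complex_of_real (sq_norm (Om n) k) = (\<integral>x. cnj (k x) * k x \<partial>Om n)"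
    by (rule integral_cnj_self[symmetric])
  also have "\<dots> = (\<integral>x. cnj (k x) * \<xi> x \<partial>Om n) - (\<integral>x. cnj (k x) * \<eta> x \<partial>Om n)"
    using inner_diff_right[OF k sq] by (simp add: k_def)
  also have "\<dots> = 0"
    using is_projD(2)[OF assms(1) k] is_projD(2)[OF assms(2) k] by simp
  finally have "sq_norm (Om n) k = 0" by (simp only: of_real_eq_0_iff)
  from sq_norm_zero_AE[OF k this] show ?thesis by eventually_elim (simp add: k_def)
qed

lemma is_proj_cong:
  assumes "is_proj n f \<xi>" "\<eta> \<in> borel_measurable M" "AE x in Om n. \<eta> x = \<xi> x"
  shows "is_proj n f \<eta>"
proof -
  have sq: "\<xi> \<in> sq_int (Om n)" using assms by (auto dest: is_projD)
  then have "\<eta> \<in> sq_int (Om n)" using assms by (intro sq_int_cong_AE[OF sq]) simp_all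
  moreover have "(\<integral>x. cnj (k x) * \<xi> x \<partial>Om n) = (\<integral>x. cnj (k x) * \<eta> x \<partial>Om n)" if k: "k \<in> sq_int (Om n)" for k
  proof (rule integral_cong_AE)
    show "AE x in Om n. cnj (k x) * \<xi> x = cnj (k x) * \<eta> x" using assms(3) by eventually_elim simp
  qed (use k sq assms(2) in \<open>auto intro!: borel_measurable_times borel_measurable_cnj simp: sq_int_def\<close>)
  ultimately show ?thesis using assms(1) by (simp add: is_proj_def)
qed

lemma is_proj_add:
  assumes "f \<in> sq_int P" "g \<in> sq_int P" "is_proj n f \<xi>" "is_proj n g \<eta>"
  shows "is_proj n (\<lambda>p. f p + g p) (\<lambda>x. \<xi> x + \<eta> x)"
proof -
  have sq: "\<xi> \<in> sq_int (Om n)" "\<eta> \<in> sq_int (Om n)" using assms by (auto dest: is_projD)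
  have "(\<integral>p. cnj (k (theta n p)) * (f p + g p) \<partial>P) = (\<integral>x. cnj (k x) * (\<xi> x + \<eta> x) \<partial>Om n)"
    if k: "k \<in> sq_int (Om n)" for k
    by (simp only: inner_add_right[OF sq_int_theta[OF k] assms(1,2)] inner_add_right[OF k sq]
        is_projD(2)[OF assms(3) k] is_projD(2)[OF assms(4) k])
  then show ?thesis using sq by (simp add: is_proj_def sq_int_add)
qed

lemma is_proj_scale:
  assumes "is_proj n f \<xi>"
  shows "is_proj n (\<lambda>p. c * f p) (\<lambda>x. c * \<xi> x)"
  using assms unfolding is_proj_def by (simp only: inner_scale_right sq_int_scale) auto

lemma sq_norm_diff_proj:
  assumes "f \<in> sq_int P" "is_proj n f \<xi>"
  shows "sq_norm P (\<lambda>p. f p - \<xi> (theta n p)) = sq_norm P f - sq_norm (Om n) \<xi>"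
proof -
  have \<xi>: "\<xi> \<in> sq_int (Om n)" using assms by (auto dest: is_projD)
  have "sq_norm P (\<lambda>p. f p - 1 * \<xi> (theta n p)) = sq_norm P f
      - 2 * Re (cnj 1 * (\<integral>p. cnj (\<xi> (theta n p)) * f p \<partial>P)) + (cmod 1)\<^sup>2 * sq_norm P (\<lambda>p. \<xi> (theta n p))"
    by (rule sq_norm_diff_scale[OF assms(1) sq_int_theta[OF \<xi>]])
  then show ?thesis
    by (simp add: is_projD(2)[OF assms(2) \<xi>] integral_cnj_self sq_norm_theta[OF \<xi>])
qed

section \<open>Neighbouring levels and the relation defining the sequence space\<close>

lemma sq_int_r: "k \<in> sq_int (Om n) \<Longrightarrow> (\<lambda>x. k (r x)) \<in> sq_int (Om (Suc n))"
  using integrable_distr_eq[of r "Om (Suc n)" M "\<lambda>x. (cmod (k x))\<^sup>2"]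
  by (simp add: sq_int_def distr_Om_Suc measurable_compose[OF r_measurable] borel_measurable_cmod_sq)

definition compatible :: "nat \<Rightarrow> ('a \<Rightarrow> complex) \<Rightarrow> ('a \<Rightarrow> complex) \<Rightarrow> bool" where
  "compatible n \<xi>' \<xi> \<longleftrightarrow>
     (AE x in M. T (\<lambda>y. \<xi>' y * complex_of_real (h y)) x = \<xi> x * complex_of_real (h x))"

text \<open>By adjointness the left integral equals that of \<open>cnj k\<close> against
  \<open>T (\<xi>' h)\<close> with weight \<open>W n\<close>, and the right one has
  \<open>\<xi> h\<close> in its place. The pointwise relation thus implies the weak one; conversely
  indicators as test functions recover it.\<close>

lemma compatible_iff:
  assumes \<xi>: "\<xi> \<in> sq_int (Om n)" and \<xi>': "\<xi>' \<in> sq_int (Om (Suc n))"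
  shows "compatible n \<xi>' \<xi> \<longleftrightarrow> (\<forall>k\<in>sq_int (Om n).
    (\<integral>x. cnj (k (r x)) * \<xi>' x \<partial>Om (Suc n)) = (\<integral>x. cnj (k x) * \<xi> x \<partial>Om n))"
proof -
  let ?h = "\<lambda>x. complex_of_real (h x)"
  define T' where "T' = T (\<lambda>y. \<xi>' y * ?h y)"
  have [measurable]: "\<xi> \<in> borel_measurable M" "\<xi>' \<in> borel_measurable M"
    using \<xi> \<xi>' by (auto simp: sq_int_def)
  have [measurable]: "T' \<in> borel_measurable M"
    unfolding T'_def by (rule T_measurable) measurable
  have upper: "integrable M (\<lambda>x. complex_of_real (W n x) * (cnj (k x) * T' x))"
    "(\<integral>x. cnj (k (r x)) * \<xi>' x \<partial>Om (Suc n)) = (\<integral>x. complex_of_real (W n x) * (cnj (k x) * T' x) \<partial>M)"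
    if k: "k \<in> sq_int (Om n)" for k
  proof -
    have [measurable]: "k \<in> borel_measurable M" using k by (auto simp: sq_int_def)
    have m: "(\<lambda>x. cnj (k (r x)) * \<xi>' x) \<in> borel_measurable M" by measurable
    have "integrable (Om (Suc n)) (\<lambda>x. cnj (k (r x)) * \<xi>' x)"
      by (intro integrable_cnj_mult sq_int_r k \<xi>')
    then have i: "integrable M (\<lambda>x. complex_of_real (W (Suc n) x) * (cnj (k (r x)) * (\<xi>' x * ?h x)))"
      unfolding integrable_Om[OF m] by (simp only: mult.assoc)
    from T_balance[where k = "\<lambda>x. cnj (k x)", OF i]
    show "integrable M (\<lambda>x. complex_of_real (W n x) * (cnj (k x) * T' x))"
      "(\<integral>x. cnj (k (r x)) * \<xi>' x \<partial>Om (Suc n)) = (\<integral>x. complex_of_real (W n x) * (cnj (k x) * T' x) \<partial>M)"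
      unfolding integral_Om[OF m] T'_def by (simp_all only: mult.assoc)
  qed
  have lower: "integrable M (\<lambda>x. complex_of_real (W n x) * (cnj (k x) * (\<xi> x * ?h x)))"
    "(\<integral>x. cnj (k x) * \<xi> x \<partial>Om n) = (\<integral>x. complex_of_real (W n x) * (cnj (k x) * (\<xi> x * ?h x)) \<partial>M)"
    if k: "k \<in> sq_int (Om n)" for k
  proof -
    have [measurable]: "k \<in> borel_measurable M" using k by (auto simp: sq_int_def)
    have m: "(\<lambda>x. cnj (k x) * \<xi> x) \<in> borel_measurable M" by measurable
    show "integrable M (\<lambda>x. complex_of_real (W n x) * (cnj (k x) * (\<xi> x * ?h x)))"
      "(\<integral>x. cnj (k x) * \<xi> x \<partial>Om n) = (\<integral>x. complex_of_real (W n x) * (cnj (k x) * (\<xi> x * ?h x)) \<partial>M)"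
      using integrable_cnj_mult[OF k \<xi>] unfolding integrable_Om[OF m] integral_Om[OF m]
      by (simp_all only: mult.assoc)
  qed
  show ?thesis
  proof
    assume c: "compatible n \<xi>' \<xi>"
    show "\<forall>k\<in>sq_int (Om n). (\<integral>x. cnj (k (r x)) * \<xi>' x \<partial>Om (Suc n)) = (\<integral>x. cnj (k x) * \<xi> x \<partial>Om n)"
    proof
      fix k assume k: "k \<in> sq_int (Om n)"
      show "(\<integral>x. cnj (k (r x)) * \<xi>' x \<partial>Om (Suc n)) = (\<integral>x. cnj (k x) * \<xi> x \<partial>Om n)"
        unfolding upper(2)[OF k] lower(2)[OF k]
      proof (rule integral_cong_AE)
        show "AE x in M. complex_of_real (W n x) * (cnj (k x) * T' x) =
            complex_of_real (W n x) * (cnj (k x) * (\<xi> x * ?h x))"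
          using c unfolding compatible_def T'_def by eventually_elim (simp only:)
      qed (use upper(1)[OF k] lower(1)[OF k] in auto)
    qed
  next
    assume eq: "\<forall>k\<in>sq_int (Om n). (\<integral>x. cnj (k (r x)) * \<xi>' x \<partial>Om (Suc n)) = (\<integral>x. cnj (k x) * \<xi> x \<partial>Om n)"
    \<comment> \<open>The integrals of \<open>g\<close> over measurable sets are the differences of
      the two sides for indicators, so \<open>g\<close> vanishes almost everywhere; positivity of
      \<open>W n\<close> then removes the weight.\<close>
    define g where "g x = complex_of_real (W n x) * (T' x - \<xi> x * ?h x)" for x
    have one: "(\<lambda>_. 1) \<in> sq_int (Om n)"
      using Linf_Om by (intro Linf_sq_int finite_measure_Om) (auto simp: Linf_def)
    have "AE x in M. g x = 0"
    proof (rule density_zero)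
      show "integrable M g"
        using Bochner_Integration.integrable_diff[OF upper(1)[OF one] lower(1)[OF one]]
        by (simp add: g_def[abs_def] right_diff_distrib)
      fix A assume A: "A \<in> sets M"
      let ?k = "\<lambda>x. complex_of_real (indicator A x)"
      have k: "?k \<in> sq_int (Om n)"
        using subsetD[OF Linf_Om indicator_Linf[OF A]] by (intro Linf_sq_int finite_measure_Om)
      have "(LINT x:A|M. g x) = (\<integral>x. complex_of_real (W n x) * (cnj (?k x) * T' x)
          - complex_of_real (W n x) * (cnj (?k x) * (\<xi> x * ?h x)) \<partial>M)"
        unfolding set_lebesgue_integral_def g_def
        by (intro Bochner_Integration.integral_cong refl) (simp add: scaleR_conv_of_real algebra_simps)
      also have "\<dots> = (\<integral>x. complex_of_real (W n x) * (cnj (?k x) * T' x) \<partial>M)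
          - (\<integral>x. complex_of_real (W n x) * (cnj (?k x) * (\<xi> x * ?h x)) \<partial>M)"
        by (rule Bochner_Integration.integral_diff[OF upper(1)[OF k] lower(1)[OF k]])
      also have "\<dots> = 0"
        using eq[rule_format, OF k] unfolding upper(2)[OF k] lower(2)[OF k] by simp
      finally show "(LINT x:A|M. g x) = 0" .
    qed
    then show "compatible n \<xi>' \<xi>"
      unfolding compatible_def T'_def[symmetric] using AE_W_pos
    proof eventually_elim
      case (elim x)
      have "W n x \<noteq> 0" using elim(2) by (metis less_irrefl)
      then show ?case using elim(1) by (simp add: g_def)
    qed
  qed
qed

lemma integral_theta_Suc_cong:
  "(\<integral>p. k (r (theta (Suc n) p)) p \<partial>P) = (\<integral>p. k (theta n p) p \<partial>P)"
  by (intro Bochner_Integration.integral_cong refl) (simp add: theta_Suc)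

text \<open>As \<open>r\<close> sends coordinate \<open>n + 1\<close> to coordinate
  \<open>n\<close>, every test function of level \<open>n\<close> is also one of level
  \<open>n + 1\<close>, after composition with \<open>r\<close>.\<close>

lemma is_proj_compatible:
  assumes "is_proj n f \<xi>" "is_proj (Suc n) f \<xi>'"
  shows "compatible n \<xi>' \<xi>"
proof -
  have "(\<integral>x. cnj (k (r x)) * \<xi>' x \<partial>Om (Suc n)) = (\<integral>x. cnj (k x) * \<xi> x \<partial>Om n)"
    if k: "k \<in> sq_int (Om n)" for k
    using is_projD(2)[OF assms(2) sq_int_r[OF k]] is_projD(2)[OF assms(1) k]
      integral_theta_Suc_cong[of "\<lambda>x p. cnj (k x) * f p" n] by simp
  then show ?thesis using assms by (subst compatible_iff) (auto dest: is_projD)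
qed

lemma proj_determines:
  assumes f: "f \<in> sq_int P" and g: "g \<in> sq_int P"
    and eq: "\<And>n A. A \<in> sets M \<Longrightarrow>
      (\<integral>p. cnj (complex_of_real (indicator A (theta n p))) * f p \<partial>P) =
      (\<integral>p. cnj (complex_of_real (indicator A (theta n p))) * g p \<partial>P)"
  shows "AE p in P. f p = g p"
proof -
  have one: "(\<lambda>_. 1) \<in> sq_int P"
    using P.finite_measure_axioms by (intro Linf_sq_int) (auto simp: Linf_def)
  have "AE p in P. f p - g p = 0"
  proof (rule AE_zero_of_cyl_integrals)
    show "integrable P (\<lambda>p. f p - g p)"
      using integrable_cnj_mult[OF one sq_int_diff[OF f g]] by simp
    fix n A assume A: "A \<in> sets M"
    let ?k = "\<lambda>p. complex_of_real (indicator A (theta n p))"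
    have "(\<lambda>x. complex_of_real (indicator A x)) \<in> sq_int (Om n)"
      using subsetD[OF Linf_Om indicator_Linf[OF A]] by (intro Linf_sq_int finite_measure_Om)
    then have k: "?k \<in> sq_int P" by (rule sq_int_theta)
    have "(LINT p:cyl n A|P. f p - g p) = (\<integral>p. cnj (?k p) * (f p - g p) \<partial>P)"
      unfolding set_lebesgue_integral_def
      by (intro Bochner_Integration.integral_cong refl) (auto simp: cyl_def indicator_def)
    also have "\<dots> = 0" unfolding inner_diff_right[OF k f g] eq[OF A] by simp
    finally show "(LINT p:cyl n A|P. f p - g p) = 0" .
  qed
  then show ?thesis by eventually_elim simp
qed

lemma is_proj_determines:
  assumes "f \<in> sq_int P" "g \<in> sq_int P" "\<And>n. is_proj n f (\<xi> n)" "\<And>n. is_proj n g (\<xi> n)"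
  shows "AE p in P. f p = g p"
proof (rule proj_determines[OF assms(1,2)])
  fix n A assume "A \<in> sets M"
  then have k: "(\<lambda>x. complex_of_real (indicator A x)) \<in> sq_int (Om n)"
    using subsetD[OF Linf_Om indicator_Linf] by (intro Linf_sq_int finite_measure_Om)
  from is_projD(2)[OF assms(3) k] is_projD(2)[OF assms(4) k]
  show "(\<integral>p. cnj (complex_of_real (indicator A (theta n p))) * f p \<partial>P) =
      (\<integral>p. cnj (complex_of_real (indicator A (theta n p))) * g p \<partial>P)" by simp
qed

text \<open>A compatible sequence is a martingale on the path space; boundedness makes it converge.\<close>

lemma martingale_limit:
  assumes \<xi>: "\<And>n. \<xi> n \<in> sq_int (Om n)" and comp: "\<And>n. compatible n (\<xi> (Suc n)) (\<xi> n)"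
    and bdd: "bdd_above (range (\<lambda>n. sq_norm (Om n) (\<xi> n)))"
  shows "\<exists>f\<in>sq_int P. (\<forall>n. is_proj n f (\<xi> n)) \<and> (\<lambda>n. sq_norm P (\<lambda>p. \<xi> n (theta n p) - f p)) \<longlonglongrightarrow> 0"
proof -
  define F where "F n p = \<xi> n (theta n p)" for n p
  have F: "F n \<in> sq_int P" for n unfolding F_def[abs_def] by (rule sq_int_theta[OF \<xi>])
  have NF: "sq_norm P (F n) = sq_norm (Om n) (\<xi> n)" for n
    unfolding F_def[abs_def] by (rule sq_norm_theta[OF \<xi>])
  \<comment> \<open>Compatibility lets the projection property descend one level; iterated, every
    later \<open>F (n + j)\<close> has \<open>\<xi> n\<close> as its projection.\<close>
  have step: "is_proj n f (\<xi> n)" if "is_proj (Suc n) f (\<xi> (Suc n))" for n f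
  proof -
    have "(\<integral>p. cnj (k (theta n p)) * f p \<partial>P) = (\<integral>x. cnj (k x) * \<xi> n x \<partial>Om n)" if k: "k \<in> sq_int (Om n)" for k
      using is_projD(2)[OF \<open>is_proj (Suc n) f _\<close> sq_int_r[OF k]] comp[of n] k
        integral_theta_Suc_cong[of "\<lambda>x p. cnj (k x) * f p" n]
      by (simp add: compatible_iff[OF \<xi> \<xi>])
    then show ?thesis using \<xi> by (simp add: is_proj_def)
  qed
  have self: "is_proj n (F n) (\<xi> n)" for n
    using \<xi> by (simp add: is_proj_def F_def inner_theta)
  have proj: "is_proj n (F (n + j)) (\<xi> n)" for n j
  proof (induction j arbitrary: n)
    case 0
    then show ?case using self by simp
  next
    case (Suc j)
    have "is_proj (Suc n) (F (n + Suc j)) (\<xi> (Suc n))" using Suc[of "Suc n"] by simp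
    then show ?case by (rule step)
  qed
  \<comment> \<open>Pythagoras: increments are orthogonal, so squared norms increase and their
    differences are the squared distances. A bounded increasing real sequence being Cauchy, so is
    \<open>F\<close>.\<close>
  have dist: "sq_norm P (\<lambda>p. F m p - F n p) = sq_norm P (F m) - sq_norm P (F n)" if "n \<le> m" for m n
    using sq_norm_diff_proj[OF F, of n m "\<xi> n"] proj[of n "m - n"] that NF[of n] by (simp add: F_def)
  have mono: "sq_norm P (F n) \<le> sq_norm P (F m)" if "n \<le> m" for m n
    using dist[OF that] sq_norm_nonneg[of P "\<lambda>p. F m p - F n p"] by linarith
  obtain B where B: "\<And>n. sq_norm P (F n) \<le> B" using bdd by (auto simp: bdd_above_def NF)
  have "convergent (\<lambda>n. sq_norm P (F n))"
    using B mono by (intro Bseq_mono_convergent) (auto intro!: BseqI'[of _ B] simp: NF)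
  then have Cau: "Cauchy (\<lambda>n. sq_norm P (F n))" by (rule convergent_Cauchy)
  have "\<exists>L\<in>sq_int P. (\<lambda>n. sq_norm P (\<lambda>p. F n p - L p)) \<longlonglongrightarrow> 0"
  proof (rule sq_int_complete[OF F])
    fix e :: real assume "e > 0"
    then obtain N where N: "\<And>m n. m \<ge> N \<Longrightarrow> n \<ge> N \<Longrightarrow> dist (sq_norm P (F m)) (sq_norm P (F n)) < e"
      using Cau unfolding Cauchy_def by meson
    show "\<exists>N. \<forall>m\<ge>N. \<forall>n\<ge>N. sq_norm P (\<lambda>p. F m p - F n p) < e"
    proof (intro exI[of _ N] allI impI)
      fix m n assume "m \<ge> N" "n \<ge> N"
      then have d: "dist (sq_norm P (F m)) (sq_norm P (F n)) < e" by (rule N)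
      show "sq_norm P (\<lambda>p. F m p - F n p) < e"
      proof (cases "n \<le> m")
        case True
        then show ?thesis using d dist[OF True] by (simp add: dist_real_def)
      next
        case False
        then have "sq_norm P (\<lambda>p. F n p - F m p) < e" using d dist[of m n] by (simp add: dist_real_def)
        then show ?thesis by (simp add: norm_minus_commute)
      qed
    qed
  qed
  then obtain f where f: "f \<in> sq_int P" and lim: "(\<lambda>n. sq_norm P (\<lambda>p. F n p - f p)) \<longlonglongrightarrow> 0" by blast
  have "is_proj n f (\<xi> n)" for n
    unfolding is_proj_def
  proof (intro conjI \<xi> ballI)
    fix k assume k: "k \<in> sq_int (Om n)"
    let ?k = "\<lambda>p. k (theta n p)"
    let ?c = "\<integral>x. cnj (k x) * \<xi> n x \<partial>Om n"
    have "(\<lambda>j. sq_norm P (\<lambda>p. F (j + n) p - f p)) \<longlonglongrightarrow> 0"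
      using lim by (rule LIMSEQ_ignore_initial_segment)
    then have "(\<lambda>j. \<integral>p. cnj (?k p) * (F (j + n) p - f p) \<partial>P) \<longlonglongrightarrow> 0"
      by (intro tendsto_integral_cnj_zero sq_int_theta[OF k] sq_int_diff F f)
    moreover have "(\<integral>p. cnj (?k p) * (F (j + n) p - f p) \<partial>P) = ?c - (\<integral>p. cnj (?k p) * f p \<partial>P)" for j
      using is_projD(2)[OF proj[of n j] k]
      by (simp add: inner_diff_right[OF sq_int_theta[OF k] F f] add.commute)
    ultimately have "?c - (\<integral>p. cnj (?k p) * f p \<partial>P) = 0"
      by (simp add: LIMSEQ_const_iff)
    then show "(\<integral>p. cnj (?k p) * f p \<partial>P) = ?c" by simp
  qed
  then show ?thesis using f lim by (auto simp: F_def)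
qed

text \<open>The projections of \<open>f\<close> form a bounded compatible sequence and so converge
  to some \<open>g\<close> with the same projections. Cylinder integrals force \<open>g = f\<close>
  almost everywhere, which is density of the union of the \<open>H_n\<close>.\<close>

lemma proj_tendsto:
  assumes f: "f \<in> sq_int P" and \<xi>: "\<And>n. is_proj n f (\<xi> n)"
  shows "(\<lambda>n. sq_norm P (\<lambda>p. \<xi> n (theta n p) - f p)) \<longlonglongrightarrow> 0"
    "bdd_above (range (\<lambda>n. sq_norm (Om n) (\<xi> n)))"
proof -
  have sq: "\<xi> n \<in> sq_int (Om n)" for n using \<xi> by (auto dest: is_projD)
  have "sq_norm (Om n) (\<xi> n) \<le> sq_norm P f" for n
    using sq_norm_diff_proj[OF f \<xi>[of n]] sq_norm_nonneg[of P "\<lambda>p. f p - \<xi> n (theta n p)"] by linarith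
  then show bdd: "bdd_above (range (\<lambda>n. sq_norm (Om n) (\<xi> n)))" by (intro bdd_aboveI2)
  obtain g where g: "g \<in> sq_int P" "\<And>n. is_proj n g (\<xi> n)"
    and lim: "(\<lambda>n. sq_norm P (\<lambda>p. \<xi> n (theta n p) - g p)) \<longlonglongrightarrow> 0"
    using martingale_limit[OF sq is_proj_compatible[OF \<xi> \<xi>] bdd] by blast
  have fg: "AE p in P. f p = g p" by (rule is_proj_determines[OF f g(1) \<xi> g(2)])
  have "sq_norm P (\<lambda>p. \<xi> n (theta n p) - f p) = sq_norm P (\<lambda>p. \<xi> n (theta n p) - g p)" for n
  proof (rule integral_cong_AE)
    show "AE p in P. (cmod (\<xi> n (theta n p) - f p))\<^sup>2 = (cmod (\<xi> n (theta n p) - g p))\<^sup>2"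
      using fg by eventually_elim simp
  qed (use sq_int_integrable[OF sq_int_diff[OF sq_int_theta[OF sq] f]]
        sq_int_integrable[OF sq_int_diff[OF sq_int_theta[OF sq] g(1)]] in auto)
  then show "(\<lambda>n. sq_norm P (\<lambda>p. \<xi> n (theta n p) - f p)) \<longlonglongrightarrow> 0" using lim by simp
qed

text \<open>Since \<open>\<eta> n\<close> is the projection of \<open>g\<close>, the inner product
  at level \<open>n\<close> equals that of \<open>\<xi> n \<circ> theta n\<close> with
  \<open>g\<close>; only the first factor still varies, and it converges to
  \<open>f\<close>.\<close>

lemma inner_proj_tendsto:
  assumes f: "f \<in> sq_int P" and g: "g \<in> sq_int P"
    and \<xi>: "\<And>n. is_proj n f (\<xi> n)" and \<eta>: "\<And>n. is_proj n g (\<eta> n)"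
  shows "(\<lambda>n. \<integral>x. cnj (\<xi> n x) * \<eta> n x \<partial>Om n) \<longlonglongrightarrow> (\<integral>p. cnj (f p) * g p \<partial>P)"
proof -
  have sq: "\<xi> n \<in> sq_int (Om n)" for n using \<xi> by (auto dest: is_projD)
  have cnj_swap: "(\<integral>p. cnj (u p) * v p \<partial>P) = cnj (\<integral>p. cnj (v p) * u p \<partial>P)" for u v
    by (subst Bochner_Integration.integral_cnj[symmetric]) (simp add: mult.commute)
  have "(\<lambda>n. \<integral>p. cnj (g p) * (\<xi> n (theta n p) - f p) \<partial>P) \<longlonglongrightarrow> 0"
    by (intro tendsto_integral_cnj_zero g sq_int_diff sq_int_theta sq f proj_tendsto(1)[OF f \<xi>])
  then have "(\<lambda>n. (\<integral>p. cnj (g p) * \<xi> n (theta n p) \<partial>P) - (\<integral>p. cnj (g p) * f p \<partial>P)) \<longlonglongrightarrow> 0"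
    by (simp add: inner_diff_right[OF g sq_int_theta[OF sq] f])
  then have "(\<lambda>n. \<integral>p. cnj (g p) * \<xi> n (theta n p) \<partial>P) \<longlonglongrightarrow> (\<integral>p. cnj (g p) * f p \<partial>P)"
    by (simp add: LIM_zero_iff)
  then have "(\<lambda>n. cnj (\<integral>p. cnj (g p) * \<xi> n (theta n p) \<partial>P)) \<longlonglongrightarrow> cnj (\<integral>p. cnj (g p) * f p \<partial>P)"
    by (rule tendsto_cnj)
  then show ?thesis
    unfolding cnj_swap[symmetric] is_projD(2)[OF \<eta> sq] .
qed

end

section \<open>The transform\<close>

context transfer_setting
begin

abbreviation V :: "((nat \<Rightarrow> 'a) \<Rightarrow> complex) set hspace" where
  "V \<equiv> L2 P"

abbreviation S :: "(nat \<Rightarrow> ('a \<Rightarrow> complex) set) hspace" where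
  "S \<equiv> seq_space M r m0 h"

abbreviation Phi' :: "((nat \<Rightarrow> 'a) \<Rightarrow> complex) set \<Rightarrow> nat \<Rightarrow> ('a \<Rightarrow> complex) set" where
  "Phi' \<equiv> Phi M r m0 h"

lemma sq_int_Om_measurable: "\<xi> \<in> sq_int (Om n) \<Longrightarrow> \<xi> \<in> borel_measurable M"
  by (simp add: sq_int_def)

lemma i_map_class:
  assumes "\<xi> \<in> sq_int (Om n)"
  shows "i_map M r m0 h n (ae_class (Om n) \<xi>) = ae_class P (\<lambda>p. \<xi> (theta n p))"
  unfolding i_map_def P_def[symmetric]
  by (intro ae_class_cong AE_theta[where Q = "\<lambda>x. rep (ae_class (Om n) \<xi>) x = \<xi> x"] rep_ae_class(2) sq_int_measurable assms)

lemma H_sub_eq: "H_sub M r m0 h n = {ae_class P (\<lambda>p. \<xi> (theta n p)) | \<xi>. \<xi> \<in> sq_int (Om n)}"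
  unfolding H_sub_def P_def[symmetric] omega_eq carrier_L2
  by (auto simp: i_map_class sq_int_theta)

lemma ae_class_theta_eq_iff:
  assumes "\<xi> \<in> sq_int (Om n)" "\<eta> \<in> sq_int (Om n)"
  shows "ae_class P (\<lambda>p. \<xi> (theta n p)) = ae_class P (\<lambda>p. \<eta> (theta n p)) \<longleftrightarrow>
    ae_class (Om n) \<xi> = ae_class (Om n) \<eta>"
proof -
  have [measurable]: "\<xi> \<in> borel_measurable M" "\<eta> \<in> borel_measurable M"
    using assms by (auto simp: sq_int_def)
  have "{x \<in> space M. \<xi> x = \<eta> x} \<in> sets M" by measurable
  from AE_theta_iff[OF this, of n] show ?thesis
    using assms by (simp add: ae_class_eq_iff sq_int_measurable borel_measurable_theta)
qed

lemma orth_proj_class: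
  assumes f: "f \<in> sq_int P" and \<xi>: "is_proj n f \<xi>"
  shows "orth_proj V (H_sub M r m0 h n) (ae_class P f) = ae_class P (\<lambda>p. \<xi> (theta n p))"
proof -
  have orth: "(\<forall>K\<in>H_sub M r m0 h n. hinner V K (hdiff V (ae_class P f) (ae_class P (\<lambda>p. \<eta> (theta n p)))) = 0)
      \<longleftrightarrow> is_proj n f \<eta>" if \<eta>: "\<eta> \<in> sq_int (Om n)" for \<eta>
  proof -
    have "hinner V (ae_class P (\<lambda>p. k (theta n p))) (hdiff V (ae_class P f) (ae_class P (\<lambda>p. \<eta> (theta n p)))) =
        (\<integral>p. cnj (k (theta n p)) * (f p - \<eta> (theta n p)) \<partial>P)" if k: "k \<in> sq_int (Om n)" for k
      using f sq_int_theta[OF k] sq_int_theta[OF \<eta>]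
      by (simp add: L2_diff L2_inner sq_int_measurable sq_int_diff)
    then show ?thesis
      unfolding is_proj_iff_orthogonal[OF f \<eta>] H_sub_eq by auto
  qed
  have \<xi>s: "\<xi> \<in> sq_int (Om n)" using \<xi> by (rule is_projD)
  show ?thesis
    unfolding orth_proj_def
  proof (rule the_equality)
    show "ae_class P (\<lambda>p. \<xi> (theta n p)) \<in> H_sub M r m0 h n \<and>
      (\<forall>K\<in>H_sub M r m0 h n. hinner V K (hdiff V (ae_class P f) (ae_class P (\<lambda>p. \<xi> (theta n p)))) = 0)"
      using \<xi> \<xi>s orth[OF \<xi>s] by (auto simp: H_sub_eq)
    fix Q assume Q: "Q \<in> H_sub M r m0 h n \<and> (\<forall>K\<in>H_sub M r m0 h n. hinner V K (hdiff V (ae_class P f) Q) = 0)"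
    then obtain \<eta> where \<eta>: "\<eta> \<in> sq_int (Om n)" "Q = ae_class P (\<lambda>p. \<eta> (theta n p))"
      by (auto simp: H_sub_eq)
    then have "is_proj n f \<eta>" using Q orth[OF \<eta>(1)] by simp
    then have "ae_class (Om n) \<eta> = ae_class (Om n) \<xi>"
      using \<xi> by (intro ae_class_cong is_proj_unique)
    then show "Q = ae_class P (\<lambda>p. \<xi> (theta n p))"
      using ae_class_theta_eq_iff[OF \<eta>(1) \<xi>s] \<eta>(2) by simp
  qed
qed

lemma Phi_class:
  assumes f: "f \<in> sq_int P" and \<xi>: "is_proj n f \<xi>"
  shows "Phi' (ae_class P f) n = ae_class (Om n) \<xi>"
proof -
  have \<xi>s: "\<xi> \<in> sq_int (Om n)" using \<xi> by (rule is_projD)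
  have inj: "inj_on (i_map M r m0 h n) (hcarrier (L2 (Om n)))"
    unfolding carrier_L2 inj_on_def using ae_class_theta_eq_iff by (auto simp: i_map_class)
  have "Phi' (ae_class P f) n = inv_into (hcarrier (L2 (Om n))) (i_map M r m0 h n) (ae_class P (\<lambda>p. \<xi> (theta n p)))"
    unfolding Phi_def P_def[symmetric] omega_eq orth_proj_class[OF f \<xi>] ..
  also have "\<dots> = ae_class (Om n) \<xi>"
    unfolding i_map_class[OF \<xi>s, symmetric] by (rule inv_into_f_f[OF inj]) (simp add: carrier_L2 \<xi>s)
  finally show ?thesis .
qed

definition proj :: "((nat \<Rightarrow> 'a) \<Rightarrow> complex) \<Rightarrow> nat \<Rightarrow> 'a \<Rightarrow> complex" where
  "proj f n = (SOME \<xi>. is_proj n f \<xi>)"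

lemma is_proj_proj: "f \<in> sq_int P \<Longrightarrow> is_proj n f (proj f n)"
  unfolding proj_def by (rule someI_ex[OF ex_is_proj])

lemma proj_sq_int: "f \<in> sq_int P \<Longrightarrow> proj f n \<in> sq_int (Om n)"
  using is_proj_proj by (rule is_projD)

lemma Phi_proj: "f \<in> sq_int P \<Longrightarrow> Phi' (ae_class P f) = (\<lambda>n. ae_class (Om n) (proj f n))"
  by (rule ext) (intro Phi_class is_proj_proj)

text \<open>Null sets of \<open>Om (Suc n)\<close> may have positive \<open>M\<close> measure, but
  only where \<open>h = 0\<close>. Multiplication by \<open>h\<close> makes the equality hold modulo
  \<open>M\<close>, and \<open>avg_cong_AE\<close> carries it across fibres.\<close>

lemma T_cong_AE_Om:
  assumes "AE x in Om n. \<xi> x = \<eta> x"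
  shows "AE x in M. T (\<lambda>y. \<xi> y * complex_of_real (h y)) x = T (\<lambda>y. \<eta> y * complex_of_real (h y)) x"
  unfolding transfer_op_def
proof (rule avg_cong_AE)
  show "AE x in M. complex_of_real ((cmod (m0 x))\<^sup>2) * (\<xi> x * complex_of_real (h x)) =
      complex_of_real ((cmod (m0 x))\<^sup>2) * (\<eta> x * complex_of_real (h x))"
    using assms unfolding AE_Om_mult_h by eventually_elim simp
qed

lemma compatible_cong:
  assumes "AE x in Om (Suc n). \<xi>' x = \<eta>' x" "AE x in Om n. \<xi> x = \<eta> x" "compatible n \<xi>' \<xi>"
  shows "compatible n \<eta>' \<eta>"
  using assms(3) T_cong_AE_Om[OF assms(1)] assms(2) unfolding compatible_def AE_Om_mult_h
  by eventually_elim simp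

lemma sq_norm_rep:
  assumes "\<xi> \<in> sq_int N"
  shows "sq_norm N (rep (ae_class N \<xi>)) = sq_norm N \<xi>"
proof (rule integral_cong_AE)
  show "AE x in N. (cmod (rep (ae_class N \<xi>) x))\<^sup>2 = (cmod (\<xi> x))\<^sup>2"
    using rep_ae_class(2)[OF sq_int_measurable[OF assms]] by eventually_elim simp
qed (use sq_int_integrable[OF rep_sq_int[OF assms]] sq_int_integrable[OF assms] in auto)

lemma transfer_integral_sq:
  assumes "\<xi> \<in> sq_int (Om n)"
  shows "transfer_integral M r m0 h n (\<lambda>y. complex_of_real ((cmod (\<xi> y))\<^sup>2)) = complex_of_real (sq_norm (Om n) \<xi>)"
proof -
  have "transfer_integral M r m0 h n (\<lambda>y. complex_of_real ((cmod (\<xi> y))\<^sup>2)) =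
      (\<integral>x. complex_of_real ((cmod (\<xi> x))\<^sup>2) \<partial>Om n)"
  proof (rule transfer_integral_eq)
    show "(\<lambda>y. complex_of_real ((cmod (\<xi> y))\<^sup>2)) \<in> borel_measurable M"
      using sq_int_Om_measurable[OF assms] by measurable
    show "integrable (Om n) (\<lambda>y. complex_of_real ((cmod (\<xi> y))\<^sup>2))"
      using sq_int_integrable[OF assms] by (simp only: complex_of_real_integrable_eq)
  qed
  then show ?thesis by (simp only: integral_complex_of_real)
qed

text \<open>The carrier is defined through the representatives that \<open>rep\<close> happens to
  choose; both the relation and the bound are unaffected by replacing them with the given
  \<open>\<xi> n\<close>.\<close>

lemma seq_carrier_iff:
  assumes \<xi>: "\<And>n. \<xi> n \<in> sq_int (Om n)"
  shows "(\<lambda>n. ae_class (Om n) (\<xi> n)) \<in> hcarrier S \<longleftrightarrow>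
    (\<forall>n. compatible n (\<xi> (Suc n)) (\<xi> n)) \<and> bdd_above (range (\<lambda>n. sq_norm (Om n) (\<xi> n)))"
proof -
  define \<rho> where "\<rho> n = rep (ae_class (Om n) (\<xi> n))" for n
  have \<rho>: "AE x in Om n. \<rho> n x = \<xi> n x" "AE x in Om n. \<xi> n x = \<rho> n x" "\<rho> n \<in> sq_int (Om n)" for n
    using rep_ae_class(2)[OF sq_int_measurable[OF \<xi>], of n] rep_sq_int[OF \<xi>, of n]
    by (auto simp: \<rho>_def eq_commute)
  have "compatible n (\<rho> (Suc n)) (\<rho> n) \<longleftrightarrow> compatible n (\<xi> (Suc n)) (\<xi> n)" for n
    using compatible_cong[OF \<rho>(1) \<rho>(1)] compatible_cong[OF \<rho>(2) \<rho>(2)] by blast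
  moreover have "Re (transfer_integral M r m0 h n (\<lambda>y. complex_of_real ((cmod (\<rho> n y))\<^sup>2))) = sq_norm (Om n) (\<xi> n)" for n
    unfolding transfer_integral_sq[OF \<rho>(3)] Re_complex_of_real using sq_norm_rep[OF \<xi>] by (simp add: \<rho>_def)
  ultimately show ?thesis
    unfolding seq_space_def omega_eq compatible_def \<rho>_def
    by (simp only: hspace.simps mem_Collect_eq carrier_L2 imageI[OF \<xi>] simp_thms)
qed

section \<open>Operations on the sequence space and the isomorphism\<close>

lemma seq_carrier_rep:
  assumes "\<Xi> \<in> hcarrier S"
  shows "rep (\<Xi> n) \<in> sq_int (Om n)" "\<Xi> n = ae_class (Om n) (rep (\<Xi> n))"
proof -
  have "\<Xi> n \<in> hcarrier (L2 (Om n))" using assms by (simp add: seq_space_def omega_eq)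
  then show "rep (\<Xi> n) \<in> sq_int (Om n)" "\<Xi> n = ae_class (Om n) (rep (\<Xi> n))"
    by (rule carrier_L2_rep)+
qed

lemma seq_zero: "hzero S = (\<lambda>n. ae_class (Om n) (\<lambda>_. 0))"
  by (simp add: seq_space_def omega_eq L2_zero)

lemma seq_add:
  assumes "\<And>n. \<xi> n \<in> sq_int (Om n)" "\<And>n. \<eta> n \<in> sq_int (Om n)"
  shows "hadd S (\<lambda>n. ae_class (Om n) (\<xi> n)) (\<lambda>n. ae_class (Om n) (\<eta> n)) =
    (\<lambda>n. ae_class (Om n) (\<lambda>x. \<xi> n x + \<eta> n x))"
  using assms[THEN sq_int_measurable] by (simp add: seq_space_def omega_eq L2_add)

lemma seq_scale:
  assumes "\<And>n. \<xi> n \<in> sq_int (Om n)"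
  shows "hscale S a (\<lambda>n. ae_class (Om n) (\<xi> n)) = (\<lambda>n. ae_class (Om n) (\<lambda>x. a * \<xi> n x))"
  using assms[THEN sq_int_measurable] by (simp add: seq_space_def omega_eq L2_scale)

lemma seq_inner:
  assumes "\<And>n. \<xi> n \<in> sq_int (Om n)" "\<And>n. \<eta> n \<in> sq_int (Om n)"
  shows "hinner S (\<lambda>n. ae_class (Om n) (\<xi> n)) (\<lambda>n. ae_class (Om n) (\<eta> n)) =
    lim (\<lambda>n. \<integral>x. cnj (\<xi> n x) * \<eta> n x \<partial>Om n)"
proof -
  have "transfer_integral M r m0 h n
      (\<lambda>y. cnj (rep (ae_class (Om n) (\<xi> n)) y) * rep (ae_class (Om n) (\<eta> n)) y) =
      (\<integral>x. cnj (\<xi> n x) * \<eta> n x \<partial>Om n)" for n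
  proof -
    have sq: "rep (ae_class (Om n) (\<xi> n)) \<in> sq_int (Om n)" "rep (ae_class (Om n) (\<eta> n)) \<in> sq_int (Om n)"
      using assms by (auto intro: rep_sq_int)
    have "transfer_integral M r m0 h n
        (\<lambda>y. cnj (rep (ae_class (Om n) (\<xi> n)) y) * rep (ae_class (Om n) (\<eta> n)) y) =
        hinner (L2 (Om n)) (ae_class (Om n) (\<xi> n)) (ae_class (Om n) (\<eta> n))"
      by (subst transfer_integral_eq)
         (auto simp: L2_def intro!: integrable_cnj_mult sq borel_measurable_times borel_measurable_cnj sq[THEN sq_int_Om_measurable])
    then show ?thesis using assms by (simp only: L2_inner sq_int_measurable)
  qed
  then show ?thesis by (simp add: seq_space_def)
qed

lemma Phi_add:
  assumes "F \<in> hcarrier V" "G \<in> hcarrier V"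
  shows "Phi' (hadd V F G) = hadd S (Phi' F) (Phi' G)"
proof -
  obtain f g where f: "f \<in> sq_int P" "F = ae_class P f" and g: "g \<in> sq_int P" "G = ae_class P g"
    using assms by (auto simp: carrier_L2)
  have "Phi' (ae_class P (\<lambda>p. f p + g p)) = (\<lambda>n. ae_class (Om n) (\<lambda>x. proj f n x + proj g n x))"
    by (rule ext) (intro Phi_class sq_int_add is_proj_add is_proj_proj f g)
  then show ?thesis
    by (simp add: f g L2_add sq_int_measurable Phi_proj seq_add proj_sq_int)
qed

lemma Phi_scale:
  assumes "F \<in> hcarrier V"
  shows "Phi' (hscale V a F) = hscale S a (Phi' F)"
proof -
  obtain f where f: "f \<in> sq_int P" "F = ae_class P f" using assms by (auto simp: carrier_L2)
  have "Phi' (ae_class P (\<lambda>p. a * f p)) = (\<lambda>n. ae_class (Om n) (\<lambda>x. a * proj f n x))"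
    by (rule ext) (intro Phi_class sq_int_scale is_proj_scale is_proj_proj f)
  then show ?thesis
    by (simp add: f L2_scale sq_int_measurable Phi_proj seq_scale proj_sq_int)
qed

lemma Phi_zero: "Phi' (hzero V) = hzero S"
proof -
  have "is_proj n (\<lambda>_. 0) (\<lambda>_. 0)" for n by (simp add: is_proj_def)
  then show ?thesis unfolding L2_zero seq_zero by (intro ext Phi_class sq_int_zero)
qed

lemma Phi_inner:
  assumes "F \<in> hcarrier V" "G \<in> hcarrier V"
  shows "hinner S (Phi' F) (Phi' G) = hinner V F G"
proof -
  obtain f g where f: "f \<in> sq_int P" "F = ae_class P f" and g: "g \<in> sq_int P" "G = ae_class P g"
    using assms by (auto simp: carrier_L2)
  have "(\<lambda>n. \<integral>x. cnj (proj f n x) * proj g n x \<partial>Om n) \<longlonglongrightarrow> (\<integral>p. cnj (f p) * g p \<partial>P)"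
    by (intro inner_proj_tendsto is_proj_proj f g)
  from limI[OF this] show ?thesis
    by (simp add: f g L2_inner sq_int_measurable Phi_proj seq_inner proj_sq_int)
qed

lemma Phi_bij: "bij_betw Phi' (hcarrier V) (hcarrier S)"
  unfolding bij_betw_def
proof
  show "inj_on Phi' (hcarrier V)"
  proof (rule inj_onI)
    fix F G assume "F \<in> hcarrier V" "G \<in> hcarrier V" and eq: "Phi' F = Phi' G"
    then obtain f g where f: "f \<in> sq_int P" "F = ae_class P f" and g: "g \<in> sq_int P" "G = ae_class P g"
      by (auto simp: carrier_L2)
    have "is_proj n g (proj f n)" for n
    proof (rule is_proj_cong[OF is_proj_proj[OF g(1)]])
      show "proj f n \<in> borel_measurable M" by (rule sq_int_Om_measurable[OF proj_sq_int[OF f(1)]])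
      have "ae_class (Om n) (proj f n) = ae_class (Om n) (proj g n)"
        using fun_cong[OF eq, of n] by (simp add: f g Phi_proj)
      then show "AE x in Om n. proj f n x = proj g n x"
        unfolding ae_class_eq_iff[OF sq_int_measurable[OF proj_sq_int[OF f(1)]]] .
    qed
    then have "AE p in P. f p = g p"
      by (intro is_proj_determines[OF f(1) g(1) is_proj_proj[OF f(1)]])
    then show "F = G" by (simp add: f g ae_class_cong)
  qed
  show "Phi' ` hcarrier V = hcarrier S"
  proof (intro equalityI subsetI)
    fix \<Xi> assume "\<Xi> \<in> Phi' ` hcarrier V"
    then obtain f where f: "f \<in> sq_int P" "\<Xi> = Phi' (ae_class P f)" by (auto simp: carrier_L2)
    have "(\<lambda>n. ae_class (Om n) (proj f n)) \<in> hcarrier S"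
      using is_proj_compatible[OF is_proj_proj[OF f(1)] is_proj_proj[OF f(1)]]
        proj_tendsto(2)[OF f(1) is_proj_proj[OF f(1)]]
      by (subst seq_carrier_iff) (auto intro: proj_sq_int f)
    then show "\<Xi> \<in> hcarrier S" by (simp add: f Phi_proj)
  next
    fix \<Xi> assume \<Xi>: "\<Xi> \<in> hcarrier S"
    define \<xi> where "\<xi> n = rep (\<Xi> n)" for n
    have \<xi>: "\<And>n. \<xi> n \<in> sq_int (Om n)" and \<Xi>_eq: "\<Xi> = (\<lambda>n. ae_class (Om n) (\<xi> n))"
      using seq_carrier_rep[OF \<Xi>] by (auto simp: \<xi>_def)
    then have "\<And>n. compatible n (\<xi> (Suc n)) (\<xi> n)" "bdd_above (range (\<lambda>n. sq_norm (Om n) (\<xi> n)))"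
      using \<Xi> seq_carrier_iff[OF \<xi>] by simp_all
    from martingale_limit[OF \<xi> this] obtain f where f: "f \<in> sq_int P" "\<And>n. is_proj n f (\<xi> n)"
      by blast
    then have "\<Xi> = Phi' (ae_class P f)" unfolding \<Xi>_eq by (intro ext Phi_class[symmetric])
    then show "\<Xi> \<in> Phi' ` hcarrier V" using f by (auto simp: carrier_L2)
  qed
qed

lemma Phi_isomorphism: "hilbert_isomorphism V S Phi'"
proof -
  have "complex_hilbert_space S"
    by (rule complex_hilbert_space_transport[OF complex_hilbert_space_L2 Phi_bij Phi_zero])
       (auto intro: Phi_add Phi_scale Phi_inner)
  then show ?thesis
    unfolding hilbert_isomorphism_def
    by (auto intro: complex_hilbert_space_L2 Phi_bij Phi_add Phi_scale Phi_inner)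
qed

section \<open>The action on projections of the operator \<open>U\<close> and of multiplication by
  bounded functions\<close>

lemma integral_Om_Suc:
  fixes f :: "'a \<Rightarrow> complex"
  assumes f: "f \<in> borel_measurable M"
  shows "(\<integral>x. f x \<partial>Om (Suc n)) = (\<integral>x. complex_of_real ((cmod (m0 ((r ^^ n) x)))\<^sup>2) * f x \<partial>Om n)"
    "integrable (Om (Suc n)) f \<longleftrightarrow> integrable (Om n) (\<lambda>x. complex_of_real ((cmod (m0 ((r ^^ n) x)))\<^sup>2) * f x)"
proof -
  have f': "f \<in> borel_measurable (Om n)" using f by simp
  have m: "(\<lambda>x. (cmod (m0 ((r ^^ n) x)))\<^sup>2) \<in> borel_measurable (Om n)" by simp
  show "(\<integral>x. f x \<partial>Om (Suc n)) = (\<integral>x. complex_of_real ((cmod (m0 ((r ^^ n) x)))\<^sup>2) * f x \<partial>Om n)"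
    unfolding density_Om[symmetric]
    by (subst integral_density[OF f' m]) (simp_all add: scaleR_conv_of_real)
  show "integrable (Om (Suc n)) f \<longleftrightarrow> integrable (Om n) (\<lambda>x. complex_of_real ((cmod (m0 ((r ^^ n) x)))\<^sup>2) * f x)"
    unfolding density_Om[symmetric]
    by (subst integrable_density[OF f' m]) (simp_all add: scaleR_conv_of_real)
qed

text \<open>Multiplication by \<open>m0 \<circ> r^n\<close> is isometric from level
  \<open>n + 1\<close> to level \<open>n\<close>, the squared modulus being the density between the
  two measures.\<close>

lemma sq_int_Om_Suc:
  assumes "f \<in> borel_measurable M"
  shows "f \<in> sq_int (Om (Suc n)) \<longleftrightarrow> (\<lambda>x. m0 ((r ^^ n) x) * f x) \<in> sq_int (Om n)"
proof -
  have m: "(\<lambda>x. complex_of_real ((cmod (f x))\<^sup>2)) \<in> borel_measurable M" using assms by measurable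
  have m': "(\<lambda>x. m0 ((r ^^ n) x) * f x) \<in> borel_measurable M" using assms by measurable
  have "integrable (Om (Suc n)) (\<lambda>x. (cmod (f x))\<^sup>2) \<longleftrightarrow>
      integrable (Om n) (\<lambda>x. (cmod (m0 ((r ^^ n) x) * f x))\<^sup>2)"
    using integral_Om_Suc(2)[OF m, of n]
    by (simp only: complex_of_real_integrable_eq of_real_mult[symmetric] norm_mult power_mult_distrib)
  then show ?thesis using assms m' by (simp add: sq_int_def)
qed

text \<open>Holds also for \<open>m = 0\<close>, where both sides vanish; this spares the later
  integrals an exceptional set.\<close>

lemma cnj_divide_mult: "complex_of_real ((cmod m)\<^sup>2) * (cnj (k / m) * u) = cnj k * (m * u)"
  by (cases "m = 0") (simp_all add: complex_norm_square field_simps del: of_real_power)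

lemma sq_int_divide:
  assumes "k \<in> sq_int (Om n)"
  shows "(\<lambda>x. k x / m0 ((r ^^ n) x)) \<in> sq_int (Om (Suc n))"
proof -
  have [measurable]: "k \<in> borel_measurable M" using assms by (rule sq_int_Om_measurable)
  have "(\<lambda>x. m0 ((r ^^ n) x) * (k x / m0 ((r ^^ n) x))) \<in> sq_int (Om n)"
  proof (rule sq_int_dominated[OF _ sq_int_integrable[OF assms]])
    show "AE x in Om n. (cmod (m0 ((r ^^ n) x) * (k x / m0 ((r ^^ n) x))))\<^sup>2 \<le> (cmod (k x))\<^sup>2" by simp
  qed simp
  then show ?thesis by (subst sq_int_Om_Suc) simp_all
qed

definition Uf :: "((nat \<Rightarrow> 'a) \<Rightarrow> complex) \<Rightarrow> (nat \<Rightarrow> 'a) \<Rightarrow> complex" where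
  "Uf f p = m0 (theta 0 p) * f (rhat r p)"

lemma Uf_sq_int:
  assumes "f \<in> sq_int P"
  shows "Uf f \<in> sq_int P"
proof -
  have [measurable]: "f \<in> borel_measurable P" using assms by auto
  have m: "(\<lambda>p. complex_of_real ((cmod (f p))\<^sup>2)) \<in> borel_measurable P" by measurable
  have "integrable P (\<lambda>p. (cmod (m0 (theta 0 p) * f (rhat r p)))\<^sup>2)"
    using integral_rhat(2)[OF m] sq_int_integrable[OF assms]
    by (simp only: complex_of_real_integrable_eq of_real_mult[symmetric] norm_mult power_mult_distrib)
  moreover have "(\<lambda>p. m0 (theta 0 p) * f (rhat r p)) \<in> borel_measurable P" by measurable
  ultimately show ?thesis unfolding Uf_def[abs_def] by (simp add: sq_int_def)
qed

text \<open>Dividing the test function by \<open>m0 \<circ> r^n\<close> lifts it to level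
  \<open>n + 1\<close>. The pairing with \<open>U f\<close> then carries the factor
  \<open>|m0 \<circ> theta 0|^2\<close> and depends on \<open>rhat\<close>, so the change of
  variables reduces it to a pairing with \<open>f\<close>.\<close>

lemma is_proj_Uf:
  assumes f: "f \<in> sq_int P" and \<xi>: "is_proj (Suc n) f \<xi>"
  shows "is_proj n (Uf f) (\<lambda>x. m0 ((r ^^ n) x) * \<xi> x)"
proof -
  have \<xi>s: "\<xi> \<in> sq_int (Om (Suc n))" using \<xi> by (rule is_projD)
  then have \<xi>m: "\<xi> \<in> borel_measurable M" by (rule sq_int_Om_measurable)
  have "(\<integral>p. cnj (k (theta n p)) * Uf f p \<partial>P) = (\<integral>x. cnj (k x) * (m0 ((r ^^ n) x) * \<xi> x) \<partial>Om n)"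
    if k: "k \<in> sq_int (Om n)" for k
  proof -
    define k' where "k' x = k x / m0 ((r ^^ n) x)" for x
    have k': "k' \<in> sq_int (Om (Suc n))" unfolding k'_def[abs_def] by (rule sq_int_divide[OF k])
    have m: "(\<lambda>p. cnj (k' (theta (Suc n) p)) * f p) \<in> borel_measurable P"
      using f sq_int_theta[OF k'] by (intro borel_measurable_times borel_measurable_cnj) auto
    have m2: "(\<lambda>x. cnj (k' x) * \<xi> x) \<in> borel_measurable M"
      using \<xi>m sq_int_Om_measurable[OF k'] by (intro borel_measurable_times borel_measurable_cnj)
    have "(\<integral>p. cnj (k (theta n p)) * Uf f p \<partial>P) =
        (\<integral>p. complex_of_real ((cmod (m0 (theta 0 p)))\<^sup>2) * (cnj (k' (theta (Suc n) (rhat r p))) * f (rhat r p)) \<partial>P)"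
      by (intro Bochner_Integration.integral_cong refl)
         (simp only: space_P theta_Suc_rhat k'_def Uf_def theta_0[of _ n] cnj_divide_mult)
    also have "\<dots> = (\<integral>p. cnj (k' (theta (Suc n) p)) * f p \<partial>P)" by (rule integral_rhat(1)[OF m])
    also have "\<dots> = (\<integral>x. cnj (k' x) * \<xi> x \<partial>Om (Suc n))" by (rule is_projD(2)[OF \<xi> k'])
    also have "\<dots> = (\<integral>x. cnj (k x) * (m0 ((r ^^ n) x) * \<xi> x) \<partial>Om n)"
      unfolding integral_Om_Suc(1)[OF m2] by (simp only: k'_def cnj_divide_mult)
    finally show ?thesis .
  qed
  then show ?thesis using \<xi>s sq_int_Om_Suc[OF \<xi>m] by (simp add: is_proj_def)
qed

lemma Linf_theta:
  assumes "g \<in> Linf M"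
  shows "(\<lambda>p. g (theta n p)) \<in> Linf P"
proof -
  obtain C where C: "AE x in Om n. cmod (g x) \<le> C" and g: "g \<in> borel_measurable M"
    using subsetD[OF Linf_Om assms, of n] by (auto simp: Linf_def)
  from AE_theta[OF C] borel_measurable_theta[OF g] show ?thesis by (auto simp: Linf_def)
qed

text \<open>On paths \<open>g \<circ> theta 0\<close> is a function of coordinate \<open>n\<close>,
  so its conjugate can be absorbed into the test function.\<close>

lemma is_proj_mult:
  assumes f: "f \<in> sq_int P" and g: "g \<in> Linf M" and \<xi>: "is_proj n f \<xi>"
  shows "is_proj n (\<lambda>p. g (theta 0 p) * f p) (\<lambda>x. g ((r ^^ n) x) * \<xi> x)"
proof -
  have gn: "(\<lambda>x. g ((r ^^ n) x)) \<in> Linf (Om n)" using Linf_r_pow[OF g] Linf_Om by blast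
  have \<xi>s: "\<xi> \<in> sq_int (Om n)" using \<xi> by (rule is_projD)
  have "(\<integral>p. cnj (k (theta n p)) * (g (theta 0 p) * f p) \<partial>P) = (\<integral>x. cnj (k x) * (g ((r ^^ n) x) * \<xi> x) \<partial>Om n)"
    if k: "k \<in> sq_int (Om n)" for k
  proof -
    have "(\<lambda>x. cnj (g ((r ^^ n) x))) \<in> Linf (Om n)"
      using gn by (auto simp: Linf_def intro: borel_measurable_cnj)
    then have k': "(\<lambda>x. cnj (g ((r ^^ n) x)) * k x) \<in> sq_int (Om n)" by (rule sq_int_bounded_mult[OF k])
    have "(\<integral>p. cnj (k (theta n p)) * (g (theta 0 p) * f p) \<partial>P) =
        (\<integral>p. cnj (cnj (g ((r ^^ n) (theta n p))) * k (theta n p)) * f p \<partial>P)"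
      by (intro Bochner_Integration.integral_cong refl) (simp add: theta_0[of _ n] mult_ac)
    also have "\<dots> = (\<integral>x. cnj (cnj (g ((r ^^ n) x)) * k x) * \<xi> x \<partial>Om n)" by (rule is_projD(2)[OF \<xi> k'])
    also have "\<dots> = (\<integral>x. cnj (k x) * (g ((r ^^ n) x) * \<xi> x) \<partial>Om n)" by (simp add: mult_ac)
    finally show ?thesis .
  qed
  then show ?thesis using sq_int_bounded_mult[OF \<xi>s gn] by (simp add: is_proj_def)
qed

lemma one_sq_int: "(\<lambda>_. 1) \<in> sq_int P"
  using P.finite_measure_axioms by (intro Linf_sq_int) (auto simp: Linf_def)

lemma one_sq_int_Om: "(\<lambda>_. 1) \<in> sq_int (Om n)"
  using finite_measure_Om by (intro Linf_sq_int) (auto simp: Linf_def)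

lemma is_proj_one: "is_proj n (\<lambda>_. 1) (\<lambda>_. 1)"
  using inner_theta[OF _ one_sq_int_Om, of _ n] by (auto simp: is_proj_def one_sq_int_Om)

lemma phi_vec_eq: "phi_vec M r m0 h = ae_class P (\<lambda>_. 1)"
  by (simp add: phi_vec_def P_def)

lemma U_op_rep: "U_op M r m0 h F = ae_class P (Uf (rep F))"
  by (simp add: U_op_def P_def Uf_def[abs_def])

lemma pi_op_rep: "pi_op M r m0 h g F = ae_class P (\<lambda>p. g (theta 0 p) * rep F p)"
  by (simp add: pi_op_def P_def)

text \<open>Bridge between classes and functions: it applies the function level formulas to the
  representatives occurring in the definitions of the operators.\<close>

lemma is_proj_rep_Phi:
  assumes "F \<in> hcarrier V"
  shows "is_proj n (rep F) (rep (Phi' F n))"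
proof -
  note F = carrier_L2_rep[OF assms]
  have "Phi' F n = ae_class (Om n) (proj (rep F) n)" using Phi_proj[OF F(1)] F(2) by metis
  moreover have "proj (rep F) n \<in> borel_measurable (Om n)" by (rule sq_int_measurable[OF proj_sq_int[OF F(1)]])
  ultimately show ?thesis
    using is_proj_cong[OF is_proj_proj[OF F(1)]] rep_ae_class[of "proj (rep F) n" "Om n"] by simp
qed

lemma Phi_U: "F \<in> hcarrier V \<Longrightarrow> Phi' (U_op M r m0 h F) n =
    ae_class (Om n) (\<lambda>x. m0 ((r ^^ n) x) * rep (Phi' F (Suc n)) x)"
  unfolding U_op_rep by (intro Phi_class Uf_sq_int is_proj_Uf carrier_L2_rep is_proj_rep_Phi)

lemma Phi_pi: "F \<in> hcarrier V \<Longrightarrow> g \<in> Linf M \<Longrightarrow> Phi' (pi_op M r m0 h g F) n =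
    ae_class (Om n) (\<lambda>x. g ((r ^^ n) x) * rep (Phi' F n) x)"
  unfolding pi_op_rep
  by (intro Phi_class sq_int_bounded_mult Linf_theta is_proj_mult carrier_L2_rep is_proj_rep_Phi)

lemma Phi_phi: "Phi' (phi_vec M r m0 h) n = ae_class (Om n) (\<lambda>_. 1)"
  unfolding phi_vec_eq by (intro Phi_class one_sq_int is_proj_one)

section \<open>The three conditions and uniqueness of the transform\<close>

lemma transform_conditions_iff:
  assumes "bij_betw \<Psi> (hcarrier V) (hcarrier S)"
  shows "transform_conditions M r m0 h \<Psi> \<longleftrightarrow>
    (\<forall>F\<in>hcarrier V. \<Psi> (U_op M r m0 h F) =
      (\<lambda>n. ae_class (Om n) (\<lambda>x. m0 ((r ^^ n) x) * rep (\<Psi> F (Suc n)) x))) \<and>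
    (\<forall>g\<in>Linf M. \<forall>F\<in>hcarrier V. \<Psi> (pi_op M r m0 h g F) =
      (\<lambda>n. ae_class (Om n) (\<lambda>x. g ((r ^^ n) x) * rep (\<Psi> F n) x))) \<and>
    \<Psi> (phi_vec M r m0 h) = (\<lambda>n. ae_class (Om n) (\<lambda>_. 1))"
proof -
  have img: "hcarrier S = \<Psi> ` hcarrier V" and inj: "inj_on \<Psi> (hcarrier V)"
    using assms by (auto simp: bij_betw_def)
  show ?thesis
    unfolding transform_conditions_def P_def[symmetric] omega_eq img
    by (simp add: inv_into_f_f[OF inj])
qed

lemma Phi_transform_conditions: "transform_conditions M r m0 h Phi'"
  unfolding transform_conditions_iff[OF Phi_bij] by (auto simp: fun_eq_iff Phi_U Phi_pi Phi_phi)

text \<open>The relation \<open>R (\<xi>_1 h) = \<xi>_0 h\<close> determines the initial entry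
  modulo \<open>Om 0\<close>. This matters because the formula for \<open>U\<close> involves only
  the entries with index at least one.\<close>

lemma seq_eqI:
  assumes \<Xi>: "\<Xi> \<in> hcarrier S" and \<Xi>': "\<Xi>' \<in> hcarrier S"
    and eq: "\<And>n. \<Xi> (Suc n) = \<Xi>' (Suc n)"
  shows "\<Xi> = \<Xi>'"
proof -
  have comp: "compatible 0 (rep (\<Theta> (Suc 0))) (rep (\<Theta> 0))" if "\<Theta> \<in> hcarrier S" for \<Theta>
    using that by (simp add: seq_space_def compatible_def)
  have "AE x in Om 0. rep (\<Xi> 0) x = rep (\<Xi>' 0) x"
    using comp[OF \<Xi>] comp[OF \<Xi>'] unfolding compatible_def AE_Om_mult_h eq
    by eventually_elim (simp only:)
  then have "ae_class (Om 0) (rep (\<Xi> 0)) = ae_class (Om 0) (rep (\<Xi>' 0))" by (rule ae_class_cong)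
  then have "\<Xi> 0 = \<Xi>' 0" using seq_carrier_rep(2)[OF \<Xi>] seq_carrier_rep(2)[OF \<Xi>'] by metis
  show ?thesis
  proof
    show "\<Xi> n = \<Xi>' n" for n using eq \<open>\<Xi> 0 = \<Xi>' 0\<close> by (cases n) auto
  qed
qed

text \<open>\<open>m0 \<circ> r^n\<close> is nonzero almost everywhere and can be cancelled; the
  resulting equality at level \<open>n\<close> is also one at level \<open>n + 1\<close>, as these
  have the same null sets.\<close>

lemma seq_eq_of_mult_m0:
  assumes \<Xi>: "\<Xi> \<in> hcarrier S" and \<Xi>': "\<Xi>' \<in> hcarrier S"
    and eq: "\<And>n. ae_class (Om n) (\<lambda>x. m0 ((r ^^ n) x) * rep (\<Xi> (Suc n)) x) =
      ae_class (Om n) (\<lambda>x. m0 ((r ^^ n) x) * rep (\<Xi>' (Suc n)) x)"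
  shows "\<Xi> = \<Xi>'"
proof (rule seq_eqI[OF \<Xi> \<Xi>'])
  fix n
  have [measurable]: "rep (\<Xi> (Suc n)) \<in> borel_measurable M"
    by (rule sq_int_Om_measurable[OF seq_carrier_rep(1)[OF \<Xi>]])
  have m: "(\<lambda>x. m0 ((r ^^ n) x) * rep (\<Xi> (Suc n)) x) \<in> borel_measurable (Om n)" by simp
  have "AE x in M. h x \<noteq> 0 \<longrightarrow> m0 ((r ^^ n) x) * rep (\<Xi> (Suc n)) x = m0 ((r ^^ n) x) * rep (\<Xi>' (Suc n)) x"
    using eq[of n] unfolding ae_class_eq_iff[OF m] AE_Om .
  then have "AE x in Om (Suc n). rep (\<Xi> (Suc n)) x = rep (\<Xi>' (Suc n)) x"
    unfolding AE_Om using AE_r_pow[OF AE_m0_nonzero, of n] by eventually_elim simp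
  then show "\<Xi> (Suc n) = \<Xi>' (Suc n)"
    using seq_carrier_rep(2)[OF \<Xi>, of "Suc n"] seq_carrier_rep(2)[OF \<Xi>', of "Suc n"] ae_class_cong by metis
qed

text \<open>\<open>rhat\<close> turns coordinate \<open>n + 1\<close> into coordinate
  \<open>n\<close>, and \<open>m0 \<circ> theta 0\<close> is also a function of coordinate
  \<open>n\<close>. So \<open>U\<close> lowers the level by one and keeps the function
  bounded.\<close>

lemma U_op_class_theta:
  assumes b: "b \<in> Linf M"
  shows "U_op M r m0 h (ae_class P (\<lambda>p. b (theta (Suc n) p))) =
    ae_class P (\<lambda>p. m0 ((r ^^ n) (theta n p)) * b (theta n p))"
  unfolding U_op_rep
proof (rule ae_class_cong)
  let ?f = "\<lambda>p. b (theta (Suc n) p)"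
  have "?f \<in> borel_measurable P" using b by (intro borel_measurable_theta) (simp add: Linf_def)
  from AE_rhat[OF rep_ae_class(2)[OF this]]
  have "AE p in P. m0 (theta 0 p) \<noteq> 0 \<longrightarrow> rep (ae_class P ?f) (rhat r p) = b (theta n p)"
    by (simp only: theta_Suc_rhat)
  then show "AE p in P. Uf (rep (ae_class P ?f)) p = m0 ((r ^^ n) (theta n p)) * b (theta n p)"
    by (rule AE_mp) (auto intro!: AE_I2 simp: Uf_def theta_0[of _ n])
qed

text \<open>Induction on the level, for all bounded \<open>b\<close> at once since \<open>U\<close>
  replaces \<open>b\<close> by its product with \<open>m0 \<circ> r^n\<close>. Agreement on
  \<open>U G\<close> yields agreement on \<open>G\<close> by cancelling \<open>m0\<close> in the
  resulting sequences.\<close>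

lemma transform_unique_on_cylinders:
  assumes bij: "bij_betw \<Psi> (hcarrier V) (hcarrier S)" and cond: "transform_conditions M r m0 h \<Psi>"
    and b: "b \<in> Linf M"
  shows "\<Psi> (ae_class P (\<lambda>p. b (theta n p))) = Phi' (ae_class P (\<lambda>p. b (theta n p)))"
  using b
proof (induction n arbitrary: b)
  case 0
  have one: "ae_class P (\<lambda>_. 1) \<in> hcarrier V" using one_sq_int by (simp add: carrier_L2)
  have "ae_class P (\<lambda>p. b (theta 0 p)) = pi_op M r m0 h b (phi_vec M r m0 h)"
    unfolding pi_op_rep phi_vec_eq
  proof (rule ae_class_cong)
    show "AE p in P. b (theta 0 p) = b (theta 0 p) * rep (ae_class P (\<lambda>_. 1)) p"
      using rep_ae_class(2)[OF sq_int_measurable[OF one_sq_int]] by eventually_elim simp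
  qed
  then show ?case
    using cond Phi_transform_conditions 0 one
    unfolding transform_conditions_iff[OF bij] transform_conditions_iff[OF Phi_bij] phi_vec_eq
    by simp
next
  case (Suc n)
  let ?G = "ae_class P (\<lambda>p. b (theta (Suc n) p))"
  have G: "?G \<in> hcarrier V"
    using Linf_sq_int[OF finite_measure_P Linf_theta[OF Suc.prems]] by (simp add: carrier_L2)
  have b': "(\<lambda>x. m0 ((r ^^ n) x) * b x) \<in> Linf M"
  proof -
    obtain C C' where C: "AE x in M. cmod (m0 ((r ^^ n) x)) \<le> C" "AE x in M. cmod (b x) \<le> C'"
      using Linf_r_pow[OF m0_bounded, of n] Suc.prems by (auto simp: Linf_def)
    have "AE x in M. cmod (m0 ((r ^^ n) x) * b x) \<le> C * C'"
      using C
    proof eventually_elim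
      case (elim x)
      then have "0 \<le> C" using norm_ge_zero order_trans by blast
      with elim show ?case unfolding norm_mult by (intro mult_mono) auto
    qed
    then show ?thesis using Suc.prems by (auto simp: Linf_def)
  qed
  have "\<Psi> (U_op M r m0 h ?G) = Phi' (U_op M r m0 h ?G)"
    unfolding U_op_class_theta[OF Suc.prems] by (rule Suc.IH[OF b'])
  then have "(\<lambda>n. ae_class (Om n) (\<lambda>x. m0 ((r ^^ n) x) * rep (\<Psi> ?G (Suc n)) x)) =
      (\<lambda>n. ae_class (Om n) (\<lambda>x. m0 ((r ^^ n) x) * rep (Phi' ?G (Suc n)) x))"
    using cond Phi_transform_conditions G
    unfolding transform_conditions_iff[OF bij] transform_conditions_iff[OF Phi_bij] by simp
  then show ?case
    using bij_betwE[OF bij] bij_betwE[OF Phi_bij] G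
    by (intro seq_eq_of_mult_m0) (auto dest: fun_cong)
qed

text \<open>In place of a continuity argument, surjectivity of \<open>Phi\<close> provides
  \<open>F'\<close> with \<open>Phi F' = \<Psi> F\<close>. Both maps preserve inner products and
  agree on cylinder indicators, so \<open>F\<close> and \<open>F'\<close> have equal inner products
  with all of these and coincide.\<close>

lemma transform_unique:
  assumes iso: "hilbert_isomorphism V S \<Psi>" and cond: "transform_conditions M r m0 h \<Psi>"
    and F: "F \<in> hcarrier V"
  shows "\<Psi> F = Phi' F"
proof -
  have bij: "bij_betw \<Psi> (hcarrier V) (hcarrier S)"
    and inner: "\<And>F G. F \<in> hcarrier V \<Longrightarrow> G \<in> hcarrier V \<Longrightarrow> hinner S (\<Psi> F) (\<Psi> G) = hinner V F G"
    using iso by (auto simp: hilbert_isomorphism_def)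
  have "\<Psi> F \<in> Phi' ` hcarrier V" using bij_betwE[OF bij] F Phi_bij by (auto simp: bij_betw_def)
  then obtain F' where F': "F' \<in> hcarrier V" "Phi' F' = \<Psi> F" by auto
  note f = carrier_L2_rep[OF F] and f' = carrier_L2_rep[OF F'(1)]
  have "AE p in P. rep F' p = rep F p"
  proof (rule proj_determines[OF f'(1) f(1)])
    fix n A assume "A \<in> sets M"
    then have A: "(\<lambda>x. complex_of_real (indicator A x)) \<in> Linf M" by (rule indicator_Linf)
    let ?g = "\<lambda>p. complex_of_real (indicator A (theta n p))"
    have g: "?g \<in> sq_int P" by (rule Linf_sq_int[OF finite_measure_P Linf_theta[OF A]])
    then have G: "ae_class P ?g \<in> hcarrier V" by (simp add: carrier_L2)
    have eq: "\<Psi> (ae_class P ?g) = Phi' (ae_class P ?g)"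
      by (rule transform_unique_on_cylinders[OF bij cond A])
    have inn: "hinner V (ae_class P ?g) F'' = (\<integral>p. cnj (?g p) * rep F'' p \<partial>P)" if "F'' \<in> hcarrier V" for F''
    proof -
      note f'' = carrier_L2_rep[OF that]
      have "hinner V (ae_class P ?g) (ae_class P (rep F'')) = (\<integral>p. cnj (?g p) * rep F'' p \<partial>P)"
        by (intro L2_inner sq_int_measurable g f'')
      then show ?thesis using f''(2) by simp
    qed
    have "hinner V (ae_class P ?g) F' = hinner S (Phi' (ae_class P ?g)) (Phi' F')"
      by (rule Phi_inner[OF G F'(1), symmetric])
    also have "\<dots> = hinner V (ae_class P ?g) F"
      unfolding F'(2) eq[symmetric] by (rule inner[OF G F])
    finally show "(\<integral>p. cnj (?g p) * rep F' p \<partial>P) = (\<integral>p. cnj (?g p) * rep F p \<partial>P)"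
      by (simp only: inn[OF F] inn[OF F'(1)])
  qed
  then have "F' = F" using ae_class_cong f(2) f'(2) by metis
  then show ?thesis using F' by simp
qed

end

theorem theorem4p3p6:
  fixes M :: "'a measure" and r :: "'a \<Rightarrow> 'a" and m0 :: "'a \<Rightarrow> complex" and h :: "'a \<Rightarrow> real"
  assumes prob: "prob_space M"
    and r_measurable: "r \<in> measurable M M"
    and r_finite_to_one: "\<forall>x\<in>space M. finite {y \<in> space M. r y = x}"
    and r_onto: "r ` space M = space M"
    and invariant: "strongly_invariant M r"
    and m0_bounded: "m0 \<in> Linf M"
    and m0_nonvanishing: "\<forall>A\<in>sets M. emeasure M A > 0 \<longrightarrow> (\<exists>x\<in>A. m0 x \<noteq> 0)"
    and h_integrable: "integrable M h"
    and h_nonneg: "AE x in M. 0 \<le> h x"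
    and h_fixed: "AE x in M.
      transfer_op M r m0 (\<lambda>y. complex_of_real (h y)) x = complex_of_real (h x)"
  shows "hilbert_isomorphism (L2 (muhat M r m0 h)) (seq_space M r m0 h) (Phi M r m0 h) \<and>
    transform_conditions M r m0 h (Phi M r m0 h) \<and>
    (\<forall>\<Psi>. hilbert_isomorphism (L2 (muhat M r m0 h)) (seq_space M r m0 h) \<Psi> \<and>
          transform_conditions M r m0 h \<Psi> \<longrightarrow>
          (\<forall>F\<in>hcarrier (L2 (muhat M r m0 h)). \<Psi> F = Phi M r m0 h F))"
proof -
  interpret prob_space M by (rule prob)
  interpret transfer_setting M r m0 h
    by unfold_locales fact+
  show ?thesis
    using Phi_isomorphism Phi_transform_conditions transform_unique unfolding P_def by blast
qed

end
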